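(* Let $M$ be an EMV-algebra without top element and let $N$ be an MV-algebra representing $M$. Then the set $\mathcal{PS}(M)$ of pre-states on $M$ is a Bauer simplex, and for each pre-state $s$ on $M$: (i) there is a unique regular Borel probability measure $\mu$ on $\mathcal B(\mathcal{SM}(N))$ such that $s(x)=\int_{\mathcal{SM}(N)}\bar{\hat x}(t)\,d\mu(t)$ for all $x\in M$, where $\bar{\hat x}:\mathcal S(N)\to[0,1]$ is the continuous map $\bar{\hat x}(t)=t(x)$; (ii) there is a unique regular Borel measure $\mu_s$ (a non-negative $\sigma$-additive regular measure, not necessarily a probability) on $\mathcal B(\mathcal{SM}(M))$ such that $s(x)=\int_{\mathcal{SM}(M)}\hat x(t)\,d\mu_s(t)$ for all $x\in M$, where $\hat x:\mathcal{PS}(M)\to[0,1]$ is the continuous affine map $\hat x(t)=t(x)$.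
   Context: An EMV-algebra is an algebra $(M;\vee,\wedge,\oplus,0)$ of type $\langle 2,2,2,0\rangle$ such that: (i) $(M;\oplus,0)$ is a commutative monoid with neutral element $0$; (ii) $(M;\vee,\wedge,0)$ is a distributive lattice with bottom $0$ (order $\le$); (iii) for each idempotent $a$ ($a\oplus a=a$; set $\mathcal I(M)$), $([0,a];\oplus,\lambda_a,0,a)$ is an MV-algebra, where $[0,a]=\{x:0\le x\le a\}$ and $\lambda_a(x)=\min\{z\in[0,a]:z\oplus x=a\}$; (iv) each element lies below some idempotent. For $x,y\le a\in\mathcal I(M)$, $x\odot y=\lambda_a(\lambda_a(x)\oplus\lambda_a(y))$; $x+y$ is defined iff $x\odot y=0$, then $x+y=x\oplus y$. A pre-state is a map $s:M\to[0,1]$ with $s(x+y)=s(x)+s(y)$ whenever $x+y$ is defined; $\mathcal{PS}(M)$ is their set. A state-morphism on $M$ is a map $s:M\to[0,1]$ preserving $\vee,\wedge,\oplus$ (with $u\oplus v=\min\{u+v,1\}$) and $0$, with $s(\lambda_b(x))=s(b)-s(x)$ for $b\in\mathcal I(M)$, $x\le b$, and attaining $1$; $\mathcal{SM}(M)$ is their set. All these sets carry the weak topology induced by the product topology of $[0,1]^M$ (resp. $[0,1]^N$). An MV-algebra $(N;\oplus,^*,0,1)$ represents $M$ if $M\subseteq N$ is a maximal ideal of $N$, the operations $\vee,\wedge,\oplus$ of $M$ are the restrictions of those of $N$ and $\lambda_a(x)=a\odot x^*$ for $a\in\mathcal I(M)$, $x\le a$, and every element of $N$ either lies in $M$ or is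 $x_0^*$ for some $x_0\in M$. A state on $N$ is a map $t:N\to[0,1]$ with $t(1)=1$ and $t(x\oplus y)=t(x)+t(y)$ whenever $x\odot y=0$; $\mathcal S(N)$ is their set; $\mathcal{SM}(N)$ is the set of MV-homomorphisms $N\to[0,1]$. A Borel measure $\mu$ on $\mathcal B(K)$, $K$ Hausdorff, is regular if $\inf\{\mu(O):Y\subseteq O, O\text{ open}\}=\mu(Y)=\sup\{\mu(C):C\subseteq Y, C\text{ compact}\}$ for all Borel $Y$. A simplex is a convex set affinely isomorphic to a base of a lattice cone (a strict convex cone which is a lattice in its induced order; a base is a convex subset $K$ of the cone such that every non-zero cone element is uniquely $\alpha x$ with $\alpha>0$, $x\in K$); a Bauer simplex is a simplex $K$ in a locally convex Hausdorff space such that $K$ and its set of extreme points are compact. *)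

theory Defs
  imports "HOL-Probability.Probability" "HOL-Library.Function_Algebras"
begin

record 'a mv =
  mv_carrier :: "'a set"
  mv_plus :: "'a \<Rightarrow> 'a \<Rightarrow> 'a"
  mv_neg :: "'a \<Rightarrow> 'a"
  mv_zero :: 'a
  mv_one :: 'a

locale mv_algebra =
  fixes N :: "'a mv"
  assumes plus_closed: "x \<in> mv_carrier N \<Longrightarrow> y \<in> mv_carrier N \<Longrightarrow> mv_plus N x y \<in> mv_carrier N"
    and neg_closed: "x \<in> mv_carrier N \<Longrightarrow> mv_neg N x \<in> mv_carrier N"
    and zero_closed: "mv_zero N \<in> mv_carrier N"
    and one_closed: "mv_one N \<in> mv_carrier N"
    and plus_assoc: "x \<in> mv_carrier N \<Longrightarrow> y \<in> mv_carrier N \<Longrightarrow> z \<in> mv_carrier N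
          \<Longrightarrow> mv_plus N (mv_plus N x y) z = mv_plus N x (mv_plus N y z)"
    and plus_comm: "x \<in> mv_carrier N \<Longrightarrow> y \<in> mv_carrier N \<Longrightarrow> mv_plus N x y = mv_plus N y x"
    and plus_zero: "x \<in> mv_carrier N \<Longrightarrow> mv_plus N x (mv_zero N) = x"
    and neg_neg: "x \<in> mv_carrier N \<Longrightarrow> mv_neg N (mv_neg N x) = x"
    and neg_zero: "mv_neg N (mv_zero N) = mv_one N"
    and plus_one: "x \<in> mv_carrier N \<Longrightarrow> mv_plus N x (mv_one N) = mv_one N"
    and lukasiewicz: "x \<in> mv_carrier N \<Longrightarrow> y \<in> mv_carrier N
          \<Longrightarrow> mv_plus N (mv_neg N (mv_plus N (mv_neg N x) y)) y
            = mv_plus N (mv_neg N (mv_plus N (mv_neg N y) x)) x"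

definition mv_odot :: "'a mv \<Rightarrow> 'a \<Rightarrow> 'a \<Rightarrow> 'a" where
  "mv_odot N x y = mv_neg N (mv_plus N (mv_neg N x) (mv_neg N y))"

definition mv_join :: "'a mv \<Rightarrow> 'a \<Rightarrow> 'a \<Rightarrow> 'a" where
  "mv_join N x y = mv_plus N (mv_odot N x (mv_neg N y)) y"

definition mv_meet :: "'a mv \<Rightarrow> 'a \<Rightarrow> 'a \<Rightarrow> 'a" where
  "mv_meet N x y = mv_odot N x (mv_plus N (mv_neg N x) y)"

definition mv_le :: "'a mv \<Rightarrow> 'a \<Rightarrow> 'a \<Rightarrow> bool" where
  "mv_le N x y \<longleftrightarrow> mv_meet N x y = x"

definition mv_ideal :: "'a mv \<Rightarrow> 'a set \<Rightarrow> bool" where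
  "mv_ideal N I \<longleftrightarrow> I \<subseteq> mv_carrier N \<and> I \<noteq> {}
     \<and> (\<forall>x\<in>I. \<forall>y\<in>I. mv_plus N x y \<in> I)
     \<and> (\<forall>x\<in>I. \<forall>y\<in>mv_carrier N. mv_le N y x \<longrightarrow> y \<in> I)"

definition mv_maximal_ideal :: "'a mv \<Rightarrow> 'a set \<Rightarrow> bool" where
  "mv_maximal_ideal N I \<longleftrightarrow> mv_ideal N I \<and> I \<noteq> mv_carrier N
     \<and> (\<forall>J. mv_ideal N J \<and> I \<subseteq> J \<and> J \<noteq> mv_carrier N \<longrightarrow> J = I)"

record 'a emv =
  emv_carrier :: "'a set"
  emv_join :: "'a \<Rightarrow> 'a \<Rightarrow> 'a"
  emv_meet :: "'a \<Rightarrow> 'a \<Rightarrow> 'a"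
  emv_plus :: "'a \<Rightarrow> 'a \<Rightarrow> 'a"
  emv_zero :: 'a

definition emv_le :: "'a emv \<Rightarrow> 'a \<Rightarrow> 'a \<Rightarrow> bool" where
  "emv_le M x y \<longleftrightarrow> emv_meet M x y = x"

definition emv_idem :: "'a emv \<Rightarrow> 'a set" where
  "emv_idem M = {a \<in> emv_carrier M. emv_plus M a a = a}"

definition emv_interval :: "'a emv \<Rightarrow> 'a \<Rightarrow> 'a set" where
  "emv_interval M a = {x \<in> emv_carrier M. emv_le M (emv_zero M) x \<and> emv_le M x a}"

text \<open>\<open>emv_is_lam M a x z\<close> says \<open>z = min {w \<in> [0,a]. w \<oplus> x = a}\<close>; the existence of this minimum is
  part of the axioms of an EMV-algebra below, so \<open>emv_lam\<close> is well defined there.\<close>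

definition emv_is_lam :: "'a emv \<Rightarrow> 'a \<Rightarrow> 'a \<Rightarrow> 'a \<Rightarrow> bool" where
  "emv_is_lam M a x z \<longleftrightarrow> z \<in> emv_interval M a \<and> emv_plus M z x = a
     \<and> (\<forall>w\<in>emv_interval M a. emv_plus M w x = a \<longrightarrow> emv_le M z w)"

definition emv_lam :: "'a emv \<Rightarrow> 'a \<Rightarrow> 'a \<Rightarrow> 'a" where
  "emv_lam M a x = (THE z. emv_is_lam M a x z)"

definition emv_interval_mv :: "'a emv \<Rightarrow> 'a \<Rightarrow> 'a mv" where
  "emv_interval_mv M a = \<lparr>mv_carrier = emv_interval M a, mv_plus = emv_plus M,
     mv_neg = emv_lam M a, mv_zero = emv_zero M, mv_one = a\<rparr>"

locale emv_algebra =
  fixes M :: "'a emv"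
  assumes plus_closed: "x \<in> emv_carrier M \<Longrightarrow> y \<in> emv_carrier M \<Longrightarrow> emv_plus M x y \<in> emv_carrier M"
    and join_closed: "x \<in> emv_carrier M \<Longrightarrow> y \<in> emv_carrier M \<Longrightarrow> emv_join M x y \<in> emv_carrier M"
    and meet_closed: "x \<in> emv_carrier M \<Longrightarrow> y \<in> emv_carrier M \<Longrightarrow> emv_meet M x y \<in> emv_carrier M"
    and zero_closed: "emv_zero M \<in> emv_carrier M"
    and plus_assoc: "x \<in> emv_carrier M \<Longrightarrow> y \<in> emv_carrier M \<Longrightarrow> z \<in> emv_carrier M
          \<Longrightarrow> emv_plus M (emv_plus M x y) z = emv_plus M x (emv_plus M y z)"
    and plus_comm: "x \<in> emv_carrier M \<Longrightarrow> y \<in> emv_carrier M \<Longrightarrow> emv_plus M x y = emv_plus M y x"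
    and plus_zero: "x \<in> emv_carrier M \<Longrightarrow> emv_plus M x (emv_zero M) = x"
    and join_assoc: "x \<in> emv_carrier M \<Longrightarrow> y \<in> emv_carrier M \<Longrightarrow> z \<in> emv_carrier M
          \<Longrightarrow> emv_join M (emv_join M x y) z = emv_join M x (emv_join M y z)"
    and join_comm: "x \<in> emv_carrier M \<Longrightarrow> y \<in> emv_carrier M \<Longrightarrow> emv_join M x y = emv_join M y x"
    and meet_assoc: "x \<in> emv_carrier M \<Longrightarrow> y \<in> emv_carrier M \<Longrightarrow> z \<in> emv_carrier M
          \<Longrightarrow> emv_meet M (emv_meet M x y) z = emv_meet M x (emv_meet M y z)"
    and meet_comm: "x \<in> emv_carrier M \<Longrightarrow> y \<in> emv_carrier M \<Longrightarrow> emv_meet M x y = emv_meet M y x"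
    and join_absorb: "x \<in> emv_carrier M \<Longrightarrow> y \<in> emv_carrier M \<Longrightarrow> emv_join M x (emv_meet M x y) = x"
    and meet_absorb: "x \<in> emv_carrier M \<Longrightarrow> y \<in> emv_carrier M \<Longrightarrow> emv_meet M x (emv_join M x y) = x"
    and meet_join_distrib: "x \<in> emv_carrier M \<Longrightarrow> y \<in> emv_carrier M \<Longrightarrow> z \<in> emv_carrier M
          \<Longrightarrow> emv_meet M x (emv_join M y z) = emv_join M (emv_meet M x y) (emv_meet M x z)"
    and zero_bot: "x \<in> emv_carrier M \<Longrightarrow> emv_le M (emv_zero M) x"
    and lam_exists: "a \<in> emv_idem M \<Longrightarrow> x \<in> emv_interval M a \<Longrightarrow> \<exists>z. emv_is_lam M a x z"
    and interval_mv: "a \<in> emv_idem M \<Longrightarrow> mv_algebra (emv_interval_mv M a)"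
    and below_idem: "x \<in> emv_carrier M \<Longrightarrow> \<exists>a\<in>emv_idem M. emv_le M x a"

definition emv_has_top :: "'a emv \<Rightarrow> bool" where
  "emv_has_top M \<longleftrightarrow> (\<exists>e\<in>emv_carrier M. \<forall>x\<in>emv_carrier M. emv_le M x e)"

definition emv_odot :: "'a emv \<Rightarrow> 'a \<Rightarrow> 'a \<Rightarrow> 'a \<Rightarrow> 'a" where
  "emv_odot M a x y = emv_lam M a (emv_plus M (emv_lam M a x) (emv_lam M a y))"

text \<open>\<open>emv_odot M a x y\<close> is meant to be independent of the idempotent \<open>a\<close> above \<open>x\<close> and \<open>y\<close>, as
  it is when \<open>M\<close> is represented by an MV-algebra. With the existential quantifier below,
  additivity of a pre-state is required for every choice of \<open>a\<close>.\<close>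

definition emv_sum_defined :: "'a emv \<Rightarrow> 'a \<Rightarrow> 'a \<Rightarrow> bool" where
  "emv_sum_defined M x y \<longleftrightarrow>
     (\<exists>a\<in>emv_idem M. emv_le M x a \<and> emv_le M y a \<and> emv_odot M a x y = emv_zero M)"

text \<open>The zero of \<open>M\<close> is automatically that of \<open>N\<close>: both are neutral for the same
  operation on \<open>M\<close>.\<close>

definition mv_represents :: "'a mv \<Rightarrow> 'a emv \<Rightarrow> bool" where
  "mv_represents N M \<longleftrightarrow>
     mv_maximal_ideal N (emv_carrier M)
     \<and> (\<forall>x\<in>emv_carrier M. \<forall>y\<in>emv_carrier M.
          emv_join M x y = mv_join N x y \<and> emv_meet M x y = mv_meet N x y
          \<and> emv_plus M x y = mv_plus N x y)
     \<and> (\<forall>a\<in>emv_idem M. \<forall>x\<in>emv_carrier M. emv_le M x a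
          \<longrightarrow> emv_lam M a x = mv_odot N a (mv_neg N x))
     \<and> (\<forall>x\<in>mv_carrier N. x \<in> emv_carrier M \<or> (\<exists>x0\<in>emv_carrier M. x = mv_neg N x0))"

text \<open>A map from a carrier \<open>A \<subseteq> UNIV\<close> to \<open>[0,1]\<close> is represented by the function on the whole
  type that is extended by \<open>0\<close> outside \<open>A\<close>. This identifies \<open>\<real>\<^sup>A\<close> with a linear subspace of
  \<open>'a \<Rightarrow> real\<close>, and the product topology of \<open>[0,1]\<^sup>A\<close> with the topology induced from the
  library's product topology on \<open>'a \<Rightarrow> real\<close>.\<close>

definition unit_maps :: "'a set \<Rightarrow> ('a \<Rightarrow> real) set" where
  "unit_maps A = {s. (\<forall>x\<in>A. 0 \<le> s x \<and> s x \<le> 1) \<and> (\<forall>x. x \<notin> A \<longrightarrow> s x = 0)}"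

definition pre_states :: "'a emv \<Rightarrow> ('a \<Rightarrow> real) set" where
  "pre_states M = {s \<in> unit_maps (emv_carrier M).
     \<forall>x\<in>emv_carrier M. \<forall>y\<in>emv_carrier M. emv_sum_defined M x y
       \<longrightarrow> s (emv_plus M x y) = s x + s y}"

definition emv_state_morphisms :: "'a emv \<Rightarrow> ('a \<Rightarrow> real) set" where
  "emv_state_morphisms M = {s \<in> unit_maps (emv_carrier M).
     (\<forall>x\<in>emv_carrier M. \<forall>y\<in>emv_carrier M.
        s (emv_join M x y) = max (s x) (s y)
        \<and> s (emv_meet M x y) = min (s x) (s y)
        \<and> s (emv_plus M x y) = min (s x + s y) 1)
     \<and> s (emv_zero M) = 0
     \<and> (\<forall>b\<in>emv_idem M. \<forall>x\<in>emv_carrier M. emv_le M x b \<longrightarrow> s (emv_lam M b x) = s b - s x)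
     \<and> (\<exists>x\<in>emv_carrier M. s x = 1)}"

definition mv_states :: "'a mv \<Rightarrow> ('a \<Rightarrow> real) set" where
  "mv_states N = {t \<in> unit_maps (mv_carrier N).
     t (mv_one N) = 1
     \<and> (\<forall>x\<in>mv_carrier N. \<forall>y\<in>mv_carrier N. mv_odot N x y = mv_zero N
          \<longrightarrow> t (mv_plus N x y) = t x + t y)}"

definition mv_state_morphisms :: "'a mv \<Rightarrow> ('a \<Rightarrow> real) set" where
  "mv_state_morphisms N = {t \<in> unit_maps (mv_carrier N).
     (\<forall>x\<in>mv_carrier N. \<forall>y\<in>mv_carrier N. t (mv_plus N x y) = min (t x + t y) 1)
     \<and> (\<forall>x\<in>mv_carrier N. t (mv_neg N x) = 1 - t x)
     \<and> t (mv_zero N) = 0 \<and> t (mv_one N) = 1}"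

definition evaluation :: "'a \<Rightarrow> ('a \<Rightarrow> real) \<Rightarrow> real" where
  "evaluation x t = t x"

text \<open>The last conjunct of \<open>locally_convex\<close> is the unfolded \<open>convex V\<close>, which cannot be used
  inside the class declaration itself.\<close>

class locally_convex_hausdorff = real_vector + topological_ab_group_add + t2_space +
  assumes tendsto_scaleR_Pair: "LIM p (nhds c \<times>\<^sub>F nhds x). fst p *\<^sub>R snd p :> nhds (c *\<^sub>R x)"
    and locally_convex: "open U \<Longrightarrow> x \<in> U \<Longrightarrow> \<exists>V. open V \<and> x \<in> V \<and> V \<subseteq> U
      \<and> (\<forall>a\<in>V. \<forall>b\<in>V. \<forall>u\<ge>0. \<forall>v\<ge>0. u + v = 1 \<longrightarrow> u *\<^sub>R a + v *\<^sub>R b \<in> V)"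

instance real :: locally_convex_hausdorff
proof
  show "LIM p (nhds c \<times>\<^sub>F nhds x). fst p *\<^sub>R snd p :> nhds (c *\<^sub>R x)" for c x :: real
    by (intro tendsto_intros filterlim_fst filterlim_snd)
  show "\<exists>V. open V \<and> x \<in> V \<and> V \<subseteq> U
      \<and> (\<forall>a\<in>V. \<forall>b\<in>V. \<forall>u\<ge>0. \<forall>v\<ge>0. u + v = 1 \<longrightarrow> u *\<^sub>R a + v *\<^sub>R b \<in> V)"
    if U: "open U" "x \<in> U" for U and x :: real
  proof -
    from U obtain e where e: "e > 0" "ball x e \<subseteq> U"
      by (meson open_contains_ball)
    then show ?thesis
      using convex_ball[of x e] by (intro exI[of _ "ball x e"]) (simp add: convex_def)
  qed
qed

instantiation "fun" :: (type, real_vector) real_vector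
begin

definition scaleR_fun :: "real \<Rightarrow> ('a \<Rightarrow> 'b) \<Rightarrow> 'a \<Rightarrow> 'b" where
  "scaleR_fun c f = (\<lambda>x. c *\<^sub>R f x)"

instance
  by standard (auto simp: scaleR_fun_def fun_eq_iff scaleR_add_right scaleR_add_left)

end

lemma open_coord_vimage:
  fixes U :: "'b::topological_space set"
  assumes "open U"
  shows "open ((\<lambda>h :: 'a \<Rightarrow> 'b. h i) -` U)"
  using assms by (intro open_vimage) (auto intro: continuous_on_product_coordinates)

instance "fun" :: (type, t0_space) t0_space
proof
  fix f g :: "'a \<Rightarrow> 'b"
  assume "f \<noteq> g"
  then obtain i where "f i \<noteq> g i" by auto
  then obtain U where U: "open U" "\<not> (f i \<in> U \<longleftrightarrow> g i \<in> U)"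
    by (metis separation_t0)
  show "\<exists>U. open U \<and> \<not> (f \<in> U \<longleftrightarrow> g \<in> U)"
    by (rule exI[of _ "(\<lambda>h. h i) -` U"]) (use U in \<open>auto intro: open_coord_vimage\<close>)
qed

instance "fun" :: (type, t1_space) t1_space
proof
  fix f g :: "'a \<Rightarrow> 'b"
  assume "f \<noteq> g"
  then obtain i where "f i \<noteq> g i" by auto
  then obtain U where U: "open U" "f i \<in> U" "g i \<notin> U"
    by (metis separation_t1)
  show "\<exists>U. open U \<and> f \<in> U \<and> g \<notin> U"
    by (rule exI[of _ "(\<lambda>h. h i) -` U"]) (use U in \<open>auto intro: open_coord_vimage\<close>)
qed

instance "fun" :: (type, t2_space) t2_space
proof
  fix f g :: "'a \<Rightarrow> 'b"
  assume "f \<noteq> g"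
  then obtain i where "f i \<noteq> g i" by auto
  then obtain U V where UV: "open U" "open V" "f i \<in> U" "g i \<in> V" "U \<inter> V = {}"
    by (metis hausdorff)
  show "\<exists>U V. open U \<and> open V \<and> f \<in> U \<and> g \<in> V \<and> U \<inter> V = {}"
    by (rule exI[of _ "(\<lambda>h. h i) -` U"], rule exI[of _ "(\<lambda>h. h i) -` V"])
      (use UV in \<open>auto intro: open_coord_vimage\<close>)
qed

lemma tendsto_funI:
  fixes l :: "'a \<Rightarrow> 'b::topological_space"
  assumes "\<And>i. ((\<lambda>p. f p i) \<longlongrightarrow> l i) F"
  shows "(f \<longlongrightarrow> l) F"
  using assms limitin_componentwise[of "\<lambda>_. euclidean" UNIV f l F]
  by (simp add: euclidean_product_topology)

lemma tendsto_fun_apply_nhds: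
  fixes f0 :: "'a \<Rightarrow> 'b::topological_space"
  shows "((\<lambda>f. f i) \<longlongrightarrow> f0 i) (nhds f0)"
  using limitin_componentwise[of "\<lambda>_. euclidean" UNIV "\<lambda>f. f" f0 "nhds f0"]
  by (simp add: euclidean_product_topology filterlim_ident)

instance "fun" :: (type, topological_ab_group_add) topological_ab_group_add
proof
  show "LIM x (nhds a \<times>\<^sub>F nhds b). fst x + snd x :> nhds (a + b)" for a b :: "'a \<Rightarrow> 'b"
    unfolding plus_fun_def
    by (intro tendsto_funI tendsto_add
          filterlim_compose[OF tendsto_fun_apply_nhds filterlim_fst]
          filterlim_compose[OF tendsto_fun_apply_nhds filterlim_snd])
  show "(uminus \<longlongrightarrow> - a) (nhds a)" for a :: "'a \<Rightarrow> 'b"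
    by (rule tendsto_funI) (auto intro!: tendsto_minus tendsto_fun_apply_nhds)
qed

lemma tendsto_scaleR_lch:
  fixes x :: "'b::locally_convex_hausdorff"
  assumes "(f \<longlongrightarrow> c) F" "(g \<longlongrightarrow> x) F"
  shows "((\<lambda>p. f p *\<^sub>R g p) \<longlongrightarrow> c *\<^sub>R x) F"
  using filterlim_compose[OF tendsto_scaleR_Pair filterlim_Pair[OF assms]] by simp

instance "fun" :: (type, locally_convex_hausdorff) locally_convex_hausdorff
proof
  show "LIM p (nhds c \<times>\<^sub>F nhds x). fst p *\<^sub>R snd p :> nhds (c *\<^sub>R x)" for c and x :: "'a \<Rightarrow> 'b"
    unfolding scaleR_fun_def
    by (intro tendsto_funI tendsto_scaleR_lch filterlim_fst
          filterlim_compose[OF tendsto_fun_apply_nhds filterlim_snd])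
  fix U and x :: "'a \<Rightarrow> 'b"
  assume "open U" "x \<in> U"
  then obtain X where X: "x \<in> Pi\<^sub>E UNIV X" "\<And>i. open (X i)"
      "finite {i. X i \<noteq> UNIV}" "Pi\<^sub>E UNIV X \<subseteq> U"
    using product_topology_open_contains_basis[of "\<lambda>_. euclidean" UNIV U x]
    by (auto simp: open_fun_def)
  have "\<exists>V. open V \<and> x i \<in> V \<and> V \<subseteq> X i \<and> (X i = UNIV \<longrightarrow> V = UNIV)
      \<and> (\<forall>a\<in>V. \<forall>b\<in>V. \<forall>u\<ge>0. \<forall>v\<ge>0. u + v = 1 \<longrightarrow> u *\<^sub>R a + v *\<^sub>R b \<in> V)" for i
  proof (cases "X i = UNIV")
    case True
    then show ?thesis by auto
  next
    case False
    then show ?thesis using locally_convex[of "X i" "x i"] X by auto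
  qed
  then obtain W where W: "\<And>i. open (W i)" "\<And>i. x i \<in> W i" "\<And>i. W i \<subseteq> X i"
      "\<And>i. X i = UNIV \<Longrightarrow> W i = UNIV"
      "\<And>i a b u v. a \<in> W i \<Longrightarrow> b \<in> W i \<Longrightarrow> u \<ge> 0 \<Longrightarrow> v \<ge> 0 \<Longrightarrow> u + v = 1
         \<Longrightarrow> u *\<^sub>R a + v *\<^sub>R b \<in> W i"
    by metis
  have "finite {i. W i \<noteq> UNIV}"
    by (rule finite_subset[OF _ X(3)]) (use W(4) in auto)
  then have "open (Pi\<^sub>E UNIV W)"
    using W(1) by (intro open_PiE) auto
  then show "\<exists>V. open V \<and> x \<in> V \<and> V \<subseteq> U
      \<and> (\<forall>a\<in>V. \<forall>b\<in>V. \<forall>u\<ge>0. \<forall>v\<ge>0. u + v = 1 \<longrightarrow> u *\<^sub>R a + v *\<^sub>R b \<in> V)"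
    using W X(4) by (intro exI[of _ "Pi\<^sub>E UNIV W"])
      (fastforce simp: PiE_iff plus_fun_def scaleR_fun_def)
qed

definition cone_le :: "'v::real_vector set \<Rightarrow> 'v \<Rightarrow> 'v \<Rightarrow> bool" where
  "cone_le C x y \<longleftrightarrow> y - x \<in> C"

definition lattice_cone :: "'v::real_vector set \<Rightarrow> bool" where
  "lattice_cone C \<longleftrightarrow> convex_cone C \<and> C \<inter> uminus ` C = {0}
     \<and> (\<forall>x\<in>C. \<forall>y\<in>C.
          (\<exists>u\<in>C. cone_le C x u \<and> cone_le C y u
             \<and> (\<forall>w\<in>C. cone_le C x w \<and> cone_le C y w \<longrightarrow> cone_le C u w))
        \<and> (\<exists>l\<in>C. cone_le C l x \<and> cone_le C l y
             \<and> (\<forall>w\<in>C. cone_le C w x \<and> cone_le C w y \<longrightarrow> cone_le C w l)))"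

definition cone_base :: "'v::real_vector set \<Rightarrow> 'v set \<Rightarrow> bool" where
  "cone_base C B \<longleftrightarrow> B \<subseteq> C \<and> convex B
     \<and> (\<forall>y\<in>C. y \<noteq> 0 \<longrightarrow> (\<exists>!p. fst p > (0::real) \<and> snd p \<in> B \<and> y = fst p *\<^sub>R snd p))"

definition affine_iso :: "'v::real_vector set \<Rightarrow> 'w::real_vector set \<Rightarrow> ('v \<Rightarrow> 'w) \<Rightarrow> bool" where
  "affine_iso K B f \<longleftrightarrow> bij_betw f K B
     \<and> (\<forall>x\<in>K. \<forall>y\<in>K. \<forall>u\<in>{0..1}. f ((1 - u) *\<^sub>R x + u *\<^sub>R y) = (1 - u) *\<^sub>R f x + u *\<^sub>R f y)"

text \<open>HOL cannot quantify over the vector space containing the cone. Taking \<open>'v \<times> real\<close> is no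
  restriction: an affine isomorphism of \<open>K \<subseteq> 'v\<close> with a base of some lattice cone extends to an
  isomorphism of that cone with the cone generated by \<open>K \<times> {1}\<close>.\<close>

definition simplex_set :: "'v::real_vector set \<Rightarrow> bool" where
  "simplex_set K \<longleftrightarrow> convex K
     \<and> (\<exists>(C :: ('v \<times> real) set) B f. lattice_cone C \<and> cone_base C B \<and> affine_iso K B f)"

definition bauer_simplex :: "'v::locally_convex_hausdorff set \<Rightarrow> bool" where
  "bauer_simplex K \<longleftrightarrow> simplex_set K \<and> compact K \<and> compact {x. x extreme_point_of K}"

text \<open>\<open>restrict_space borel K\<close> carries the Borel \<open>\<sigma>\<close>-algebra of the subspace \<open>K\<close>.\<close>

definition regular_borel_measure :: "'b::t2_space set \<Rightarrow> 'b measure \<Rightarrow> bool" where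
  "regular_borel_measure K \<mu> \<longleftrightarrow> sets \<mu> = sets (restrict_space borel K)
     \<and> (\<forall>Y\<in>sets \<mu>.
          (INF U\<in>{U. openin (top_of_set K) U \<and> Y \<subseteq> U}. emeasure \<mu> U) = emeasure \<mu> Y
        \<and> emeasure \<mu> Y = (SUP C\<in>{C. compact C \<and> C \<subseteq> Y}. emeasure \<mu> C))"

end

theory Submission
  imports Defs
begin

text \<open>A pre-state on \<open>M\<close> extends to a state on \<open>N\<close> by \<open>x\<^sub>0\<^sup>* \<mapsto> 1 - s(x\<^sub>0)\<close>, which identifies the pre-states
  affinely with the states of \<open>N\<close>. Extreme states are morphisms, because the part of an extreme
  state carried by the ideal of an element is \<open>0\<close> or everything, so that linear combinations of
  elements are dominated by their values at the morphisms. This turns states into functionals on a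
  clan of \<open>[0,1]\<close>-valued continuous functions on the compact space of morphisms. Such a clan
  separates disjoint compact sets, hence a functional induces a content on compact sets and a
  regular measure that represents it. The positive functionals form a lattice by the Riesz formula,
  evaluated pointwise on the morphisms. Deleting the zero map from the closure of the
  state-morphisms of \<open>M\<close> yields the measure on the state-morphisms of \<open>M\<close>.\<close>

section \<open>MV-algebras and extreme states\<close>

text \<open>The functions \<open>evaluation x\<close> do not form a vector space, and since
  \<open>N\<close> may contain infinitesimals they need not even determine \<open>x\<close>. A
  functional is therefore never extended to a linear span: what is proved about it is that a bound
  on a finite linear combination that holds at every morphism also holds for the functional.
  Linearity, positivity and dependence on values alone all follow from that. Pre-states are not
  normalised and the zero map is one of them; moreover the state-morphisms of \<open>M\<close> are
  only locally compact. On \<open>N\<close> both defects vanish: the states are cut out of the cone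
  of positive functionals by the value 1 at the unit, and the morphisms are compact. The zero map is
  the point at infinity of the state-morphisms. Mass placed there is invisible to the elements of
  \<open>M\<close>, which is why the measure in (ii) need not be a probability.\<close>

definition mv_functionals :: "'a mv \<Rightarrow> ('a \<Rightarrow> real) set" where
  "mv_functionals N = {F. (\<forall>x\<in>mv_carrier N. 0 \<le> F x) \<and> (\<forall>x. x \<notin> mv_carrier N \<longrightarrow> F x = 0)
     \<and> (\<forall>x\<in>mv_carrier N. \<forall>y\<in>mv_carrier N. mv_odot N x y = mv_zero N
          \<longrightarrow> F (mv_plus N x y) = F x + F y)}"

context mv_algebra
begin

abbreviation carr where "carr \<equiv> mv_carrier N"
abbreviation pl (infixl \<open>\<oplus>\<close> 65) where "x \<oplus> y \<equiv> mv_plus N x y"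
abbreviation ot (infixl \<open>\<odot>\<close> 70) where "x \<odot> y \<equiv> mv_odot N x y"
abbreviation ng (\<open>\<sim>_\<close> [80] 80) where "\<sim>x \<equiv> mv_neg N x"
abbreviation mt (infixl \<open>\<sqinter>\<^sub>N\<close> 70) where "x \<sqinter>\<^sub>N y \<equiv> mv_meet N x y"
abbreviation zr (\<open>\<zero>\<close>) where "\<zero> \<equiv> mv_zero N"
abbreviation on (\<open>\<one>\<close>) where "\<one> \<equiv> mv_one N"
abbreviation lq (infix \<open>\<preceq>\<close> 50) where "x \<preceq> y \<equiv> mv_le N x y"

declare plus_closed [simp, intro] neg_closed [simp, intro] zero_closed [simp, intro] one_closed [simp, intro]
declare neg_neg [simp] neg_zero [simp] plus_one [simp] plus_zero [simp]

section \<open>Order and lattice arithmetic of MV-algebras\<close>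

lemma odot_closed [simp, intro]: "x \<in> carr \<Longrightarrow> y \<in> carr \<Longrightarrow> x \<odot> y \<in> carr"
  by (simp add: mv_odot_def)

lemma meet_closed [simp, intro]: "x \<in> carr \<Longrightarrow> y \<in> carr \<Longrightarrow> x \<sqinter>\<^sub>N y \<in> carr"
  by (simp add: mv_meet_def)

lemma neg_one [simp]: "\<sim>\<one> = \<zero>"
  using neg_neg[of \<zero>] by simp

lemma zero_plus [simp]: "x \<in> carr \<Longrightarrow> \<zero> \<oplus> x = x"
  using plus_comm[of \<zero> x] by simp

lemma one_plus [simp]: "x \<in> carr \<Longrightarrow> \<one> \<oplus> x = \<one>"
  using plus_comm[of \<one> x] by simp

lemma plus_lcomm: "x \<in> carr \<Longrightarrow> y \<in> carr \<Longrightarrow> z \<in> carr \<Longrightarrow> x \<oplus> (y \<oplus> z) = y \<oplus> (x \<oplus> z)"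
  by (metis plus_assoc plus_comm)

lemmas plus_ac = plus_assoc plus_comm plus_lcomm

lemma plus_neg [simp]: "x \<in> carr \<Longrightarrow> x \<oplus> \<sim>x = \<one>"
  using lukasiewicz[of x \<one>] plus_comm[of x "\<sim>x"] by simp

lemma neg_plus [simp]: "x \<in> carr \<Longrightarrow> \<sim>x \<oplus> x = \<one>"
  using plus_comm[of x "\<sim>x"] by simp

lemma odot_comm: "x \<in> carr \<Longrightarrow> y \<in> carr \<Longrightarrow> x \<odot> y = y \<odot> x"
  by (simp add: mv_odot_def plus_comm)

lemma odot_assoc: "x \<in> carr \<Longrightarrow> y \<in> carr \<Longrightarrow> z \<in> carr \<Longrightarrow> x \<odot> y \<odot> z = x \<odot> (y \<odot> z)"
  by (simp add: mv_odot_def plus_assoc)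

lemma odot_lcomm: "x \<in> carr \<Longrightarrow> y \<in> carr \<Longrightarrow> z \<in> carr \<Longrightarrow> x \<odot> (y \<odot> z) = y \<odot> (x \<odot> z)"
  by (metis odot_assoc odot_comm)

lemma odot_neg [simp]: "x \<in> carr \<Longrightarrow> x \<odot> \<sim>x = \<zero>"
  by (simp add: mv_odot_def)

lemma odot_zero [simp]: "x \<in> carr \<Longrightarrow> x \<odot> \<zero> = \<zero>"
  by (simp add: mv_odot_def)

lemma one_odot [simp]: "x \<in> carr \<Longrightarrow> \<one> \<odot> x = x"
  by (simp add: mv_odot_def)

lemma odot_one [simp]: "x \<in> carr \<Longrightarrow> x \<odot> \<one> = x"
  by (simp add: mv_odot_def)

lemma neg_odot: "x \<in> carr \<Longrightarrow> y \<in> carr \<Longrightarrow> \<sim>(x \<odot> y) = \<sim>x \<oplus> \<sim>y"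
  by (simp add: mv_odot_def)

lemma neg_plus_distrib: "x \<in> carr \<Longrightarrow> y \<in> carr \<Longrightarrow> \<sim>(x \<oplus> y) = \<sim>x \<odot> \<sim>y"
  by (simp add: mv_odot_def)

text \<open>Negating \<open>x = x \<odot> (\<sim>x \<oplus> y)\<close> and adding \<open>y\<close>
  produces the unit; in this form order questions become equations about sums.\<close>

lemma le_iff: assumes "x \<in> carr" "y \<in> carr" shows "x \<preceq> y \<longleftrightarrow> \<sim>x \<oplus> y = \<one>"
proof
  assume "x \<preceq> y"
  then have "\<sim>x = \<sim>(x \<odot> (\<sim>x \<oplus> y))"
    by (simp add: mv_le_def mv_meet_def)
  then have "\<sim>x = \<sim>x \<oplus> \<sim>(\<sim>x \<oplus> y)"
    using assms by (simp add: neg_odot)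
  then have "\<sim>x \<oplus> y = \<sim>x \<oplus> \<sim>(\<sim>x \<oplus> y) \<oplus> y" by simp
  also have "\<dots> = (\<sim>x \<oplus> y) \<oplus> \<sim>(\<sim>x \<oplus> y)"
    using assms by (metis neg_closed plus_assoc plus_closed plus_comm)
  finally show "\<sim>x \<oplus> y = \<one>" using assms by simp
next
  assume "\<sim>x \<oplus> y = \<one>"
  then show "x \<preceq> y" using assms by (simp add: mv_le_def mv_meet_def)
qed

text \<open>De Morgan applied to the axiom \<open>lukasiewicz\<close> at the negated
  elements.\<close>

lemma meet_comm: assumes "x \<in> carr" "y \<in> carr" shows "x \<sqinter>\<^sub>N y = y \<sqinter>\<^sub>N x"
proof -
  have "\<sim>(x \<sqinter>\<^sub>N y) = \<sim>(y \<sqinter>\<^sub>N x)"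
    using assms lukasiewicz[of "\<sim>y" "\<sim>x"]
    by (simp add: mv_meet_def mv_odot_def plus_comm)
  then show ?thesis using assms by (metis neg_neg meet_closed)
qed

lemma le_refl [simp]: "x \<in> carr \<Longrightarrow> x \<preceq> x"
  by (simp add: le_iff)

lemma le_antisym: "x \<in> carr \<Longrightarrow> y \<in> carr \<Longrightarrow> x \<preceq> y \<Longrightarrow> y \<preceq> x \<Longrightarrow> x = y"
  by (metis meet_comm mv_le_def)

text \<open>For \<open>x \<preceq> y\<close> one side of the axiom \<open>lukasiewicz\<close>
  collapses to \<open>y\<close>. The order thereby becomes divisibility by sums, and transitivity
  and monotonicity reduce to adding remainders.\<close>

lemma le_sum: assumes "x \<in> carr" "y \<in> carr" "x \<preceq> y" shows "x \<oplus> (y \<odot> \<sim>x) = y"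
  using assms lukasiewicz[of y x] by (simp add: le_iff mv_odot_def plus_comm)

lemma le_plus [simp]: "x \<in> carr \<Longrightarrow> y \<in> carr \<Longrightarrow> x \<preceq> x \<oplus> y"
  by (simp add: le_iff flip: plus_assoc)

lemma le_plus2 [simp]: "x \<in> carr \<Longrightarrow> y \<in> carr \<Longrightarrow> y \<preceq> x \<oplus> y"
  by (metis le_plus plus_comm)

lemma le_trans: assumes "x \<in> carr" "y \<in> carr" "z \<in> carr" "x \<preceq> y" "y \<preceq> z" shows "x \<preceq> z"
proof -
  have "z = x \<oplus> ((y \<odot> \<sim>x) \<oplus> (z \<odot> \<sim>y))"
    using le_sum[of x y] le_sum[of y z] assms
    by (metis neg_closed odot_closed plus_assoc)
  then show ?thesis using assms le_plus[of x "(y \<odot> \<sim>x) \<oplus> (z \<odot> \<sim>y)"] by simp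
qed

lemma zero_le [simp]: "x \<in> carr \<Longrightarrow> \<zero> \<preceq> x"
  by (simp add: le_iff)

lemma le_zero: "x \<in> carr \<Longrightarrow> x \<preceq> \<zero> \<Longrightarrow> x = \<zero>"
  by (simp add: le_antisym)

lemma le_one [simp]: "x \<in> carr \<Longrightarrow> x \<preceq> \<one>"
  by (simp add: le_iff)

lemma neg_le_neg: "x \<in> carr \<Longrightarrow> y \<in> carr \<Longrightarrow> x \<preceq> y \<Longrightarrow> \<sim>y \<preceq> \<sim>x"
  by (simp add: le_iff plus_comm)

lemma plus_mono1: assumes "x \<in> carr" "y \<in> carr" "z \<in> carr" "x \<preceq> y" shows "x \<oplus> z \<preceq> y \<oplus> z"
proof -
  have "y \<oplus> z = (x \<oplus> z) \<oplus> (y \<odot> \<sim>x)"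
    using le_sum[OF assms(1,2,4)] assms by (metis neg_closed odot_closed plus_assoc plus_comm)
  then show ?thesis using assms by simp
qed

lemma plus_mono:
  assumes "x \<in> carr" "y \<in> carr" "z \<in> carr" "w \<in> carr" "x \<preceq> y" "z \<preceq> w"
  shows "x \<oplus> z \<preceq> y \<oplus> w"
proof (rule le_trans)
  show "x \<oplus> z \<preceq> y \<oplus> z" using assms by (simp add: plus_mono1)
  show "y \<oplus> z \<preceq> y \<oplus> w" using assms plus_mono1[of z w y] by (simp add: plus_comm)
qed (use assms in auto)

lemma odot_mono:
  assumes "x \<in> carr" "y \<in> carr" "z \<in> carr" "w \<in> carr" "x \<preceq> y" "z \<preceq> w"
  shows "x \<odot> z \<preceq> y \<odot> w"
  unfolding mv_odot_def using assms by (intro neg_le_neg plus_mono) auto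

lemma odot_le1 [simp]: "x \<in> carr \<Longrightarrow> y \<in> carr \<Longrightarrow> x \<odot> y \<preceq> x"
  using odot_mono[of x x y \<one>] by simp

lemma odot_le2 [simp]: "x \<in> carr \<Longrightarrow> y \<in> carr \<Longrightarrow> x \<odot> y \<preceq> y"
  using odot_mono[of x \<one> y y] by simp

lemma residuation:
  "x \<in> carr \<Longrightarrow> y \<in> carr \<Longrightarrow> z \<in> carr \<Longrightarrow> x \<odot> y \<preceq> z \<longleftrightarrow> y \<preceq> \<sim>x \<oplus> z"
  by (simp add: le_iff neg_odot plus_ac)

lemma meet_le1 [simp]: "x \<in> carr \<Longrightarrow> y \<in> carr \<Longrightarrow> x \<sqinter>\<^sub>N y \<preceq> x"
  by (simp add: mv_meet_def)

lemma meet_le2 [simp]: "x \<in> carr \<Longrightarrow> y \<in> carr \<Longrightarrow> x \<sqinter>\<^sub>N y \<preceq> y"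
  using meet_comm[of x y] by simp

lemma meet_eq: "x \<in> carr \<Longrightarrow> y \<in> carr \<Longrightarrow> x \<preceq> y \<Longrightarrow> x \<sqinter>\<^sub>N y = x"
  by (simp add: mv_le_def)

lemma meet_greatest:
  assumes "x \<in> carr" "y \<in> carr" "z \<in> carr" "z \<preceq> x" "z \<preceq> y" shows "z \<preceq> x \<sqinter>\<^sub>N y"
proof -
  have "z = x \<odot> (\<sim>x \<oplus> z)"
    using assms meet_comm[of z x] by (simp add: mv_le_def mv_meet_def)
  moreover have "x \<odot> (\<sim>x \<oplus> z) \<preceq> x \<sqinter>\<^sub>N y"
    unfolding mv_meet_def using assms by (intro odot_mono plus_mono) auto
  ultimately show ?thesis by simp
qed

text \<open>Residuation moves \<open>x\<close> to the other side, where only a common lower bound of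
  \<open>y\<close> and \<open>z\<close> is at stake.\<close>

lemma plus_meet_distrib:
  assumes "x \<in> carr" "y \<in> carr" "z \<in> carr"
  shows "(x \<oplus> y) \<sqinter>\<^sub>N (x \<oplus> z) \<preceq> x \<oplus> (y \<sqinter>\<^sub>N z)"
proof -
  let ?m = "(x \<oplus> y) \<sqinter>\<^sub>N (x \<oplus> z)"
  have "\<sim>x \<odot> ?m \<preceq> y" "\<sim>x \<odot> ?m \<preceq> z"
    using assms by (simp_all add: residuation)
  then have "\<sim>x \<odot> ?m \<preceq> y \<sqinter>\<^sub>N z" using assms by (simp add: meet_greatest)
  then show ?thesis using assms residuation[of "\<sim>x" ?m "y \<sqinter>\<^sub>N z"] by simp
qed

text \<open>Distributivity is used twice: \<open>c\<close> is enlarged to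
  \<open>y \<oplus> c\<close> and then to \<open>(x \<sqinter>\<^sub>N c) \<oplus> c\<close>, so
  that the summands are cut down one at a time.\<close>

lemma plus_meet_subdistrib:
  assumes "x \<in> carr" "y \<in> carr" "c \<in> carr"
  shows "(x \<oplus> y) \<sqinter>\<^sub>N c \<preceq> (x \<sqinter>\<^sub>N c) \<oplus> (y \<sqinter>\<^sub>N c)"
proof -
  let ?p = "(x \<oplus> y) \<sqinter>\<^sub>N c"
  have p: "?p \<in> carr" "?p \<preceq> x \<oplus> y" "?p \<preceq> c" using assms by auto
  have "?p \<preceq> (y \<oplus> x) \<sqinter>\<^sub>N (y \<oplus> c)"
    using p assms plus_comm[of x y] le_trans[of ?p c "y \<oplus> c"] by (intro meet_greatest) auto
  then have 1: "?p \<preceq> (x \<sqinter>\<^sub>N c) \<oplus> y"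
    using plus_meet_distrib[of y x c] plus_comm[of "x \<sqinter>\<^sub>N c" y] p assms
      le_trans[of ?p "(y \<oplus> x) \<sqinter>\<^sub>N (y \<oplus> c)" "y \<oplus> (x \<sqinter>\<^sub>N c)"] by simp
  have 2: "?p \<preceq> (x \<sqinter>\<^sub>N c) \<oplus> c"
    using p assms le_trans[of ?p c "(x \<sqinter>\<^sub>N c) \<oplus> c"] by simp
  have "?p \<preceq> ((x \<sqinter>\<^sub>N c) \<oplus> y) \<sqinter>\<^sub>N ((x \<sqinter>\<^sub>N c) \<oplus> c)"
    using 1 2 p assms by (intro meet_greatest) auto
  then show ?thesis
    using plus_meet_distrib[of "x \<sqinter>\<^sub>N c" y c] p assms
      le_trans[of ?p "((x \<sqinter>\<^sub>N c) \<oplus> y) \<sqinter>\<^sub>N ((x \<sqinter>\<^sub>N c) \<oplus> c)" "(x \<sqinter>\<^sub>N c) \<oplus> (y \<sqinter>\<^sub>N c)"] by simp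
qed

lemma odot_eq_zeroI:
  assumes "x \<in> carr" "y \<in> carr" "a \<in> carr" "b \<in> carr" "x \<preceq> a" "y \<preceq> b" "a \<odot> b = \<zero>"
  shows "x \<odot> y = \<zero>"
  using assms odot_mono[of x a y b] by (simp add: le_zero)

lemma meet_diff_disjoint: "x \<in> carr \<Longrightarrow> y \<in> carr \<Longrightarrow> (x \<sqinter>\<^sub>N y) \<odot> (x \<odot> \<sim>y) = \<zero>"
  by (rule odot_eq_zeroI[of _ _ y "\<sim>y"]) auto

text \<open>Needed so that a functional splits along \<open>y\<close>: the excess of
  \<open>x\<close> over the meet turns out to be its excess over \<open>y\<close> itself.\<close>

lemma meet_plus_diff: assumes "x \<in> carr" "y \<in> carr" shows "(x \<sqinter>\<^sub>N y) \<oplus> (x \<odot> \<sim>y) = x"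
proof -
  have "x \<odot> \<sim>(x \<sqinter>\<^sub>N y) = x \<odot> (\<sim>x \<oplus> (x \<odot> \<sim>y))"
    using assms by (simp add: mv_meet_def neg_odot neg_plus_distrib)
  also have "\<dots> = x \<sqinter>\<^sub>N (x \<odot> \<sim>y)"
    by (simp add: mv_meet_def)
  also have "\<dots> = x \<odot> \<sim>y"
    using assms by (simp add: meet_comm[of x] meet_eq)
  finally show ?thesis using le_sum[of "x \<sqinter>\<^sub>N y" x] assms by simp
qed

text \<open>The meet with \<open>\<sim>x\<close> is the part of \<open>y\<close> that fits on top of
  \<open>x\<close> without overflow. An arbitrary sum is thus rewritten as a partial one, to which
  additivity applies.\<close>

lemma plus_meet_neg: assumes "x \<in> carr" "y \<in> carr" shows "x \<oplus> (y \<sqinter>\<^sub>N \<sim>x) = x \<oplus> y"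
proof -
  have "y \<sqinter>\<^sub>N \<sim>x = (x \<oplus> y) \<odot> \<sim>x"
    using assms meet_comm[of y "\<sim>x"] by (simp add: mv_meet_def odot_comm)
  then show ?thesis using le_sum[of x "x \<oplus> y"] assms by simp
qed

lemma odot_meet_neg: "x \<in> carr \<Longrightarrow> y \<in> carr \<Longrightarrow> x \<odot> (y \<sqinter>\<^sub>N \<sim>x) = \<zero>"
  by (rule odot_eq_zeroI[of _ _ x "\<sim>x"]) auto

text \<open>In a chain one of the two differences is zero; in general only this orthogonality
  remains. It is the source of the preservation of meets by extreme states.\<close>

lemma prelinear: assumes "x \<in> carr" "y \<in> carr" shows "(x \<odot> \<sim>y) \<sqinter>\<^sub>N (y \<odot> \<sim>x) = \<zero>"
proof -
  \<comment> \<open>Chosen for two properties: \<open>x \<odot> c\<close> is the meet of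
    \<open>x\<close> with \<open>y \<odot> \<sim>x\<close>, and \<open>\<sim>c\<close> lies below
    \<open>x\<close>, so that a product of \<open>\<sim>x\<close> with anything below
    \<open>\<sim>c\<close> is zero.\<close>
  define c where "c = \<sim>x \<oplus> (y \<odot> \<sim>x)"
  have c: "c \<in> carr" "\<sim>c \<preceq> x" using assms by (auto simp: c_def neg_plus_distrib)
  have "(x \<odot> \<sim>y) \<sqinter>\<^sub>N (y \<odot> \<sim>x) = x \<odot> \<sim>y \<odot> (\<sim>x \<oplus> y \<oplus> (y \<odot> \<sim>x))"
    using assms by (simp add: mv_meet_def neg_odot)
  also have "\<sim>x \<oplus> y \<oplus> (y \<odot> \<sim>x) = y \<oplus> c"
    using assms by (metis c_def neg_closed odot_closed plus_assoc plus_comm)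
  also have "x \<odot> \<sim>y \<odot> (y \<oplus> c) = x \<odot> (\<sim>y \<sqinter>\<^sub>N c)"
    using assms c by (simp add: mv_meet_def odot_assoc)
  also have "\<dots> = x \<odot> (c \<odot> (\<sim>c \<oplus> \<sim>y))"
    using assms c by (simp add: meet_comm[of "\<sim>y"]) (simp add: mv_meet_def)
  also have "\<dots> = (x \<sqinter>\<^sub>N (y \<odot> \<sim>x)) \<odot> (\<sim>c \<oplus> \<sim>y)"
    using assms c by (simp add: odot_assoc mv_meet_def c_def)
  also have "x \<sqinter>\<^sub>N (y \<odot> \<sim>x) \<preceq> y \<odot> \<sim>x" using assms by simp
  then have "(x \<sqinter>\<^sub>N (y \<odot> \<sim>x)) \<odot> (\<sim>c \<oplus> \<sim>y) \<preceq> (y \<odot> \<sim>x) \<odot> (\<sim>c \<oplus> \<sim>y)"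
    using assms c by (intro odot_mono) auto
  also have "(y \<odot> \<sim>x) \<odot> (\<sim>c \<oplus> \<sim>y) = \<sim>x \<odot> (y \<sqinter>\<^sub>N \<sim>c)"
    using assms c plus_comm[of "\<sim>c" "\<sim>y"] odot_comm[of y "\<sim>x"]
    by (simp add: mv_meet_def odot_assoc)
  finally have *: "(x \<odot> \<sim>y) \<sqinter>\<^sub>N (y \<odot> \<sim>x) \<preceq> \<sim>x \<odot> (y \<sqinter>\<^sub>N \<sim>c)" .
  have "y \<sqinter>\<^sub>N \<sim>c \<preceq> x" using le_trans[of "y \<sqinter>\<^sub>N \<sim>c" "\<sim>c" x] assms c by simp
  then have "\<sim>x \<odot> (y \<sqinter>\<^sub>N \<sim>c) = \<zero>"
    using assms c odot_eq_zeroI[of "\<sim>x" "y \<sqinter>\<^sub>N \<sim>c" "\<sim>x" x] odot_comm[of "\<sim>x" x] by simp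
  then show ?thesis using * assms by (simp add: le_zero)
qed

definition mult where "mult n a = ((\<oplus>) a ^^ n) \<zero>"

lemma mult_closed [simp, intro]: "a \<in> carr \<Longrightarrow> mult n a \<in> carr"
  by (induction n) (auto simp: mult_def)

lemma mult_Suc: "mult (Suc n) a = a \<oplus> mult n a"
  by (simp add: mult_def)

lemma mult_0: "mult 0 a = \<zero>"
  by (simp add: mult_def)

lemma mult_add: "a \<in> carr \<Longrightarrow> mult (m + n) a = mult m a \<oplus> mult n a"
  by (induction m) (auto simp: mult_Suc mult_0 plus_assoc)

text \<open>Subdistributivity passes orthogonality from \<open>a\<close> to its multiples, hence to
  the ideal on which \<open>localize\<close> is built.\<close>

lemma meet_mult_zero:
  assumes "a \<in> carr" "b \<in> carr" "a \<sqinter>\<^sub>N b = \<zero>" shows "mult n a \<sqinter>\<^sub>N b = \<zero>"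
proof (induction n)
  case 0
  show ?case using assms by (simp add: mult_0 meet_eq)
next
  case (Suc n)
  then show ?case
    using plus_meet_subdistrib[of a "mult n a" b] assms by (simp add: mult_Suc le_zero)
qed

section \<open>Positive functionals, localization and extreme states\<close>

lemma functional_add:
  "F \<in> mv_functionals N \<Longrightarrow> x \<in> carr \<Longrightarrow> y \<in> carr \<Longrightarrow> x \<odot> y = \<zero> \<Longrightarrow> F (x \<oplus> y) = F x + F y"
  by (simp add: mv_functionals_def)

lemma functional_nonneg: "F \<in> mv_functionals N \<Longrightarrow> 0 \<le> F x"
  by (cases "x \<in> carr") (auto simp: mv_functionals_def)

lemma functional_zero: "F \<in> mv_functionals N \<Longrightarrow> F \<zero> = 0"
  using functional_add[of F \<zero> \<zero>] by simp

lemma functional_mono: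
  assumes "F \<in> mv_functionals N" "x \<in> carr" "y \<in> carr" "x \<preceq> y" shows "F x \<le> F y"
proof -
  have "x \<odot> (y \<odot> \<sim>x) = \<zero>" using assms odot_lcomm[of x y "\<sim>x"] by simp
  then have "F y = F x + F (y \<odot> \<sim>x)"
    using functional_add[OF assms(1,2), of "y \<odot> \<sim>x"] le_sum[of x y] assms by simp
  then show ?thesis using functional_nonneg[OF assms(1), of "y \<odot> \<sim>x"] by simp
qed

lemma functional_neg: "F \<in> mv_functionals N \<Longrightarrow> x \<in> carr \<Longrightarrow> F (\<sim>x) = F \<one> - F x"
  using functional_add[of F x "\<sim>x"] by simp

lemma functional_split:
  "F \<in> mv_functionals N \<Longrightarrow> x \<in> carr \<Longrightarrow> y \<in> carr \<Longrightarrow> F x = F (x \<sqinter>\<^sub>N y) + F (x \<odot> \<sim>y)"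
  using functional_add[of F "x \<sqinter>\<^sub>N y" "x \<odot> \<sim>y"]
  by (simp add: meet_plus_diff meet_diff_disjoint)

lemma states_eq: "mv_states N = {F \<in> mv_functionals N. F \<one> = 1}"
proof (intro set_eqI iffI)
  fix F assume "F \<in> {F \<in> mv_functionals N. F \<one> = 1}"
  then show "F \<in> mv_states N"
    using functional_mono[of F _ \<one>]
    by (auto simp: mv_states_def unit_maps_def mv_functionals_def)
qed (auto simp: mv_states_def unit_maps_def mv_functionals_def)

lemma scaled_functional_state:
  "F \<in> mv_functionals N \<Longrightarrow> F \<one> > 0 \<Longrightarrow> (1 / F \<one>) *\<^sub>R F \<in> mv_states N"
  by (auto simp: states_eq mv_functionals_def scaleR_fun_def add_divide_distrib)

lemma functional_eq_zero: "F \<in> mv_functionals N \<Longrightarrow> F \<one> = 0 \<Longrightarrow> F = 0"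
  using functional_mono[of F _ \<one>] functional_nonneg[of F]
  by (auto simp: fun_eq_iff mv_functionals_def intro: antisym)

lemma dominated_diff_functional:
  "F \<in> mv_functionals N \<Longrightarrow> G \<in> mv_functionals N \<Longrightarrow> (\<And>x. x \<in> carr \<Longrightarrow> G x \<le> F x) \<Longrightarrow> F - G \<in> mv_functionals N"
  by (auto simp: mv_functionals_def)

text \<open>The part of a functional that is carried by the ideal generated by \<open>a\<close>. It is additive and
  dominated by the functional, so for an extreme state it is \<open>0\<close> or the whole state.\<close>

definition localize where
  "localize F a = (\<lambda>y. if y \<in> carr then SUP n. F (y \<sqinter>\<^sub>N mult n a) else 0)"

lemma localize_apply: "y \<in> carr \<Longrightarrow> localize F a y = (SUP n. F (y \<sqinter>\<^sub>N mult n a))"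
  by (simp add: localize_def)

lemma localize_bdd:
  "F \<in> mv_functionals N \<Longrightarrow> a \<in> carr \<Longrightarrow> y \<in> carr \<Longrightarrow> bdd_above (range (\<lambda>n. F (y \<sqinter>\<^sub>N mult n a)))"
  by (rule bdd_aboveI[of _ "F y"]) (auto intro!: functional_mono)

lemma localize_ge:
  "F \<in> mv_functionals N \<Longrightarrow> a \<in> carr \<Longrightarrow> y \<in> carr \<Longrightarrow> F (y \<sqinter>\<^sub>N mult n a) \<le> localize F a y"
  unfolding localize_def using localize_bdd by (auto intro!: cSUP_upper)

lemma localize_le:
  "F \<in> mv_functionals N \<Longrightarrow> a \<in> carr \<Longrightarrow> y \<in> carr \<Longrightarrow> localize F a y \<le> F y"
  unfolding localize_def by (auto intro!: cSUP_least functional_mono)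

lemma localize_functional:
  assumes F: "F \<in> mv_functionals N" and a: "a \<in> carr"
  shows "localize F a \<in> mv_functionals N"
proof -
  have nonneg: "0 \<le> localize F a x" if "x \<in> carr" for x
    using localize_ge[OF F a that, of 0] functional_nonneg[OF F] order_trans by blast
  have add: "localize F a (x \<oplus> y) = localize F a x + localize F a y"
    if xy: "x \<in> carr" "y \<in> carr" "x \<odot> y = \<zero>" for x y
  proof (rule antisym)
    have *: "F ((x \<sqinter>\<^sub>N mult m a) \<oplus> (y \<sqinter>\<^sub>N mult n a)) = F (x \<sqinter>\<^sub>N mult m a) + F (y \<sqinter>\<^sub>N mult n a)" for m n
      using xy a by (intro functional_add[OF F] odot_eq_zeroI[OF _ _ xy(1,2) _ _ xy(3)]) simp_all
    have "F ((x \<oplus> y) \<sqinter>\<^sub>N mult n a) \<le> localize F a x + localize F a y" for n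
    proof -
      have "F ((x \<oplus> y) \<sqinter>\<^sub>N mult n a) \<le> F ((x \<sqinter>\<^sub>N mult n a) \<oplus> (y \<sqinter>\<^sub>N mult n a))"
        using F a xy by (intro functional_mono plus_meet_subdistrib) auto
      then show ?thesis
        using *[of n n] localize_ge[OF F a, of x n] localize_ge[OF F a, of y n] xy by linarith
    qed
    then show "localize F a (x \<oplus> y) \<le> localize F a x + localize F a y"
      using xy by (simp add: localize_apply[of "x \<oplus> y" F a] cSUP_least)
    \<comment> \<open>The indices \<open>m\<close> and \<open>n\<close> stay independent, at the
      price of the multiple \<open>m + n\<close>, so that the two suprema can be taken one after the
      other.\<close>
    have **: "F (x \<sqinter>\<^sub>N mult m a) + F (y \<sqinter>\<^sub>N mult n a) \<le> localize F a (x \<oplus> y)" for m n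
    proof -
      have "(x \<sqinter>\<^sub>N mult m a) \<oplus> (y \<sqinter>\<^sub>N mult n a) \<preceq> (x \<oplus> y) \<sqinter>\<^sub>N mult (m + n) a"
        using xy a by (intro meet_greatest plus_mono) (auto simp: mult_add intro!: plus_mono)
      then have "F ((x \<sqinter>\<^sub>N mult m a) \<oplus> (y \<sqinter>\<^sub>N mult n a)) \<le> F ((x \<oplus> y) \<sqinter>\<^sub>N mult (m + n) a)"
        using F a xy by (intro functional_mono) auto
      then show ?thesis
        using * localize_ge[OF F a, of "x \<oplus> y" "m + n"] xy by simp
    qed
    have "F (x \<sqinter>\<^sub>N mult m a) \<le> localize F a (x \<oplus> y) - localize F a y" for m
    proof -
      have "localize F a y \<le> localize F a (x \<oplus> y) - F (x \<sqinter>\<^sub>N mult m a)"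
        unfolding localize_apply[OF xy(2)]
      proof (rule cSUP_least)
        show "F (y \<sqinter>\<^sub>N mult n a) \<le> localize F a (x \<oplus> y) - F (x \<sqinter>\<^sub>N mult m a)" for n
          using **[of m n] by simp
      qed simp
      then show ?thesis by simp
    qed
    then have "localize F a x \<le> localize F a (x \<oplus> y) - localize F a y"
      unfolding localize_apply[OF xy(1)] by (auto intro!: cSUP_least)
    then show "localize F a x + localize F a y \<le> localize F a (x \<oplus> y)" by simp
  qed
  show ?thesis using nonneg add by (auto simp: mv_functionals_def localize_def)
qed

lemma localize_self: assumes F: "F \<in> mv_functionals N" and a: "a \<in> carr" shows "localize F a a = F a"
  using localize_ge[OF F a a, of 1] localize_le[OF F a a] a
  by (simp add: mult_Suc mult_0 meet_eq)

text \<open>Normalising \<open>G\<close> and \<open>h - G\<close> writes \<open>h\<close> as a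
  convex combination of two states with weights \<open>G \<one>\<close> and
  \<open>1 - G \<one>\<close>. Extremality makes the two states equal, unless a weight is zero and
  the corresponding functional vanishes.\<close>

lemma extreme_dominated:
  assumes h: "h extreme_point_of mv_states N" and G: "G \<in> mv_functionals N"
    and le: "\<And>x. x \<in> carr \<Longrightarrow> G x \<le> h x"
  shows "G = G \<one> *\<^sub>R h"
proof -
  have hF: "h \<in> mv_functionals N" and h1: "h \<one> = 1" "h \<in> mv_states N"
    using h by (auto simp: extreme_point_of_def states_eq)
  define l where "l = G \<one>"
  have l: "0 \<le> l" "l \<le> 1" using le[of \<one>] h1 functional_nonneg[OF G, of \<one>] by (auto simp: l_def)
  have D: "h - G \<in> mv_functionals N" using dominated_diff_functional[OF hF G le] .
  consider "l = 0" | "l = 1" | "0 < l" "l < 1" using l by linarith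
  then show ?thesis
  proof cases
    case 1
    then show ?thesis using functional_eq_zero[OF G] by (simp add: l_def)
  next
    case 2
    then have "h - G = 0" using functional_eq_zero[OF D] h1 by (simp add: l_def)
    then show ?thesis using 2 by (simp add: l_def)
  next
    case 3
    define p q where "p = (1 / l) *\<^sub>R G" and "q = (1 / (1 - l)) *\<^sub>R (h - G)"
    have pq: "p \<in> mv_states N" "q \<in> mv_states N"
      using scaled_functional_state[OF G] scaled_functional_state[OF D] 3 h1
      by (simp_all add: p_def q_def l_def)
    have h_eq: "h = (1 - l) *\<^sub>R q + l *\<^sub>R p" using 3 by (simp add: p_def q_def)
    have "p = q"
    proof (rule ccontr)
      assume "p \<noteq> q"
      then have "h \<in> open_segment q p"
        unfolding in_segment using h_eq 3 by auto
      then show False using h pq by (auto simp: extreme_point_of_def)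
    qed
    then have "p = h" using h_eq by (simp flip: scaleR_left_distrib)
    then show ?thesis using 3 by (auto simp: p_def l_def)
  qed
qed

text \<open>Localizing at \<open>a\<close> loses nothing at \<open>a\<close> and gives zero at
  \<open>b\<close>, while the result is a multiple of \<open>h\<close>. Comparing at
  \<open>a\<close> forces the factor to be 1 unless \<open>h a = 0\<close>; comparing at
  \<open>b\<close> then gives \<open>h b = 0\<close>.\<close>

lemma extreme_state_prime:
  assumes h: "h extreme_point_of mv_states N" and ab: "a \<in> carr" "b \<in> carr" "a \<sqinter>\<^sub>N b = \<zero>"
  shows "h a = 0 \<or> h b = 0"
proof -
  have hF: "h \<in> mv_functionals N" using h by (auto simp: extreme_point_of_def states_eq)
  define G where "G = localize h a"
  have G: "G = G \<one> *\<^sub>R h"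
    unfolding G_def by (rule extreme_dominated[OF h localize_functional[OF hF ab(1)] localize_le[OF hF ab(1)]])
  have "G a = h a" using localize_self[OF hF ab(1)] by (simp add: G_def)
  then have 1: "h a = 0 \<or> G \<one> = 1" using fun_cong[OF G, of a] by (auto simp: scaleR_fun_def)
  have "G b = 0"
    using ab meet_mult_zero[OF ab] functional_zero[OF hF]
    by (simp add: G_def localize_def meet_comm[of b])
  then show ?thesis using 1 fun_cong[OF G, of b] by (auto simp: scaleR_fun_def)
qed

lemma extreme_state_morphism:
  assumes h: "h extreme_point_of mv_states N"
  shows "h \<in> mv_state_morphisms N"
proof -
  have hs: "h \<in> mv_states N" and hF: "h \<in> mv_functionals N" and h1: "h \<one> = 1"
    using h by (auto simp: extreme_point_of_def states_eq)
  have hmeet: "h (x \<sqinter>\<^sub>N y) = min (h x) (h y)" if xy: "x \<in> carr" "y \<in> carr" for x y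
  proof -
    have "h (x \<odot> \<sim>y) = 0 \<or> h (y \<odot> \<sim>x) = 0"
      using extreme_state_prime[OF h _ _ prelinear[OF xy]] xy by auto
    then show ?thesis
      using functional_split[OF hF xy] functional_split[OF hF xy(2,1)] meet_comm[OF xy]
        functional_nonneg[OF hF, of "x \<odot> \<sim>y"] functional_nonneg[OF hF, of "y \<odot> \<sim>x"]
      by auto
  qed
  \<comment> \<open>Cutting \<open>y\<close> down to \<open>y \<sqinter>\<^sub>N \<sim>x\<close>
    makes the sum a partial one; since meets are preserved, the cut part has the value
    \<open>min (h y) (1 - h x)\<close>.\<close>
  have "h (x \<oplus> y) = min (h x + h y) 1" if xy: "x \<in> carr" "y \<in> carr" for x y
    using functional_add[OF hF, of x "y \<sqinter>\<^sub>N \<sim>x"] xy hmeet[of y "\<sim>x"] functional_neg[OF hF, of x] h1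
    by (auto simp: plus_meet_neg odot_meet_neg)
  then show ?thesis
    using hs functional_neg[OF hF] functional_zero[OF hF] h1
    by (auto simp: mv_state_morphisms_def mv_states_def)
qed

end

section \<open>Regular measures induced by contents\<close>

lemma compact_in_sets_restrict_borel:
  "compact K \<Longrightarrow> K \<subseteq> X \<Longrightarrow> K \<in> sets (restrict_space borel X)" for X :: "'b::t2_space set"
  unfolding sets_restrict_space
  by (rule image_eqI[of _ _ K]) (auto intro: borel_closed compact_imp_closed)

lemma openin_in_sets_restrict_borel:
  "openin (top_of_set X) U \<Longrightarrow> U \<in> sets (restrict_space borel X)" for X :: "'b::t2_space set"
  unfolding sets_restrict_space openin_open by (elim exE conjE) (auto intro!: imageI borel_open)

text \<open>The content need not be outer regular, so it only bounds the induced measure from below on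
  compact sets.\<close>

locale compact_content =
  fixes X :: "'b::t2_space set" and lam :: "'b set \<Rightarrow> ennreal"
  assumes compact_space: "compact X"
    and finite_total: "lam X < \<infinity>"
    and content_empty: "lam {} = 0"
    and content_mono: "compact K \<Longrightarrow> compact L \<Longrightarrow> K \<subseteq> L \<Longrightarrow> L \<subseteq> X \<Longrightarrow> lam K \<le> lam L"
    and content_subadditive: "compact K \<Longrightarrow> compact L \<Longrightarrow> K \<subseteq> X \<Longrightarrow> L \<subseteq> X \<Longrightarrow> lam (K \<union> L) \<le> lam K + lam L"
    and content_superadditive: "compact K \<Longrightarrow> compact L \<Longrightarrow> K \<subseteq> X \<Longrightarrow> L \<subseteq> X \<Longrightarrow> K \<inter> L = {}
          \<Longrightarrow> lam K + lam L \<le> lam (K \<union> L)"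
begin

abbreviation opens where "opens \<equiv> {U. openin (top_of_set X) U}"

text \<open>Two stages, open sets from inside by compacts and arbitrary sets from outside by open
  sets, because the content is controlled on compacts only. Outer regularity is thereby built
  in.\<close>

definition inner where "inner U = (SUP K\<in>{K. compact K \<and> K \<subseteq> U}. lam K)"

definition outer where "outer B = (INF U\<in>{U\<in>opens. B \<subseteq> U}. inner U)"

lemma opens_subset: "U \<in> opens \<Longrightarrow> U \<subseteq> X"
  by (auto dest: openin_imp_subset)

lemma compact_minus_open: "compact K \<Longrightarrow> K \<subseteq> X \<Longrightarrow> U \<in> opens \<Longrightarrow> compact (K - U)"
proof -
  assume K: "compact K" "K \<subseteq> X" and "U \<in> opens"
  then obtain O' where "open O'" "U = X \<inter> O'" by (auto simp: openin_open)
  moreover from this have "K - U = K - O'" using K by auto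
  ultimately show ?thesis using K compact_diff by metis
qed

lemma minus_compact_open: "compact K \<Longrightarrow> U \<in> opens \<Longrightarrow> U - K \<in> opens"
proof -
  assume K: "compact K" and "U \<in> opens"
  then obtain O' where "open O'" "U = X \<inter> O'" by (auto simp: openin_open)
  moreover from this have "U - K = X \<inter> (O' - K)" by auto
  ultimately show ?thesis using K open_Diff[OF _ compact_imp_closed[OF K]] by (auto simp: openin_open)
qed

lemma inner_upper: "compact K \<Longrightarrow> K \<subseteq> U \<Longrightarrow> lam K \<le> inner U"
  unfolding inner_def by (rule SUP_upper) auto

lemma inner_mono: "U \<subseteq> V \<Longrightarrow> inner U \<le> inner V"
  unfolding inner_def by (rule SUP_subset_mono) auto

lemma inner_empty: "inner {} = 0"
  by (auto simp: inner_def content_empty cong: conj_cong intro!: antisym SUP_least)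

lemma inner_total: "inner X = lam X"
  unfolding inner_def using compact_space by (intro antisym SUP_least SUP_upper) (auto intro: content_mono)

text \<open>A compact \<open>K\<close> in the union is cut in two: \<open>K - U\<close> and
  \<open>K - V\<close> are disjoint compacts with disjoint open neighbourhoods, and removing these
  from \<open>K\<close> leaves compact subsets of \<open>U\<close> and of \<open>V\<close> that
  still cover \<open>K\<close>.\<close>

lemma inner_Un:
  assumes U: "U \<in> opens" and V: "V \<in> opens"
  shows "inner (U \<union> V) \<le> inner U + inner V"
  unfolding inner_def[of "U \<union> V"]
proof (rule SUP_least, clarify)
  fix K assume K: "compact K" "K \<subseteq> U \<union> V"
  then have KX: "K \<subseteq> X" using opens_subset[OF U] opens_subset[OF V] by auto
  have c: "compactin euclidean (K - U)" "compactin euclidean (K - V)"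
    using compact_minus_open K KX U V by (auto simp: compactin_euclidean_iff)
  have "Hausdorff_space (euclidean :: 'b topology)"
    unfolding Hausdorff_space_def using hausdorff by (auto simp: disjnt_def)
  moreover have "disjnt (K - U) (K - V)" using K by (auto simp: disjnt_def)
  ultimately obtain P Q where PQ: "open P" "open Q" "K - U \<subseteq> P" "K - V \<subseteq> Q" "disjnt P Q"
    using Hausdorff_space_compact_separation[OF _ c] by (metis open_openin)
  note 1 = compact_diff[OF K(1) PQ(1)] compact_diff[OF K(1) PQ(2)]
  have "K = (K - P) \<union> (K - Q)" using PQ by (auto simp: disjnt_def)
  then have "lam K \<le> lam (K - P) + lam (K - Q)"
    using content_subadditive[OF 1] KX by (metis Diff_subset subset_trans)
  also have "\<dots> \<le> inner U + inner V"
    using PQ 1 by (intro add_mono inner_upper) auto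
  finally show "lam K \<le> inner U + inner V" .
qed

lemma inner_finite_UN:
  "finite I \<Longrightarrow> (\<And>i. i \<in> I \<Longrightarrow> U i \<in> opens) \<Longrightarrow> inner (\<Union>i\<in>I. U i) \<le> (\<Sum>i\<in>I. inner (U i))"
proof (induction I rule: finite_induct)
  case empty
  then show ?case by (simp add: inner_empty)
next
  case (insert i I)
  have "inner (\<Union>i\<in>insert i I. U i) \<le> inner (U i) + inner (\<Union>i\<in>I. U i)"
    using insert.prems by (auto intro!: inner_Un openin_Union)
  also have "\<dots> \<le> inner (U i) + (\<Sum>i\<in>I. inner (U i))"
    using insert by (intro add_left_mono) auto
  finally show ?case using insert by simp
qed

lemma inner_UN:
  fixes U :: "nat \<Rightarrow> 'b set"
  assumes U: "\<And>n. U n \<in> opens"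
  shows "inner (\<Union>n. U n) \<le> (\<Sum>n. inner (U n))"
  unfolding inner_def[of "\<Union>n. U n"]
proof (rule SUP_least, clarify)
  fix K assume K: "compact K" "K \<subseteq> (\<Union>n. U n)"
  obtain O' where O': "\<And>n. open (O' n)" "\<And>n. U n = X \<inter> O' n"
    using U by (simp add: openin_open) metis
  have KX: "K \<subseteq> X" using K O' by auto
  obtain C where C: "finite C" "K \<subseteq> (\<Union>n\<in>C. O' n)"
  proof (rule compactE_image[OF K(1), of UNIV O'])
    show "K \<subseteq> (\<Union>n. O' n)" using K O' by auto
  qed (use O' in auto)
  have "lam K \<le> inner (\<Union>n\<in>C. U n)"
    using C K KX O' by (intro inner_upper) auto
  also have "\<dots> \<le> (\<Sum>n\<in>C. inner (U n))" using C U by (intro inner_finite_UN) auto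
  also have "\<dots> \<le> (\<Sum>n. inner (U n))" using C by (intro sum_le_suminf) auto
  finally show "lam K \<le> (\<Sum>n. inner (U n))" .
qed

lemma outer_open: "U \<in> opens \<Longrightarrow> outer U = inner U"
  unfolding outer_def by (intro antisym INF_greatest) (auto intro: INF_lower inner_mono)

lemma outer_mono: "A \<subseteq> B \<Longrightarrow> outer A \<le> outer B"
  unfolding outer_def by (rule INF_superset_mono) auto

lemma outer_approx:
  assumes "B \<subseteq> X" "e > 0"
  obtains U where "U \<in> opens" "B \<subseteq> U" "inner U \<le> outer B + ennreal e"
proof -
  have "outer B \<le> inner X" using assms unfolding outer_def by (auto intro!: INF_lower)
  then have "outer B \<noteq> \<infinity>" using finite_total by (auto simp: inner_total top_unique)
  then obtain U where "U \<in> {U\<in>opens. B \<subseteq> U}" "inner U < outer B + ennreal e"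
    using INF_approx_ennreal[OF assms(2) outer_def] by blast
  then show ?thesis using that by (auto intro: less_imp_le)
qed

lemma outer_measure_space: "outer_measure_space (Pow X) outer"
  unfolding outer_measure_space_def
proof (intro conjI)
  show "positive (Pow X) outer"
    using outer_open[of "{}"] by (simp add: positive_def inner_empty)
  show "increasing (Pow X) outer"
    by (auto simp: increasing_def outer_mono)
  show "countably_subadditive (Pow X) outer"
    unfolding countably_subadditive_def
  proof (intro allI impI)
    fix A :: "nat \<Rightarrow> 'b set" assume "range A \<subseteq> Pow X"
    then have A: "A n \<subseteq> X" for n by auto
    show "outer (\<Union>n. A n) \<le> (\<Sum>n. outer (A n))"
    proof (rule ennreal_le_epsilon)
      fix e :: real assume e: "0 < e"
      have "\<exists>U. U \<in> opens \<and> A n \<subseteq> U \<and> inner U \<le> outer (A n) + ennreal (e * (1/2)^Suc n)" for n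
        using outer_approx[OF A[of n], of "e * (1/2)^Suc n"] e by auto
      then obtain U where U: "\<And>n. U n \<in> opens" "\<And>n. A n \<subseteq> U n"
          "\<And>n. inner (U n) \<le> outer (A n) + ennreal (e * (1/2)^Suc n)"
        by metis
      have "outer (\<Union>n. A n) \<le> outer (\<Union>n. U n)" using U by (intro outer_mono) blast
      also have "\<dots> = inner (\<Union>n. U n)" using U by (intro outer_open) (auto intro!: openin_Union)
      also have "\<dots> \<le> (\<Sum>n. inner (U n))" using U by (intro inner_UN)
      also have "\<dots> \<le> (\<Sum>n. outer (A n) + ennreal (e * (1/2)^Suc n))"
        using U by (intro suminf_le) auto
      also have "... = (\<Sum>n. outer (A n)) + (\<Sum>n. ennreal e * ennreal ((1/2) ^ Suc n))"
        using e by (subst suminf_add[symmetric])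
                   (auto simp del: ennreal_suminf_cmult simp add: ennreal_mult[symmetric])
      also have "\<dots> = (\<Sum>n. outer (A n)) + e"
        unfolding ennreal_suminf_cmult
        by (subst suminf_ennreal_eq[OF zero_le_power power_half_series]) auto
      finally show "outer (\<Union>n. A n) \<le> (\<Sum>n. outer (A n)) + e" .
    qed
  qed
qed

text \<open>Superadditivity yields Caratheodory's inequality for open test sets. A compact
  \<open>K\<close> in the intersection is fixed first; the compacts that exhaust
  \<open>V - K\<close>, a superset of \<open>V - U\<close>, are disjoint from
  \<open>K\<close>.\<close>

lemma inner_split:
  assumes U: "U \<in> opens" and V: "V \<in> opens"
  shows "outer (V \<inter> U) + outer (V - U) \<le> inner V"
proof -
  have "lam K + outer (V - U) \<le> inner V" if K: "compact K" "K \<subseteq> V \<inter> U" for K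
  proof -
    have KX: "K \<subseteq> X" using K opens_subset[OF V] by auto
    have op: "V - K \<in> opens" using minus_compact_open K V by blast
    have "lam K + outer (V - U) \<le> lam K + outer (V - K)"
      using K by (intro add_left_mono outer_mono) auto
    also have "\<dots> = lam K + inner (V - K)" using op by (simp add: outer_open)
    also have "\<dots> = (SUP L\<in>{L. compact L \<and> L \<subseteq> V - K}. lam K + lam L)"
      unfolding inner_def by (intro ennreal_SUP_add_right) auto
    also have "\<dots> \<le> inner V"
    proof (rule SUP_least, clarify)
      fix L assume L: "compact L" "L \<subseteq> V - K"
      have "lam K + lam L \<le> lam (K \<union> L)"
        using K L KX opens_subset[OF V] by (intro content_superadditive) auto
      also have "\<dots> \<le> inner V" using K L by (intro inner_upper) auto
      finally show "lam K + lam L \<le> inner V" .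
    qed
    finally show ?thesis .
  qed
  moreover have "V \<inter> U \<in> opens" using U V by (auto intro: openin_Int)
  then have "outer (V \<inter> U) = (SUP K\<in>{K. compact K \<and> K \<subseteq> V \<inter> U}. lam K)"
    by (simp add: outer_open inner_def)
  then have "outer (V \<inter> U) + outer (V - U) = (SUP K\<in>{K. compact K \<and> K \<subseteq> V \<inter> U}. lam K + outer (V - U))"
    by (simp only:) (intro ennreal_SUP_add_left[symmetric], auto)
  ultimately show ?thesis by (auto intro!: SUP_least)
qed

lemma open_measurable:
  assumes U: "U \<in> opens"
  shows "U \<in> lambda_system X (Pow X) outer"
proof -
  interpret sigma_algebra X "Pow X" by (rule sigma_algebra_Pow)
  have "outer (B \<inter> U) + outer (B - U) \<le> outer B" for B
    unfolding outer_def[of B]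
  proof (rule INF_greatest, clarify)
    fix V assume V: "openin (top_of_set X) V" "B \<subseteq> V"
    then have "outer (B \<inter> U) + outer (B - U) \<le> outer (V \<inter> U) + outer (V - U)"
      by (intro add_mono outer_mono) auto
    then show "outer (B \<inter> U) + outer (B - U) \<le> inner V"
      using inner_split[OF U, of V] V by auto
  qed
  moreover have "outer B \<le> outer (B \<inter> U) + outer (B - U)" if "B \<subseteq> X" for B
  proof -
    have "outer B = outer ((B \<inter> U) \<union> (B - U))" by (simp add: Int_Diff_Un)
    also have "\<dots> \<le> outer (B \<inter> U) + outer (B - U)"
      using outer_measure_space that
      by (intro subadditiveD[OF countably_subadditive_subadditive])
         (auto simp: outer_measure_space_def)
    finally show ?thesis .
  qed
  ultimately show ?thesis
    using opens_subset[OF U] by (auto simp: lambda_system_eq intro: antisym)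
qed

section \<open>The Borel measure of a content and its regularity\<close>

lemma sets_borel_subspace: "sets (restrict_space borel X) = sigma_sets X opens"
proof -
  have "X \<in> sets borel" using compact_space by (simp add: compact_imp_closed borel_closed)
  then have X: "X \<in> sigma_sets UNIV {S. open S}" by (simp add: borel_def)
  have "sets (restrict_space borel X) = (\<inter>) X ` sigma_sets UNIV {S. open S}"
    by (simp add: sets_restrict_space borel_def)
  also have "\<dots> = sigma_sets X ((\<inter>) X ` {S. open S})"
    using X by (intro sigma_sets_Int) auto
  also have "(\<inter>) X ` {S. open S} = opens" by (auto simp: openin_open)
  finally show ?thesis .
qed

text \<open>Caratheodory's measurable sets may exceed the Borel sets, whereas
  \<open>regular_borel_measure\<close> fixes the \<sigma>-algebra; hence the cut to the sets
  generated by the open ones.\<close>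

definition content_measure where
  "content_measure = measure_of X (sigma_sets X opens) outer"

lemma sets_content_measure: "sets content_measure = sets (restrict_space borel X)"
proof -
  have sub: "sigma_sets X opens \<subseteq> Pow X"
    using sigma_sets_into_sp[of opens X] opens_subset by blast
  show ?thesis
    unfolding content_measure_def sets_borel_subspace
    using opens_subset by (subst sets_measure_of[OF sub]) (auto intro!: sigma_sets_sigma_sets_eq)
qed

lemma emeasure_content_measure:
  assumes "A \<in> sets content_measure" shows "emeasure content_measure A = outer A"
proof -
  have ms: "measure_space X (lambda_system X (Pow X) outer) outer"
    using sigma_algebra.caratheodory_lemma[OF sigma_algebra_Pow outer_measure_space] .
  then have "sigma_algebra X (lambda_system X (Pow X) outer)" by (simp add: measure_space_def)
  then have "sigma_sets X opens \<subseteq> lambda_system X (Pow X) outer"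
    using open_measurable by (intro sigma_algebra.sigma_sets_subset) auto
  moreover have sa: "sigma_algebra X (sigma_sets X opens)"
    using opens_subset by (intro sigma_algebra_sigma_sets) auto
  ultimately have "measure_space X (sigma_sets X opens) outer"
    using measure_down[OF ms] by blast
  then have "positive (sigma_sets X opens) outer" "countably_additive (sigma_sets X opens) outer"
    by (simp_all add: measure_space_def)
  moreover have "A \<in> sigma_sets X opens"
    using assms by (simp add: sets_content_measure sets_borel_subspace)
  ultimately show ?thesis
    unfolding content_measure_def using sa by (rule emeasure_measure_of_sigma[rotated])
qed

lemma opens_sets: "U \<in> opens \<Longrightarrow> U \<in> sets content_measure"
  by (simp add: sets_content_measure openin_in_sets_restrict_borel)

lemma compact_sets: "compact K \<Longrightarrow> K \<subseteq> X \<Longrightarrow> K \<in> sets content_measure"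
  by (simp add: sets_content_measure compact_in_sets_restrict_borel)

lemma content_le_measure: "compact K \<Longrightarrow> K \<subseteq> X \<Longrightarrow> lam K \<le> emeasure content_measure K"
  by (auto simp: emeasure_content_measure compact_sets outer_def intro!: INF_greatest inner_upper)

lemma space_content_measure: "space content_measure = X"
  using sets_content_measure by (metis sets_eq_imp_space_eq space_restrict_space2 space_borel space_restrict_space Int_UNIV_right)

lemma emeasure_content_measure_space: "emeasure content_measure X = lam X"
  using emeasure_content_measure[OF opens_sets[of X]] outer_open[of X] by (simp add: inner_total)

text \<open>Outer regularity is the definition of \<open>outer\<close>. For inner regularity the
  complement of \<open>Y\<close> is enclosed in an open \<open>U\<close> of nearly the same measure:
  \<open>X - U\<close> is compact because \<open>X\<close> is, and finiteness allows subtraction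
  from the total.\<close>

lemma regular_content_measure: "regular_borel_measure X content_measure"
  unfolding regular_borel_measure_def
proof (intro conjI ballI)
  interpret finite_measure content_measure
    using finite_total emeasure_content_measure_space
    by (intro finite_measureI) (auto simp: space_content_measure)
  fix Y assume Y: "Y \<in> sets content_measure"
  then have YX: "Y \<subseteq> X" using sets.sets_into_space space_content_measure by blast
  have "(INF U\<in>{U. openin (top_of_set X) U \<and> Y \<subseteq> U}. emeasure content_measure U)
      = (INF U\<in>{U. openin (top_of_set X) U \<and> Y \<subseteq> U}. inner U)"
    using opens_sets by (intro INF_cong) (auto simp: emeasure_content_measure outer_open)
  then show "(INF U\<in>{U. openin (top_of_set X) U \<and> Y \<subseteq> U}. emeasure content_measure U)
      = emeasure content_measure Y"
    using Y by (simp add: emeasure_content_measure outer_def)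
  show "emeasure content_measure Y = (SUP C\<in>{C. compact C \<and> C \<subseteq> Y}. emeasure content_measure C)"
  proof (rule antisym)
    show "emeasure content_measure Y \<le> (SUP C\<in>{C. compact C \<and> C \<subseteq> Y}. emeasure content_measure C)"
    proof (rule ennreal_le_epsilon)
      fix e :: real assume e: "0 < e"
      obtain U where U: "U \<in> opens" "X - Y \<subseteq> U" "inner U \<le> outer (X - Y) + ennreal e"
        using outer_approx[of "X - Y" e] e by auto
      have K: "compact (X - U)" "X - U \<subseteq> Y"
        using U compact_space compact_minus_open by auto
      have XY: "X - Y \<in> sets content_measure" using Y space_content_measure by (metis sets.compl_sets)
      note [simp] = opens_sets[OF U(1)] compact_sets[OF K(1)] Y XY
      have "emeasure content_measure U \<le> emeasure content_measure (X - Y) + ennreal e"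
        using U by (simp add: emeasure_content_measure outer_open)
      then have "measure content_measure U \<le> measure content_measure (X - Y) + e"
        using e by (simp add: emeasure_eq_measure flip: ennreal_plus)
      moreover have "measure content_measure (X - U) = measure content_measure X - measure content_measure U"
        using finite_measure_compl[of U] by (simp add: space_content_measure)
      moreover have "measure content_measure (X - Y) = measure content_measure X - measure content_measure Y"
        using finite_measure_compl[of Y] by (simp add: space_content_measure)
      ultimately have "measure content_measure Y \<le> measure content_measure (X - U) + e" by simp
      then have "emeasure content_measure Y \<le> emeasure content_measure (X - U) + ennreal e"
        using e by (simp add: emeasure_eq_measure flip: ennreal_plus)
      also have "emeasure content_measure (X - U) \<le> (SUP C\<in>{C. compact C \<and> C \<subseteq> Y}. emeasure content_measure C)"
        using K by (intro SUP_upper) auto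
      finally show "emeasure content_measure Y
          \<le> (SUP C\<in>{C. compact C \<and> C \<subseteq> Y}. emeasure content_measure C) + ennreal e"
        by (auto intro: add_right_mono)
    qed
  qed (auto intro!: SUP_least emeasure_mono Y)
qed (rule sets_content_measure)

end

section \<open>Uniqueness of regular measures with given integrals\<close>

lemma regular_borel_measure_le_on_compact:
  fixes X :: "'b::t2_space set"
  assumes \<mu>: "regular_borel_measure X \<mu>" and \<nu>: "regular_borel_measure X \<nu>"
    and K: "compact K" "K \<subseteq> X"
    and sep: "\<And>U. K \<subseteq> U \<Longrightarrow> openin (top_of_set X) U \<Longrightarrow>
      \<exists>(f :: 'b \<Rightarrow> real) r. has_bochner_integral \<mu> f r \<and> has_bochner_integral \<nu> f r
        \<and> (\<forall>t\<in>X. 0 \<le> f t \<and> f t \<le> 1) \<and> (\<forall>t\<in>K. f t = 1) \<and> (\<forall>t\<in>X - U. f t = 0)"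
  shows "emeasure \<mu> K \<le> emeasure \<nu> K"
proof -
  have sets: "sets \<mu> = sets (restrict_space borel X)" "sets \<nu> = sets (restrict_space borel X)"
    using \<mu> \<nu> by (auto simp: regular_borel_measure_def)
  have space: "space \<mu> = X" "space \<nu> = X"
    using sets[THEN sets_eq_imp_space_eq] by (auto simp: space_restrict_space)
  have "emeasure \<mu> K \<le> emeasure \<nu> U" if U: "K \<subseteq> U" "openin (top_of_set X) U" for U
  proof -
    obtain f :: "'b \<Rightarrow> real" and r where "has_bochner_integral \<mu> f r \<and> has_bochner_integral \<nu> f r
        \<and> (\<forall>t\<in>X. 0 \<le> f t \<and> f t \<le> 1) \<and> (\<forall>t\<in>K. f t = 1) \<and> (\<forall>t\<in>X - U. f t = 0)"
      using sep[OF U] by (elim exE) (rule that)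
    then have f: "has_bochner_integral \<mu> f r" "has_bochner_integral \<nu> f r"
      "\<And>t. t \<in> X \<Longrightarrow> 0 \<le> f t \<and> f t \<le> 1" "\<And>t. t \<in> K \<Longrightarrow> f t = 1" "\<And>t. t \<in> X - U \<Longrightarrow> f t = 0"
      by simp_all
    have nn: "(\<integral>\<^sup>+ t. ennreal (f t) \<partial>M) = ennreal r"
      if "has_bochner_integral M f r" "space M = X" for M
    proof -
      have "AE t in M. 0 \<le> f t" using f(3) that(2) by (intro AE_I2) blast
      then show ?thesis
        using nn_integral_eq_integral[of M f] that(1) by (simp add: has_bochner_integral_iff)
    qed
    \<comment> \<open>The function \<open>f\<close> lies between the indicators of \<open>K\<close>
      and \<open>U\<close> and has the same integral for both measures. Nonnegative integrals are
      used because the total masses are unknown.\<close>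
    have "emeasure \<mu> K = (\<integral>\<^sup>+ t. indicator K t \<partial>\<mu>)"
      using K by (simp add: sets compact_in_sets_restrict_borel)
    also have "\<dots> \<le> (\<integral>\<^sup>+ t. ennreal (f t) \<partial>\<mu>)"
      using f(4) by (intro nn_integral_mono) (auto simp: indicator_def)
    also have "\<dots> = (\<integral>\<^sup>+ t. ennreal (f t) \<partial>\<nu>)"
      using nn[OF f(1)] nn[OF f(2)] space by simp
    also have "\<dots> \<le> (\<integral>\<^sup>+ t. indicator U t \<partial>\<nu>)"
      using f(3,5) by (intro nn_integral_mono) (auto simp: indicator_def space)
    also have "\<dots> = emeasure \<nu> U"
      using U by (simp add: sets openin_in_sets_restrict_borel)
    finally show ?thesis .
  qed
  then have "emeasure \<mu> K \<le> (INF U\<in>{U. openin (top_of_set X) U \<and> K \<subseteq> U}. emeasure \<nu> U)"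
    by (intro INF_greatest) auto
  also have "\<dots> = emeasure \<nu> K"
    using \<nu> K unfolding regular_borel_measure_def by (simp add: compact_in_sets_restrict_borel)
  finally show ?thesis .
qed

text \<open>The one-sided comparison in both orders gives equality on compacts, and inner regularity
  carries it to all Borel sets.\<close>

lemma regular_borel_measure_unique:
  fixes X :: "'b::t2_space set"
  assumes \<mu>: "regular_borel_measure X \<mu>" and \<nu>: "regular_borel_measure X \<nu>"
    and sep: "\<And>K U. compact K \<Longrightarrow> K \<subseteq> U \<Longrightarrow> openin (top_of_set X) U \<Longrightarrow>
      \<exists>(f :: 'b \<Rightarrow> real) r. has_bochner_integral \<mu> f r \<and> has_bochner_integral \<nu> f r
        \<and> (\<forall>t\<in>X. 0 \<le> f t \<and> f t \<le> 1) \<and> (\<forall>t\<in>K. f t = 1) \<and> (\<forall>t\<in>X - U. f t = 0)"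
  shows "\<mu> = \<nu>"
proof (rule measure_eqI)
  show sets: "sets \<mu> = sets \<nu>"
    using \<mu> \<nu> by (auto simp: regular_borel_measure_def)
  fix Y assume Y: "Y \<in> sets \<mu>"
  have "Y \<subseteq> X"
    using sets.sets_into_space[OF Y] \<mu>
    by (auto simp: regular_borel_measure_def space_restrict_space dest!: sets_eq_imp_space_eq)
  have "emeasure \<mu> K = emeasure \<nu> K" if K: "compact K" "K \<subseteq> Y" for K
  proof (rule antisym)
    have KX: "K \<subseteq> X" using K \<open>Y \<subseteq> X\<close> by simp
    show "emeasure \<mu> K \<le> emeasure \<nu> K"
      by (rule regular_borel_measure_le_on_compact[OF \<mu> \<nu> K(1) KX sep[OF K(1)]])
    show "emeasure \<nu> K \<le> emeasure \<mu> K"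
    proof (rule regular_borel_measure_le_on_compact[OF \<nu> \<mu> K(1) KX])
      fix U assume "K \<subseteq> U" "openin (top_of_set X) U"
      from sep[OF K(1) this] obtain f :: "'b \<Rightarrow> real" and r where "has_bochner_integral \<mu> f r \<and> has_bochner_integral \<nu> f r
        \<and> (\<forall>t\<in>X. 0 \<le> f t \<and> f t \<le> 1) \<and> (\<forall>t\<in>K. f t = 1) \<and> (\<forall>t\<in>X - U. f t = 0)"
        by (elim exE) (rule that)
      then show "\<exists>(f :: 'b \<Rightarrow> real) r. has_bochner_integral \<nu> f r \<and> has_bochner_integral \<mu> f r
        \<and> (\<forall>t\<in>X. 0 \<le> f t \<and> f t \<le> 1) \<and> (\<forall>t\<in>K. f t = 1) \<and> (\<forall>t\<in>X - U. f t = 0)"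
        by (intro exI[of _ f] exI[of _ r]) simp
    qed
  qed
  then have "(SUP K\<in>{K. compact K \<and> K \<subseteq> Y}. emeasure \<mu> K) = (SUP K\<in>{K. compact K \<and> K \<subseteq> Y}. emeasure \<nu> K)"
    by (intro SUP_cong) auto
  moreover have "Y \<in> sets \<nu>" using Y sets by simp
  ultimately show "emeasure \<mu> Y = emeasure \<nu> Y"
    using \<mu> \<nu> Y unfolding regular_borel_measure_def by metis
qed

section \<open>Clans of functions on a compact space\<close>

abbreviation clamp :: "real \<Rightarrow> real" where "clamp r \<equiv> max 0 (min 1 r)"

text \<open>A segment of length \<open>b\<close> is cut into unit layers, the \<open>k\<close>-th
  being its part between \<open>k\<close> and \<open>k + 1\<close>.\<close>

lemma sum_clamp: "0 \<le> b \<Longrightarrow> (\<Sum>k<n. clamp (b - real k)) = min b (real n)"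
proof (induction n)
  case (Suc n)
  have "min b (real n) + clamp (b - real n) = min b (real (Suc n))" by linarith
  then show ?case using Suc by simp
qed simp

text \<open>The recursion known from McNaughton functions: for \<open>v \<ge> 0\<close> the last
  term \<open>clamp (v + 1)\<close> is 1, for \<open>v\<close> between -1 and 0 it undoes the
  truncation of \<open>v\<close> at 0, and below -1 everything vanishes. Truncated sums and products
  suffice on the right, so a clan can realise it.\<close>

lemma clamp_Suc:
  "0 \<le> u \<Longrightarrow> u \<le> 1 \<Longrightarrow> clamp (v + u) = max 0 (min 1 (clamp v + u) + clamp (v + 1) - 1)"
  by (auto simp: max_def min_def)

text \<open>Closure asks for an element with the right values, because only values matter: distinct
  elements may give the same function, and the elements of \<open>N\<close> will be evaluated both
  on the morphisms of \<open>N\<close> and, through \<open>ext\<close>, on maps on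
  \<open>M\<close>.\<close>

locale function_clan =
  fixes X :: "'b::t2_space set" and A :: "'a set" and ev :: "'a \<Rightarrow> 'b \<Rightarrow> real"
  assumes clan_range: "x \<in> A \<Longrightarrow> t \<in> X \<Longrightarrow> 0 \<le> ev x t \<and> ev x t \<le> 1"
    and clan_nonempty: "A \<noteq> {}"
    and clan_neg: "x \<in> A \<Longrightarrow> \<exists>u\<in>A. \<forall>t\<in>X. ev u t = 1 - ev x t"
    and clan_plus: "x \<in> A \<Longrightarrow> y \<in> A \<Longrightarrow> \<exists>u\<in>A. \<forall>t\<in>X. ev u t = min 1 (ev x t + ev y t)"
begin

lemma clan_one: "\<exists>u\<in>A. \<forall>t\<in>X. ev u t = 1"
proof -
  obtain x where "x \<in> A" using clan_nonempty by auto
  moreover from this obtain y where "y \<in> A" "\<forall>t\<in>X. ev y t = 1 - ev x t"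
    using clan_neg by blast
  ultimately show ?thesis using clan_plus[of x y] by auto
qed

lemma clan_zero: "\<exists>u\<in>A. \<forall>t\<in>X. ev u t = 0"
  using clan_one clan_neg by (metis diff_self)

lemma clan_diff:
  assumes "x \<in> A" "y \<in> A" shows "\<exists>u\<in>A. \<forall>t\<in>X. ev u t = max 0 (ev x t - ev y t)"
proof -
  obtain z where z: "z \<in> A" "\<forall>t\<in>X. ev z t = 1 - ev x t" using clan_neg assms by blast
  obtain w where w: "w \<in> A" "\<forall>t\<in>X. ev w t = min 1 (ev z t + ev y t)" using clan_plus z assms by blast
  obtain u where "u \<in> A" "\<forall>t\<in>X. ev u t = 1 - ev w t" using clan_neg w by blast
  then show ?thesis using z w by (intro bexI[of _ u]) (auto simp: max_def min_def)
qed

lemma clan_odot: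
  assumes "x \<in> A" "y \<in> A" shows "\<exists>u\<in>A. \<forall>t\<in>X. ev u t = max 0 (ev x t + ev y t - 1)"
proof -
  obtain z where z: "z \<in> A" "\<forall>t\<in>X. ev z t = 1 - ev y t" using clan_neg assms by blast
  obtain u where "u \<in> A" "\<forall>t\<in>X. ev u t = max 0 (ev x t - ev z t)" using clan_diff assms z by blast
  then show ?thesis using z by (intro bexI[of _ u]) (auto simp: algebra_simps)
qed

lemma clan_min:
  assumes "x \<in> A" "y \<in> A" shows "\<exists>u\<in>A. \<forall>t\<in>X. ev u t = min (ev x t) (ev y t)"
proof -
  obtain z where z: "z \<in> A" "\<forall>t\<in>X. ev z t = max 0 (ev x t - ev y t)" using clan_diff assms by blast
  obtain u where "u \<in> A" "\<forall>t\<in>X. ev u t = max 0 (ev x t - ev z t)" using clan_diff assms z by blast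
  then show ?thesis using z clan_range assms by (intro bexI[of _ u]) (auto simp: max_def min_def)
qed

text \<open>The induction runs over all offsets \<open>k\<close> at once, since the step to
  \<open>m + 1\<close> combines the offsets \<open>k\<close> and \<open>k - 1\<close> by
  \<open>clamp_Suc\<close>. For \<open>m = 0\<close> the sign of \<open>k\<close> decides between
  the constants 1 and 0.\<close>

lemma clan_clamp:
  assumes x: "x \<in> A"
  shows "\<exists>u\<in>A. \<forall>t\<in>X. ev u t = clamp (real m * ev x t - of_int k)"
proof (induction m arbitrary: k)
  case 0
  have "clamp (- of_int k) = (if k < 0 then 1 else 0)"
  proof (cases "k < 0")
    case True
    then have "- of_int k \<ge> (1 :: real)" by linarith
    then show ?thesis using True by auto
  qed auto
  then show ?case using clan_one clan_zero by simp
next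
  case (Suc m)
  obtain v where v: "v \<in> A" "\<forall>t\<in>X. ev v t = clamp (real m * ev x t - of_int k)" using Suc by blast
  obtain v' where v': "v' \<in> A" "\<forall>t\<in>X. ev v' t = clamp (real m * ev x t - of_int (k - 1))" using Suc by blast
  obtain w where w: "w \<in> A" "\<forall>t\<in>X. ev w t = min 1 (ev v t + ev x t)" using clan_plus v x by blast
  obtain u where u: "u \<in> A" "\<forall>t\<in>X. ev u t = max 0 (ev w t + ev v' t - 1)" using clan_odot w v' by blast
  have "ev u t = clamp (real (Suc m) * ev x t - of_int k)" if t: "t \<in> X" for t
  proof -
    define r where "r = real m * ev x t - of_int k"
    have r: "real (Suc m) * ev x t - of_int k = r + ev x t" "real m * ev x t - of_int (k - 1) = r + 1"
      by (simp_all add: r_def algebra_simps)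
    have "ev u t = max 0 (min 1 (clamp r + ev x t) + clamp (r + 1) - 1)"
      using u(2)[rule_format, OF t] v(2)[rule_format, OF t] v'(2)[rule_format, OF t] w(2)[rule_format, OF t]
      by (simp only: r r_def[symmetric])
    then show ?thesis
      using clamp_Suc[of "ev x t" r] clan_range[OF x t] by (simp only: r)
  qed
  then show ?case using u by blast
qed

text \<open>Only the values 0 and 1 are recorded, as the covering arguments use no others; the empty
  family is served by the constant one.\<close>

lemma clan_finite_min:
  "finite I \<Longrightarrow> (\<And>i. i \<in> I \<Longrightarrow> w i \<in> A) \<Longrightarrow> \<exists>u\<in>A. \<forall>t\<in>X.
     ((\<forall>i\<in>I. ev (w i) t = 1) \<longrightarrow> ev u t = 1) \<and> ((\<exists>i\<in>I. ev (w i) t = 0) \<longrightarrow> ev u t = 0)"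
proof (induction I rule: finite_induct)
  case empty
  then show ?case using clan_one by auto
next
  case (insert i I)
  have "\<exists>u\<in>A. \<forall>t\<in>X. ((\<forall>i\<in>I. ev (w i) t = 1) \<longrightarrow> ev u t = 1)
      \<and> ((\<exists>i\<in>I. ev (w i) t = 0) \<longrightarrow> ev u t = 0)"
    by (rule insert.IH) (use insert.prems in auto)
  then obtain u where u: "u \<in> A" "\<forall>t\<in>X. ((\<forall>i\<in>I. ev (w i) t = 1) \<longrightarrow> ev u t = 1)
      \<and> ((\<exists>i\<in>I. ev (w i) t = 0) \<longrightarrow> ev u t = 0)" by (elim bexE) (rule that)
  obtain v where v: "v \<in> A" "\<forall>t\<in>X. ev v t = min (ev (w i) t) (ev u t)"
    using clan_min[OF insert.prems[OF insertI1] u(1)] by (elim bexE) (rule that)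
  show ?case
  proof (intro bexI[OF _ v(1)] ballI conjI impI)
    fix t assume t: "t \<in> X"
    have r: "0 \<le> ev u t" "0 \<le> ev (w i) t"
      using clan_range[OF u(1) t] clan_range[OF insert.prems[of i] t] by auto
    show "ev v t = 1" if "\<forall>j\<in>insert i I. ev (w j) t = 1" using that u v t by simp
    show "ev v t = 0" if "\<exists>j\<in>insert i I. ev (w j) t = 0"
      using that u(2) v(2) t r by (auto simp: min_def)
  qed
qed

end

section \<open>Separation of compact sets by a clan\<close>

locale separating_clan = function_clan X A ev
  for X :: "'b::t2_space set" and A :: "'a set" and ev :: "'a \<Rightarrow> 'b \<Rightarrow> real" +
  assumes clan_compact: "compact X"
    and clan_continuous: "x \<in> A \<Longrightarrow> continuous_on X (ev x)"
    and clan_separates: "s \<in> X \<Longrightarrow> t \<in> X \<Longrightarrow> s \<noteq> t \<Longrightarrow> \<exists>x\<in>A. ev x s \<noteq> ev x t"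
begin

lemma separate_points:
  assumes st: "s \<in> X" "t \<in> X" "s \<noteq> t"
  shows "\<exists>u\<in>A. \<exists>P Q. open P \<and> open Q \<and> s \<in> P \<and> t \<in> Q
    \<and> (\<forall>r\<in>X \<inter> P. ev u r = 1) \<and> (\<forall>r\<in>X \<inter> Q. ev u r = 0)"
proof -
  \<comment> \<open>If a separating element is larger at \<open>t\<close>, its complement is larger
    at \<open>s\<close>.\<close>
  obtain x where x: "x \<in> A" "ev x t < ev x s"
  proof -
    obtain y where y: "y \<in> A" "ev y s \<noteq> ev y t" using clan_separates[OF st] by blast
    moreover obtain z where "z \<in> A" "\<forall>r\<in>X. ev z r = 1 - ev y r" using clan_neg y by blast
    ultimately show ?thesis using that[of y] that[of z] st by (cases "ev y t < ev y s") auto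
  qed
  \<comment> \<open>The gap between the two values is stretched beyond 2, so that the interval from
    \<open>k\<close> to \<open>k + 1\<close> fits strictly inside for some integer \<open>k\<close>.
    Truncating \<open>m x - k\<close> then gives 0 near \<open>t\<close> and 1 near
    \<open>s\<close>.\<close>
  obtain m :: nat where m: "2 / (ev x s - ev x t) < real m" using reals_Archimedean2 by blast
  define k where "k = \<lfloor>real m * ev x t\<rfloor> + 1"
  have k: "real m * ev x t < of_int k" "of_int k \<le> real m * ev x t + 1"
    unfolding k_def by linarith+
  have "2 < real m * (ev x s - ev x t)" using m x by (simp add: divide_less_eq)
  then have k2: "of_int k + 1 < real m * ev x s" using k by (simp add: algebra_simps)
  obtain u where u: "u \<in> A" "\<forall>r\<in>X. ev u r = clamp (real m * ev x r - of_int k)"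
    using clan_clamp[OF x(1)] by blast
  define f where "f r = real m * ev x r - of_int k" for r
  have f: "continuous_on X f" unfolding f_def using x clan_continuous by (intro continuous_intros)
  obtain P where P: "open P" "P \<inter> X = f -` {1<..} \<inter> X"
    using f by (metis continuous_on_open_invariant open_greaterThan)
  obtain Q where Q: "open Q" "Q \<inter> X = f -` {..<0} \<inter> X"
    using f by (metis continuous_on_open_invariant open_lessThan)
  have PQ: "r \<in> P \<longleftrightarrow> 1 < f r" "r \<in> Q \<longleftrightarrow> f r < 0" if "r \<in> X" for r using P Q that by auto
  show ?thesis
    using P(1) Q(1) st u k k2 PQ
    by (intro bexI[OF _ u(1)] exI[of _ P] exI[of _ Q]) (auto simp: f_def)
qed

lemma clan_finite_minE:
  assumes "finite I" "\<And>i. i \<in> I \<Longrightarrow> w i \<in> A"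
  obtains u where "u \<in> A"
    "\<And>t. t \<in> X \<Longrightarrow> (\<And>i. i \<in> I \<Longrightarrow> ev (w i) t = 1) \<Longrightarrow> ev u t = 1"
    "\<And>i t. i \<in> I \<Longrightarrow> t \<in> X \<Longrightarrow> ev (w i) t = 0 \<Longrightarrow> ev u t = 0"
proof -
  have "\<exists>u\<in>A. \<forall>t\<in>X. ((\<forall>i\<in>I. ev (w i) t = 1) \<longrightarrow> ev u t = 1)
      \<and> ((\<exists>i\<in>I. ev (w i) t = 0) \<longrightarrow> ev u t = 0)"
    by (rule clan_finite_min) (use assms in auto)
  then obtain u where u: "u \<in> A" "\<forall>t\<in>X. ((\<forall>i\<in>I. ev (w i) t = 1) \<longrightarrow> ev u t = 1)
      \<and> ((\<exists>i\<in>I. ev (w i) t = 0) \<longrightarrow> ev u t = 0)"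
    by (elim bexE) (rule that)
  show ?thesis by (rule that[OF u(1)]) (use u(2) in auto)
qed

text \<open>The value 1 is secured on a whole neighbourhood of \<open>s\<close>, because the next
  covering argument needs open sets.\<close>

lemma separate_point_compact:
  assumes s: "s \<in> X" "s \<notin> F" and F: "compact F" "F \<subseteq> X"
  shows "\<exists>u\<in>A. \<exists>P. open P \<and> s \<in> P \<and> (\<forall>r\<in>X \<inter> P. ev u r = 1) \<and> (\<forall>r\<in>F. ev u r = 0)"
proof -
  have "\<forall>t\<in>F. \<exists>u P Q. u \<in> A \<and> open P \<and> open Q \<and> s \<in> P \<and> t \<in> Q
      \<and> (\<forall>r\<in>X \<inter> P. ev u r = 1) \<and> (\<forall>r\<in>X \<inter> Q. ev u r = 0)"
  proof
    fix t assume "t \<in> F"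
    then have "\<exists>u\<in>A. \<exists>P Q. open P \<and> open Q \<and> s \<in> P \<and> t \<in> Q
      \<and> (\<forall>r\<in>X \<inter> P. ev u r = 1) \<and> (\<forall>r\<in>X \<inter> Q. ev u r = 0)"
      using s F by (intro separate_points) auto
    then show "\<exists>u P Q. u \<in> A \<and> open P \<and> open Q \<and> s \<in> P \<and> t \<in> Q
      \<and> (\<forall>r\<in>X \<inter> P. ev u r = 1) \<and> (\<forall>r\<in>X \<inter> Q. ev u r = 0)"
      by (elim bexE exE) (intro exI conjI; (elim conjE)?; assumption)
  qed
  then have "\<exists>u P Q. \<forall>t\<in>F. u t \<in> A \<and> open (P t) \<and> open (Q t) \<and> s \<in> P t \<and> t \<in> Q t
      \<and> (\<forall>r\<in>X \<inter> P t. ev (u t) r = 1) \<and> (\<forall>r\<in>X \<inter> Q t. ev (u t) r = 0)"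
    unfolding bchoice_iff .
  then obtain u P Q where "\<forall>t\<in>F. u t \<in> A \<and> open (P t) \<and> open (Q t) \<and> s \<in> P t \<and> t \<in> Q t
      \<and> (\<forall>r\<in>X \<inter> P t. ev (u t) r = 1) \<and> (\<forall>r\<in>X \<inter> Q t. ev (u t) r = 0)"
    by (elim exE) (rule that)
  then have *: "\<And>t. t \<in> F \<Longrightarrow> u t \<in> A" "\<And>t. t \<in> F \<Longrightarrow> open (P t)"
      "\<And>t. t \<in> F \<Longrightarrow> open (Q t)" "\<And>t. t \<in> F \<Longrightarrow> s \<in> P t" "\<And>t. t \<in> F \<Longrightarrow> t \<in> Q t"
      "\<And>t r. t \<in> F \<Longrightarrow> r \<in> X \<Longrightarrow> r \<in> P t \<Longrightarrow> ev (u t) r = 1"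
      "\<And>t r. t \<in> F \<Longrightarrow> r \<in> X \<Longrightarrow> r \<in> Q t \<Longrightarrow> ev (u t) r = 0"
    by auto
  obtain C where C: "C \<subseteq> F" "finite C" "F \<subseteq> (\<Union>t\<in>C. Q t)"
  proof (rule compactE_image[OF F(1), of F Q])
    show "F \<subseteq> (\<Union>t\<in>F. Q t)" using *(5) by blast
  qed (use *(3) in auto)
  obtain w where w: "w \<in> A" "\<And>t. t \<in> X \<Longrightarrow> (\<And>i. i \<in> C \<Longrightarrow> ev (u i) t = 1) \<Longrightarrow> ev w t = 1"
      "\<And>i t. i \<in> C \<Longrightarrow> t \<in> X \<Longrightarrow> ev (u i) t = 0 \<Longrightarrow> ev w t = 0"
    using clan_finite_minE[OF C(2), of u] *(1) C(1) by blast
  show ?thesis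
  proof (intro bexI[OF _ w(1)] exI[of _ "\<Inter>t\<in>C. P t"] conjI ballI)
    show "open (\<Inter>t\<in>C. P t)" using *(2) C by (intro open_INT) auto
    show "s \<in> (\<Inter>t\<in>C. P t)" using *(4) C(1) by auto
    show "ev w r = 1" if "r \<in> X \<inter> (\<Inter>t\<in>C. P t)" for r
      using that *(6) C(1) by (intro w(2)) auto
    show "ev w r = 0" if r: "r \<in> F" for r
    proof -
      obtain t where "t \<in> C" "r \<in> Q t" using r C(3) by auto
      then show ?thesis using r *(7) C(1) F(2) by (intro w(3)[of t]) auto
    qed
  qed
qed

text \<open>Each point of \<open>F\<close> is separated from \<open>K\<close> and the separating
  element is complemented: it is then 1 on \<open>K\<close>, which finite meets preserve, and 0 near
  the point of \<open>F\<close>.\<close>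

lemma separate_compacts:
  assumes K: "compact K" "K \<subseteq> X" and F: "compact F" "F \<subseteq> X" and disj: "K \<inter> F = {}"
  shows "\<exists>u\<in>A. (\<forall>r\<in>K. ev u r = 1) \<and> (\<forall>r\<in>F. ev u r = 0)"
proof -
  have "\<forall>s\<in>F. \<exists>u P. u \<in> A \<and> open P \<and> s \<in> P
      \<and> (\<forall>r\<in>X \<inter> P. ev u r = 0) \<and> (\<forall>r\<in>K. ev u r = 1)"
  proof
    fix s assume "s \<in> F"
    then have "s \<in> X" "s \<notin> K" using F disj by auto
    from separate_point_compact[OF this K] obtain v P where vP: "v \<in> A" "open P" "s \<in> P"
        "\<forall>r\<in>X \<inter> P. ev v r = 1" "\<forall>r\<in>K. ev v r = 0"
      by (elim bexE exE conjE) (rule that)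
    from clan_neg[OF vP(1)] obtain u where "u \<in> A" "\<forall>r\<in>X. ev u r = 1 - ev v r"
      by (elim bexE) (rule that)
    with vP show "\<exists>u P. u \<in> A \<and> open P \<and> s \<in> P
      \<and> (\<forall>r\<in>X \<inter> P. ev u r = 0) \<and> (\<forall>r\<in>K. ev u r = 1)"
      using K by (intro exI[of _ u] exI[of _ P]) auto
  qed
  then have "\<exists>u P. \<forall>s\<in>F. u s \<in> A \<and> open (P s) \<and> s \<in> P s
      \<and> (\<forall>r\<in>X \<inter> P s. ev (u s) r = 0) \<and> (\<forall>r\<in>K. ev (u s) r = 1)"
    unfolding bchoice_iff .
  then obtain u P where "\<forall>s\<in>F. u s \<in> A \<and> open (P s) \<and> s \<in> P s
      \<and> (\<forall>r\<in>X \<inter> P s. ev (u s) r = 0) \<and> (\<forall>r\<in>K. ev (u s) r = 1)"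
    by (elim exE) (rule that)
  then have *: "\<And>t. t \<in> F \<Longrightarrow> u t \<in> A" "\<And>t. t \<in> F \<Longrightarrow> open (P t)"
      "\<And>t. t \<in> F \<Longrightarrow> t \<in> P t"
      "\<And>t r. t \<in> F \<Longrightarrow> r \<in> X \<Longrightarrow> r \<in> P t \<Longrightarrow> ev (u t) r = 0"
      "\<And>t r. t \<in> F \<Longrightarrow> r \<in> K \<Longrightarrow> ev (u t) r = 1"
    by auto
  obtain C where C: "C \<subseteq> F" "finite C" "F \<subseteq> (\<Union>t\<in>C. P t)"
  proof (rule compactE_image[OF F(1), of F P])
    show "F \<subseteq> (\<Union>t\<in>F. P t)" using *(3) by blast
  qed (use *(2) in auto)
  obtain w where w: "w \<in> A" "\<And>t. t \<in> X \<Longrightarrow> (\<And>i. i \<in> C \<Longrightarrow> ev (u i) t = 1) \<Longrightarrow> ev w t = 1"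
      "\<And>i t. i \<in> C \<Longrightarrow> t \<in> X \<Longrightarrow> ev (u i) t = 0 \<Longrightarrow> ev w t = 0"
    using clan_finite_minE[OF C(2), of u] *(1) C(1) by blast
  show ?thesis
  proof (intro bexI[OF _ w(1)] conjI ballI)
    show "ev w r = 1" if "r \<in> K" for r
      using that *(5) C(1) K(2) by (intro w(2)) auto
    show "ev w r = 0" if r: "r \<in> F" for r
    proof -
      obtain t where "t \<in> C" "r \<in> P t" using r C(3) by auto
      then show ?thesis using r *(4) C(1) F(2) by (intro w(3)[of t]) auto
    qed
  qed
qed

lemma represented_measure_unique:
  assumes "regular_borel_measure X \<mu>" "\<forall>x\<in>A. has_bochner_integral \<mu> (ev x) (T x)"
    and "regular_borel_measure X \<nu>" "\<forall>x\<in>A. has_bochner_integral \<nu> (ev x) (T x)"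
  shows "\<mu> = \<nu>"
proof (rule regular_borel_measure_unique[OF assms(1,3)])
  fix K U assume K: "compact K" "K \<subseteq> U" and U: "openin (top_of_set X) U"
  have UX: "U \<subseteq> X" using U openin_imp_subset by blast
  obtain O' where "open O'" "U = X \<inter> O'" using U by (auto simp: openin_open)
  then have "X - U = X - O'" "open O'" by auto
  then have "compact (X - U)" using clan_compact compact_diff by metis
  then obtain u where u: "u \<in> A" "\<forall>r\<in>K. ev u r = 1" "\<forall>r\<in>X - U. ev u r = 0"
    using separate_compacts[of K "X - U"] K UX by blast
  then show "\<exists>(f :: 'b \<Rightarrow> real) r. has_bochner_integral \<mu> f r \<and> has_bochner_integral \<nu> f r
      \<and> (\<forall>t\<in>X. 0 \<le> f t \<and> f t \<le> 1) \<and> (\<forall>t\<in>K. f t = 1) \<and> (\<forall>t\<in>X - U. f t = 0)"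
    using assms clan_range by (intro exI[of _ "ev u"] exI[of _ "T u"]) auto
qed

end

text \<open>One domination hypothesis stands in for linearity, positivity and normalisation, and it
  makes \<open>T\<close> depend only on the values of an element. The bound \<open>b\<close> plays
  the part of a multiple of the constant one.\<close>

locale clan_functional = separating_clan X A ev
  for X :: "'b::t2_space set" and A :: "'a set" and ev :: "'a \<Rightarrow> 'b \<Rightarrow> real" +
  fixes T :: "'a \<Rightarrow> real"
  assumes dominated: "snd ` set xs \<subseteq> A \<Longrightarrow> (\<And>t. t \<in> X \<Longrightarrow> (\<Sum>(c, x)\<leftarrow>xs. c * ev x t) \<le> b)
      \<Longrightarrow> (\<Sum>(c, x)\<leftarrow>xs. c * T x) \<le> b"
begin

lemma T_mono: "x \<in> A \<Longrightarrow> y \<in> A \<Longrightarrow> (\<And>t. t \<in> X \<Longrightarrow> ev x t \<le> ev y t) \<Longrightarrow> T x \<le> T y"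
  using dominated[of "[(1, x), (-1, y)]" 0] by auto

lemma T_add_le:
  assumes A: "x \<in> A" "y \<in> A" "z \<in> A" and le: "\<And>t. t \<in> X \<Longrightarrow> ev x t \<le> ev y t + ev z t"
  shows "T x \<le> T y + T z"
proof -
  have "(\<Sum>(c, x)\<leftarrow>[(1, x), (-1, y), (-1, z)]. c * T x) \<le> 0"
  proof (rule dominated)
    show "(\<Sum>(c, x)\<leftarrow>[(1, x), (-1, y), (-1, z)]. c * ev x t) \<le> 0" if "t \<in> X" for t
      using le[OF that] by simp
  qed (use A in auto)
  then show ?thesis by simp
qed

lemma T_le_add:
  assumes A: "x \<in> A" "y \<in> A" "z \<in> A" and le: "\<And>t. t \<in> X \<Longrightarrow> ev y t + ev z t \<le> ev x t"
  shows "T y + T z \<le> T x"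
proof -
  have "(\<Sum>(c, x)\<leftarrow>[(-1, x), (1, y), (1, z)]. c * T x) \<le> 0"
  proof (rule dominated)
    show "(\<Sum>(c, x)\<leftarrow>[(-1, x), (1, y), (1, z)]. c * ev x t) \<le> 0" if "t \<in> X" for t
      using le[OF that] by simp
  qed (use A in auto)
  then show ?thesis by simp
qed

lemma T_nonneg: "x \<in> A \<Longrightarrow> 0 \<le> T x"
  using dominated[of "[(-1, x)]" 0] clan_range by auto

lemma T_le_one: "x \<in> A \<Longrightarrow> T x \<le> 1"
  using dominated[of "[(1, x)]" 1] clan_range by auto

lemma T_ge_one: "x \<in> A \<Longrightarrow> (\<And>t. t \<in> X \<Longrightarrow> ev x t = 1) \<Longrightarrow> 1 \<le> T x"
  using dominated[of "[(-1, x)]" "-1"] by auto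

lemma T_neg:
  assumes "x \<in> A" "y \<in> A" "\<And>t. t \<in> X \<Longrightarrow> ev y t = 1 - ev x t" shows "T y = 1 - T x"
  using dominated[of "[(1, x), (1, y)]" 1] dominated[of "[(-1, x), (-1, y)]" "-1"] assms by auto

text \<open>Riesz's infimum over the functions above the indicator of \<open>K\<close>: as values
  never exceed 1, lying above it means being 1 on \<open>K\<close>.\<close>

definition content where
  "content K = (INF w\<in>{w \<in> A. \<forall>t\<in>K. ev w t = 1}. ennreal (T w))"

lemma content_approx:
  assumes "K \<subseteq> X" "0 < e"
  obtains w where "w \<in> A" "\<forall>t\<in>K. ev w t = 1" "ennreal (T w) \<le> content K + ennreal e"
proof -
  obtain w where "w \<in> A" "\<forall>t\<in>X. ev w t = 1" using clan_one by blast
  then have "content K \<le> ennreal (T w)" using assms unfolding content_def by (intro INF_lower) auto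
  then have "content K \<noteq> \<infinity>" by (auto simp: top_unique)
  then show ?thesis
    using INF_approx_ennreal[OF assms(2) content_def] that by (auto intro: less_imp_le)
qed

sublocale compact_content X content
proof
  show "compact X" by (rule clan_compact)
  obtain w where w: "w \<in> A" "\<forall>t\<in>X. ev w t = 1" using clan_one by blast
  then have "content X \<le> ennreal (T w)" unfolding content_def by (intro INF_lower) auto
  then show "content X < \<infinity>" by (auto intro: le_less_trans)
  obtain z where z: "z \<in> A" "\<forall>t\<in>X. ev z t = 0" using clan_zero by blast
  then have "T z \<le> 0" using dominated[of "[(1, z)]" 0] by auto
  moreover have "content {} \<le> ennreal (T z)" using z unfolding content_def by (intro INF_lower) auto
  ultimately show "content {} = 0" by (simp add: ennreal_neg)
  fix K L :: "'b set" assume KL: "compact K" "compact L"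
  show "content K \<le> content L" if "K \<subseteq> L"
    unfolding content_def using that by (intro INF_superset_mono) auto
  show "content (K \<union> L) \<le> content K + content L" if sub: "K \<subseteq> X" "L \<subseteq> X"
  proof (rule ennreal_le_epsilon)
    fix e :: real assume e: "0 < e"
    obtain u where u: "u \<in> A" "\<forall>t\<in>K. ev u t = 1" "ennreal (T u) \<le> content K + ennreal (e / 2)"
      using content_approx[OF sub(1), of "e / 2"] e by auto
    obtain v where v: "v \<in> A" "\<forall>t\<in>L. ev v t = 1" "ennreal (T v) \<le> content L + ennreal (e / 2)"
      using content_approx[OF sub(2), of "e / 2"] e by auto
    \<comment> \<open>The truncated sum is 1 on both sets and costs at most the sum of the two
      values.\<close>
    obtain w where w: "w \<in> A" "\<forall>t\<in>X. ev w t = min 1 (ev u t + ev v t)"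
      using clan_plus u v by blast
    have "ev w t = 1" if "t \<in> K \<union> L" for t
      using that u v w sub clan_range[OF u(1), of t] clan_range[OF v(1), of t] by auto
    then have "content (K \<union> L) \<le> ennreal (T w)"
      unfolding content_def using w(1) by (intro INF_lower) auto
    also have "\<dots> \<le> ennreal (T u + T v)"
      using w u v by (intro ennreal_leI T_add_le) auto
    also have "\<dots> = ennreal (T u) + ennreal (T v)"
      using u v T_nonneg by simp
    also have "\<dots> \<le> (content K + ennreal (e / 2)) + (content L + ennreal (e / 2))"
      using u v by (intro add_mono) auto
    also have "\<dots> = content K + content L + (ennreal (e / 2) + ennreal (e / 2))"
      by (simp add: ac_simps)
    also have "ennreal (e / 2) + ennreal (e / 2) = ennreal e"
      using e by (simp flip: ennreal_plus)
    finally show "content (K \<union> L) \<le> content K + content L + ennreal e" .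
  qed
  show "content K + content L \<le> content (K \<union> L)" if sub: "K \<subseteq> X" "L \<subseteq> X" "K \<inter> L = {}"
    unfolding content_def[of "K \<union> L"]
  proof (rule INF_greatest, clarify)
    fix w assume w: "w \<in> A" "\<forall>t\<in>K \<union> L. ev w t = 1"
    \<comment> \<open>This \<open>u\<close> splits \<open>w\<close> into its meet with
      \<open>u\<close>, which is 1 on \<open>K\<close>, and its excess over \<open>u\<close>, which
      is 1 on \<open>L\<close>; pointwise the two pieces add up to \<open>w\<close>.\<close>
    obtain u where u: "u \<in> A" "\<forall>t\<in>K. ev u t = 1" "\<forall>t\<in>L. ev u t = 0"
      using separate_compacts KL sub by metis
    obtain p where p: "p \<in> A" "\<forall>t\<in>X. ev p t = min (ev w t) (ev u t)" using clan_min w u by blast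
    obtain q where q: "q \<in> A" "\<forall>t\<in>X. ev q t = max 0 (ev w t - ev u t)" using clan_diff w u by blast
    have "content K + content L \<le> ennreal (T p) + ennreal (T q)"
      unfolding content_def using w u p q sub by (intro add_mono INF_lower) auto
    also have "\<dots> = ennreal (T p + T q)" using p q T_nonneg by simp
    also have "\<dots> \<le> ennreal (T w)" using p q w by (intro ennreal_leI T_le_add) auto
    finally show "content K + content L \<le> ennreal (T w)" .
  qed
qed

lemma content_total: "content X = 1"
proof (rule antisym)
  obtain w where w: "w \<in> A" "\<forall>t\<in>X. ev w t = 1" using clan_one by blast
  then have "content X \<le> ennreal (T w)" unfolding content_def by (intro INF_lower) auto
  also have "\<dots> \<le> 1" using T_le_one[OF w(1)] by simp
  finally show "content X \<le> 1" .
  show "1 \<le> content X" unfolding content_def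
    using T_ge_one by (auto intro!: INF_greatest)
qed

lemma prob_content_measure: "prob_space content_measure"
  using emeasure_content_measure_space content_total space_content_measure by (intro prob_spaceI) simp

lemma ev_integrable: "x \<in> A \<Longrightarrow> integrable content_measure (ev x)"
proof -
  assume x: "x \<in> A"
  interpret prob_space content_measure by (rule prob_content_measure)
  have "ev x \<in> borel_measurable (restrict_space borel X)"
    by (rule borel_measurable_continuous_on_restrict[OF clan_continuous[OF x]])
  then have "ev x \<in> borel_measurable content_measure"
    using sets_content_measure by (simp cong: measurable_cong_sets)
  then show ?thesis
    using clan_range[OF x] space_content_measure by (intro integrable_const_bound[of _ 1]) auto
qed

text \<open>Slicing \<open>n x\<close> into the layers \<open>clamp (n x - k)\<close>, each of which is bounded by the content of
  the level set where \<open>n x \<ge> k\<close>.\<close>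

lemma T_le_integral:
  assumes x: "x \<in> A" shows "T x \<le> integral\<^sup>L content_measure (ev x)"
proof -
  interpret prob_space content_measure by (rule prob_content_measure)
  have *: "real n * T x \<le> real n * integral\<^sup>L content_measure (ev x) + 1" for n :: nat
  proof -
    have "\<exists>w. \<forall>k::nat. w k \<in> A \<and> (\<forall>t\<in>X. ev (w k) t = clamp (real n * ev x t - real k))"
      using clan_clamp[OF x, of n "int _"] by (intro choice) auto
    then obtain w where w: "\<And>k. w k \<in> A"
        "\<And>k t. t \<in> X \<Longrightarrow> ev (w k) t = clamp (real n * ev x t - real k)"
      by metis
    define E where "E k = {t \<in> X. real k \<le> real n * ev x t}" for k :: nat
    have E: "compact (E k)" "E k \<subseteq> X" for k
    proof -
      have "continuous_on X (\<lambda>t. real n * ev x t)"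
        using clan_continuous[OF x] by (intro continuous_intros)
      then have "closed (X \<inter> (\<lambda>t. real n * ev x t) -` {real k..})"
        using clan_compact compact_imp_closed by (intro continuous_closed_preimage) auto
      moreover have "X \<inter> (\<lambda>t. real n * ev x t) -` {real k..} = E k" by (auto simp: E_def)
      ultimately show "compact (E k)" using clan_compact compact_Int_closed[of X "E k"]
        by (auto simp: E_def Int_absorb1)
    qed (auto simp: E_def)
    \<comment> \<open>The layer vanishes off the level set, so every competitor in the infimum that
      defines the content lies above it.\<close>
    have layer: "T (w k) \<le> measure content_measure (E k)" for k
    proof -
      have "ennreal (T (w k)) \<le> content (E k)"
        unfolding content_def
      proof (rule INF_greatest, clarify)
        fix v assume v: "v \<in> A" "\<forall>t\<in>E k. ev v t = 1"
        have "ev (w k) t \<le> ev v t" if "t \<in> X" for t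
          using that v w(2)[of t k] clan_range[OF v(1), of t] by (cases "t \<in> E k") (auto simp: E_def)
        then show "ennreal (T (w k)) \<le> ennreal (T v)"
          using v w by (intro ennreal_leI T_mono) auto
      qed
      also have "\<dots> \<le> emeasure content_measure (E k)" using E content_le_measure by blast
      finally show ?thesis by (simp add: emeasure_eq_measure)
    qed
    have "(\<Sum>k<n. ev (w k) t) = real n * ev x t" if t: "t \<in> X" for t
    proof -
      have "real n * ev x t \<le> real n" using clan_range[OF x t] mult_left_mono[of "ev x t" 1 "real n"] by simp
      then show ?thesis using sum_clamp[of "real n * ev x t" n] w(2)[OF t] clan_range[OF x t] by simp
    qed
    then have "real n * T x \<le> (\<Sum>k<n. T (w k))"
      using dominated[of "(real n, x) # map (\<lambda>k. (-1, w k)) [0..<n]" 0] x w(1)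
      by (auto simp: o_def interv_sum_list_conv_sum_set_nat atLeast0LessThan sum_negf image_subset_iff)
    also have "(\<Sum>k<n. T (w k)) \<le> (\<Sum>k<n. measure content_measure (E k))"
      using layer by (intro sum_mono)
    also have "\<dots> = (\<Sum>k<n. \<integral>t. indicator (E k) t \<partial>content_measure)"
      using E compact_sets by simp
    also have "\<dots> = (\<integral>t. (\<Sum>k<n. indicator (E k) t) \<partial>content_measure)"
      using E compact_sets by (subst Bochner_Integration.integral_sum) (auto simp: emeasure_eq_measure)
    also have "\<dots> \<le> (\<integral>t. real n * ev x t + 1 \<partial>content_measure)"
    proof (rule integral_mono)
      fix t assume "t \<in> space content_measure"
      then have t: "t \<in> X" by (simp add: space_content_measure)
      \<comment> \<open>The shift by one makes the \<open>k\<close>-th layer of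
        \<open>n x + 1\<close> equal to 1 on \<open>E k\<close>. The surplus of one is bounded
        independently of \<open>n\<close>, and the Archimedean property removes it at the
        end.\<close>
      have "(\<Sum>k<n. indicator (E k) t) \<le> (\<Sum>k<n. clamp ((real n * ev x t + 1) - real k))"
        using t by (intro sum_mono) (auto simp: E_def indicator_def)
      also have "\<dots> \<le> real n * ev x t + 1"
        using clan_range[OF x t] by (subst sum_clamp) auto
      finally show "(\<Sum>k<n. indicator (E k) t) \<le> real n * ev x t + 1" .
    qed (use ev_integrable[OF x] E compact_sets in \<open>auto simp: emeasure_eq_measure\<close>)
    also have "\<dots> = real n * integral\<^sup>L content_measure (ev x) + 1"
      using ev_integrable[OF x] by (simp add: prob_space)
    finally show ?thesis by simp
  qed
  show ?thesis
  proof (rule ccontr)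
    assume "\<not> ?thesis"
    then have d: "0 < T x - integral\<^sup>L content_measure (ev x)" by simp
    then obtain n :: nat where "1 < real n * (T x - integral\<^sup>L content_measure (ev x))"
      using reals_Archimedean3 by blast
    then show False using *[of n] by (simp add: algebra_simps)
  qed
qed

text \<open>The missing inequality is \<open>T_le_integral\<close> at the complement of
  \<open>x\<close>, where both \<open>T\<close> and the integral are 1 minus their value at
  \<open>x\<close>.\<close>

lemma content_measure_represents:
  assumes x: "x \<in> A" shows "has_bochner_integral content_measure (ev x) (T x)"
proof -
  interpret prob_space content_measure by (rule prob_content_measure)
  obtain y where y: "y \<in> A" "\<forall>t\<in>X. ev y t = 1 - ev x t" using clan_neg[OF x] by blast
  have "integral\<^sup>L content_measure (ev y) = (\<integral>t. 1 - ev x t \<partial>content_measure)"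
    using y by (intro Bochner_Integration.integral_cong) (auto simp: space_content_measure)
  also have "\<dots> = 1 - integral\<^sup>L content_measure (ev x)"
    using ev_integrable[OF x] by (simp add: prob_space)
  finally have "integral\<^sup>L content_measure (ev x) \<le> T x"
    using T_le_integral[OF y(1)] T_neg[OF x y(1)] y(2) by simp
  then show ?thesis
    using T_le_integral[OF x] ev_integrable[OF x] by (simp add: has_bochner_integral_iff)
qed

end

section \<open>The state space of an MV-algebra\<close>

lemma continuous_on_coordinate: "continuous_on S (\<lambda>f :: 'a \<Rightarrow> 'b::topological_space. f i)"
  by (rule continuous_on_subset[OF continuous_on_product_coordinates]) simp

lemma compact_unit_maps: "compact (unit_maps A)"
proof -
  define S where "S x = (if x \<in> A then {0..1} else {0 :: real})" for x
  have "unit_maps A = Pi\<^sub>E UNIV S"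
  proof (intro set_eqI iffI)
    fix s assume "s \<in> Pi\<^sub>E UNIV S"
    then have s: "s x \<in> S x" for x by blast
    have "x \<in> A \<Longrightarrow> 0 \<le> s x \<and> s x \<le> 1" "x \<notin> A \<Longrightarrow> s x = 0" for x
      using s[of x] by (auto simp: S_def)
    then show "s \<in> unit_maps A" by (auto simp: unit_maps_def)
  qed (auto simp: unit_maps_def S_def)
  moreover have "compactin (product_topology (\<lambda>_. euclidean) UNIV) (Pi\<^sub>E UNIV S)"
    by (auto simp: compactin_PiE S_def)
  ultimately show ?thesis by (simp add: euclidean_product_topology)
qed

lemma closed_Collect_const_imp: "(Q \<Longrightarrow> closed {s. R s}) \<Longrightarrow> closed {s. Q \<longrightarrow> R s}"
  by (cases Q) auto

lemmas closed_coordinate_intros =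
  closed_Collect_all closed_Collect_const_imp closed_Collect_conj closed_Collect_eq
  continuous_on_coordinate continuous_on_add continuous_on_diff continuous_on_min
  continuous_on_max continuous_on_const

section \<open>Faces and extreme points of compact convex sets\<close>

lemma face_of_maximum:
  assumes "convex K" "linear \<phi>" and le: "\<And>x. x \<in> K \<Longrightarrow> \<phi> x \<le> (m :: real)"
  shows "{x \<in> K. \<phi> x = m} face_of K"
  unfolding face_of_def
proof (intro conjI ballI impI)
  show "convex {x \<in> K. \<phi> x = m}"
    using assms(1,2) unfolding convex_def
    by (auto simp: linear_add linear_scale simp flip: distrib_right)
  fix a b x assume ab: "a \<in> K" "b \<in> K" and x: "x \<in> {x \<in> K. \<phi> x = m}" "x \<in> open_segment a b"
  then obtain u where u: "0 < u" "u < 1" "x = (1 - u) *\<^sub>R a + u *\<^sub>R b" by (auto simp: in_segment)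
  then have m: "(1 - u) * \<phi> a + u * \<phi> b = m" using x assms(2) by (simp add: linear_add linear_scale)
  have "(1 - u) * \<phi> a \<le> (1 - u) * m" "u * \<phi> b \<le> u * m"
    using le ab u by (auto intro: mult_left_mono)
  moreover have "(1 - u) * m + u * m = m" by (simp add: algebra_simps)
  moreover have "p = p' \<and> q = q'" if "p \<le> p'" "q \<le> q'" "p + q = p' + q'" for p p' q q' :: real
    using that by linarith
  ultimately have "(1 - u) * \<phi> a = (1 - u) * m" "u * \<phi> b = u * m" using m by metis+
  then show "a \<in> {x \<in> K. \<phi> x = m}" "b \<in> {x \<in> K. \<phi> x = m}" using u ab by auto
qed auto

text \<open>A minimal non-empty closed face is a singleton, since the coordinates separate points and each
  attains its maximum on a smaller closed face.\<close>

lemma compact_convex_has_extreme_point: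
  fixes K :: "('a \<Rightarrow> real) set"
  assumes K: "compact K" "K \<noteq> {}" "convex K"
  shows "\<exists>x. x extreme_point_of K"
proof -
  define \<F> where "\<F> = {F. F face_of K \<and> closed F \<and> F \<noteq> {}}"
  have "K \<in> \<F>" using K by (auto simp: \<F>_def face_of_refl compact_imp_closed)
  \<comment> \<open>Complements turn a minimal face into a maximal set, as Zorn's lemma for
    inclusion produces. A chain is bounded by the complement of the intersection of its faces, which
    is non-empty by compactness of \<open>K\<close>.\<close>
  have "\<exists>M\<in>uminus ` \<F>. \<forall>X\<in>uminus ` \<F>. M \<subseteq> X \<longrightarrow> X = M"
  proof (rule subset_Zorn_nonempty)
    show "uminus ` \<F> \<noteq> {}" using \<open>K \<in> \<F>\<close> by auto
    fix \<C> assume C: "\<C> \<noteq> {}" "subset.chain (uminus ` \<F>) \<C>"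
    define \<G> where "\<G> = uminus ` \<C>"
    have G: "\<G> \<noteq> {}" "\<G> \<subseteq> \<F>" and chain: "subset.chain \<F> \<G>"
      using C by (auto simp: \<G>_def subset_chain_def)
    have "K \<inter> \<Inter>\<G> \<noteq> {}"
    proof (rule compact_imp_fip[OF K(1)])
      show "closed T" if "T \<in> \<G>" for T using that G by (auto simp: \<F>_def)
      fix \<H> assume H: "finite \<H>" "\<H> \<subseteq> \<G>"
      show "K \<inter> \<Inter>\<H> \<noteq> {}"
      proof (cases "\<H> = {}")
        case False
        have "subset.chain \<F> \<H>"
          using chain H(2) unfolding subset_chain_def by (meson subset_iff)
        then have "\<Inter>\<H> \<in> \<F>" using Inter_in_chain[OF H(1) False] H G by blast
        then have "\<Inter>\<H> \<noteq> {}" "\<Inter>\<H> \<subseteq> K" by (auto simp: \<F>_def dest: face_of_imp_subset)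
        then show ?thesis by blast
      qed (use K in auto)
    qed
    then have "\<Inter>\<G> \<noteq> {}" by blast
    moreover have "\<Inter>\<G> face_of K" using G by (intro face_of_Inter) (auto simp: \<F>_def)
    moreover have "closed (\<Inter>\<G>)" using G by (auto simp: \<F>_def)
    ultimately have "\<Inter>\<G> \<in> \<F>" by (simp add: \<F>_def)
    moreover have "\<Union>\<C> = - \<Inter>\<G>" by (auto simp: \<G>_def)
    ultimately show "\<Union>\<C> \<in> uminus ` \<F>" by blast
  qed
  then obtain F where F: "F \<in> \<F>" and min: "\<And>G. G \<in> \<F> \<Longrightarrow> G \<subseteq> F \<Longrightarrow> G = F"
    by auto
  have Ff: "F face_of K" "closed F" "F \<noteq> {}" using F by (auto simp: \<F>_def)
  have "F = K \<inter> F" using face_of_imp_subset[OF Ff(1)] by auto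
  then have Fc: "compact F" using K(1) Ff(2) compact_Int_closed by metis
  have "f i = g i" if fg: "f \<in> F" "g \<in> F" for f g i
  proof -
    have "continuous_on F (\<lambda>s. s i)" by (rule continuous_on_coordinate)
    then obtain m where m: "m \<in> F" "\<And>s. s \<in> F \<Longrightarrow> s i \<le> m i"
      using continuous_attains_sup[OF Fc Ff(3)] by blast
    define G where "G = {s \<in> F. s i = m i}"
    have "G face_of F" unfolding G_def
      using face_of_imp_convex[OF Ff(1)] m
      by (intro face_of_maximum) (auto intro!: linearI simp: scaleR_fun_def)
    then have "G face_of K" using Ff(1) face_of_trans by blast
    moreover have "G = F \<inter> {s. s i = m i}" by (auto simp: G_def)
    then have "closed G" using Ff(2) by (simp add: closed_Int closed_coordinate_intros)
    moreover have "G \<noteq> {}" using m by (auto simp: G_def)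
    ultimately have "G = F" by (intro min) (auto simp: \<F>_def G_def)
    then have "f \<in> G" "g \<in> G" using fg by auto
    then show ?thesis by (simp add: G_def)
  qed
  then have "f = g" if "f \<in> F" "g \<in> F" for f g using that by (auto simp: fun_eq_iff)
  then obtain x where "F = {x}" using Ff(3) by blast
  then show ?thesis using Ff(1) face_of_singleton by auto
qed

lemma linear_combination_coordinates:
  "linear (\<lambda>s :: 'a \<Rightarrow> real. \<Sum>(c, x)\<leftarrow>xs. c * s x)"
proof (rule linearI)
  show "(\<Sum>(c, x)\<leftarrow>xs. c * (s + t) x) = (\<Sum>(c, x)\<leftarrow>xs. c * s x) + (\<Sum>(c, x)\<leftarrow>xs. c * t x)"
    for s t :: "'a \<Rightarrow> real"
    by (induction xs) (auto simp: algebra_simps)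
  show "(\<Sum>(c, x)\<leftarrow>xs. c * (r *\<^sub>R s) x) = r *\<^sub>R (\<Sum>(c, x)\<leftarrow>xs. c * s x)"
    for r and s :: "'a \<Rightarrow> real"
    by (induction xs) (auto simp: scaleR_fun_def algebra_simps)
qed

lemma continuous_combination_coordinates:
  "continuous_on S (\<lambda>s :: 'a \<Rightarrow> real. \<Sum>(c, x)\<leftarrow>xs. c * s x)"
  by (induction xs) (auto intro!: continuous_intros continuous_on_coordinate simp: split_beta)

section \<open>Compactness of the state space and domination by morphisms\<close>

context mv_algebra
begin

lemma convex_states: "convex (mv_states N)"
proof (rule convexI)
  fix s t :: "'a \<Rightarrow> real" and u v :: real
  assume st: "s \<in> mv_states N" "t \<in> mv_states N" and uv: "0 \<le> u" "0 \<le> v" "u + v = 1"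
  have "u * s x + v * t x \<le> u * 1 + v * 1" if "x \<in> carr" for x
    using st uv that by (intro add_mono mult_left_mono) (auto simp: mv_states_def unit_maps_def)
  then show "u *\<^sub>R s + v *\<^sub>R t \<in> mv_states N"
    using st uv by (auto simp: mv_states_def unit_maps_def scaleR_fun_def algebra_simps)
qed

lemma compact_states: "compact (mv_states N)"
proof -
  have "mv_states N = unit_maps carr \<inter> {t. t \<one> = 1
     \<and> (\<forall>x. x \<in> carr \<longrightarrow> (\<forall>y. y \<in> carr \<longrightarrow> x \<odot> y = \<zero> \<longrightarrow> t (x \<oplus> y) = t x + t y))}"
    by (auto simp: mv_states_def)
  moreover have "closed {t :: 'a \<Rightarrow> real. t \<one> = 1
     \<and> (\<forall>x. x \<in> carr \<longrightarrow> (\<forall>y. y \<in> carr \<longrightarrow> x \<odot> y = \<zero> \<longrightarrow> t (x \<oplus> y) = t x + t y))}"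
    by (intro closed_coordinate_intros)
  ultimately show ?thesis using compact_Int_closed[OF compact_unit_maps] by simp
qed

lemma compact_state_morphisms: "compact (mv_state_morphisms N)"
proof -
  have "mv_state_morphisms N = unit_maps carr \<inter> {t.
     (\<forall>x. x \<in> carr \<longrightarrow> (\<forall>y. y \<in> carr \<longrightarrow> t (x \<oplus> y) = min (t x + t y) 1))
     \<and> (\<forall>x. x \<in> carr \<longrightarrow> t (\<sim>x) = 1 - t x) \<and> t \<zero> = 0 \<and> t \<one> = 1}"
    by (auto simp: mv_state_morphisms_def)
  moreover have "closed {t :: 'a \<Rightarrow> real.
     (\<forall>x. x \<in> carr \<longrightarrow> (\<forall>y. y \<in> carr \<longrightarrow> t (x \<oplus> y) = min (t x + t y) 1))
     \<and> (\<forall>x. x \<in> carr \<longrightarrow> t (\<sim>x) = 1 - t x) \<and> t \<zero> = 0 \<and> t \<one> = 1}"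
    by (intro closed_coordinate_intros)
  ultimately show ?thesis using compact_Int_closed[OF compact_unit_maps] by simp
qed

lemma morphism_odot: "h \<in> mv_state_morphisms N \<Longrightarrow> x \<in> carr \<Longrightarrow> y \<in> carr \<Longrightarrow> h (x \<odot> y) = max 0 (h x + h y - 1)"
  by (auto simp: mv_state_morphisms_def mv_odot_def)

lemma morphism_join: "h \<in> mv_state_morphisms N \<Longrightarrow> x \<in> carr \<Longrightarrow> y \<in> carr \<Longrightarrow> h (mv_join N x y) = max (h x) (h y)"
  by (auto simp: mv_join_def mv_state_morphisms_def unit_maps_def morphism_odot max_def min_def)

lemma morphism_meet: "h \<in> mv_state_morphisms N \<Longrightarrow> x \<in> carr \<Longrightarrow> y \<in> carr \<Longrightarrow> h (x \<sqinter>\<^sub>N y) = min (h x) (h y)"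
  by (auto simp: mv_meet_def mv_state_morphisms_def unit_maps_def morphism_odot max_def min_def)

lemma morphism_state: assumes h: "h \<in> mv_state_morphisms N" shows "h \<in> mv_states N"
proof -
  have "h (x \<oplus> y) = h x + h y" if "x \<in> carr" "y \<in> carr" "x \<odot> y = \<zero>" for x y
    using h morphism_odot[OF h that(1,2)] that by (auto simp: mv_state_morphisms_def)
  then show ?thesis using h by (auto simp: mv_state_morphisms_def mv_states_def)
qed

text \<open>A linear functional attains its maximum over the states on a closed face, hence at an extreme
  point, which is a morphism.\<close>

lemma state_dominated:
  assumes s: "s \<in> mv_states N"
    and b: "\<And>h. h \<in> mv_state_morphisms N \<Longrightarrow> (\<Sum>(c, x)\<leftarrow>xs. c * h x) \<le> b"
  shows "(\<Sum>(c, x)\<leftarrow>xs. c * s x) \<le> b"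
proof -
  define \<phi> where "\<phi> s = (\<Sum>(c, x)\<leftarrow>xs. c * s x)" for s :: "'a \<Rightarrow> real"
  have lin: "linear \<phi>" unfolding \<phi>_def by (rule linear_combination_coordinates)
  have cont: "continuous_on S \<phi>" for S unfolding \<phi>_def by (rule continuous_combination_coordinates)
  obtain m where m: "m \<in> mv_states N" "\<And>t. t \<in> mv_states N \<Longrightarrow> \<phi> t \<le> \<phi> m"
    using continuous_attains_sup[OF compact_states _ cont] s by blast
  define F where "F = {t \<in> mv_states N. \<phi> t = \<phi> m}"
  have F: "F face_of mv_states N"
    unfolding F_def using m by (intro face_of_maximum convex_states lin)
  have "closed {t. \<phi> t = \<phi> m}" by (intro closed_Collect_eq cont continuous_on_const)
  moreover have "F = mv_states N \<inter> {t. \<phi> t = \<phi> m}" by (auto simp: F_def)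
  ultimately have "compact F" using compact_states by (simp add: compact_Int_closed)
  moreover have "F \<noteq> {}" using m by (auto simp: F_def)
  ultimately obtain h where "h extreme_point_of F"
    using compact_convex_has_extreme_point face_of_imp_convex[OF F] by blast
  then have "h \<in> F" "{h} face_of F" by (simp_all add: face_of_singleton extreme_point_of_def)
  moreover from this have "h extreme_point_of mv_states N"
    using face_of_trans F by (auto simp flip: face_of_singleton)
  ultimately have "\<phi> h = \<phi> m" "h \<in> mv_state_morphisms N"
    using extreme_state_morphism by (auto simp: F_def)
  moreover from this(2) have "\<phi> h \<le> b" unfolding \<phi>_def by (rule b)
  ultimately show ?thesis using m(2)[OF s] by (simp add: \<phi>_def)
qed

text \<open>Normalising \<open>F\<close> rescales any bound, and 0 is the one that survives; a
  functional with value 0 at the unit is zero anyway.\<close>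

lemma functional_dominated:
  assumes F: "F \<in> mv_functionals N"
    and b: "\<And>h. h \<in> mv_state_morphisms N \<Longrightarrow> (\<Sum>(c, x)\<leftarrow>xs. c * h x) \<le> 0"
  shows "(\<Sum>(c, x)\<leftarrow>xs. c * F x) \<le> 0"
proof (cases "F \<one> = 0")
  case True
  then have "F = 0" using functional_eq_zero F by blast
  then show ?thesis by (induction xs) auto
next
  case False
  then have pos: "0 < F \<one>" using functional_nonneg[OF F, of \<one>] by simp
  define s where "s = (1 / F \<one>) *\<^sub>R F"
  have "(\<Sum>(c, x)\<leftarrow>xs. c * s x) \<le> 0"
    unfolding s_def by (rule state_dominated[OF scaled_functional_state[OF F pos] b])
  moreover have "F = F \<one> *\<^sub>R s" using False by (simp add: s_def)
  then have "(\<Sum>(c, x)\<leftarrow>xs. c * F x) = F \<one> * (\<Sum>(c, x)\<leftarrow>xs. c * s x)"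
    using linear_scale[OF linear_combination_coordinates[of xs], of "F \<one>" s] by simp
  ultimately show ?thesis using pos by (simp add: mult_le_0_iff)
qed

sublocale spectrum: separating_clan "mv_state_morphisms N" carr evaluation
proof
  fix x t assume "x \<in> carr" "t \<in> mv_state_morphisms N"
  then show "0 \<le> evaluation x t \<and> evaluation x t \<le> 1"
    by (auto simp: mv_state_morphisms_def unit_maps_def evaluation_def)
next
  show "carr \<noteq> {}" using one_closed by blast
next
  fix x assume "x \<in> carr"
  then show "\<exists>u\<in>carr. \<forall>t\<in>mv_state_morphisms N. evaluation u t = 1 - evaluation x t"
    by (intro bexI[of _ "\<sim>x"]) (auto simp: mv_state_morphisms_def evaluation_def)
next
  fix x y assume "x \<in> carr" "y \<in> carr"
  then show "\<exists>u\<in>carr. \<forall>t\<in>mv_state_morphisms N. evaluation u t = min 1 (evaluation x t + evaluation y t)"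
    by (intro bexI[of _ "x \<oplus> y"]) (auto simp: mv_state_morphisms_def evaluation_def min.commute)
next
  show "compact (mv_state_morphisms N)" by (rule compact_state_morphisms)
next
  fix x show "continuous_on (mv_state_morphisms N) (evaluation x)"
    unfolding evaluation_def by (rule continuous_on_coordinate)
next
  fix s t assume st: "s \<in> mv_state_morphisms N" "t \<in> mv_state_morphisms N" "s \<noteq> t"
  then obtain x where "s x \<noteq> t x" by (auto simp: fun_eq_iff)
  moreover from this have "x \<in> carr" using st by (auto simp: mv_state_morphisms_def unit_maps_def)
  ultimately show "\<exists>x\<in>carr. evaluation x s \<noteq> evaluation x t" by (auto simp: evaluation_def)
qed

lemma state_clan_functional:
  assumes s: "s \<in> mv_states N"
  shows "clan_functional (mv_state_morphisms N) carr evaluation s"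
  using state_dominated[OF s] by unfold_locales (auto simp: evaluation_def)

text \<open>If \<open>s x\<close> exceeded \<open>h x\<close>, a truncation \<open>v\<close> of
  \<open>n x - k\<close> would vanish at \<open>h\<close>, hence at \<open>s\<close> by the kernel
  hypothesis. Domination bounds \<open>n x - n v\<close> by \<open>k\<close>, and this contradicts
  the size of \<open>s x\<close>.\<close>

lemma state_le_morphism:
  assumes h: "h \<in> mv_state_morphisms N" and s: "s \<in> mv_states N"
    and ker: "\<And>v. v \<in> carr \<Longrightarrow> h v = 0 \<Longrightarrow> s v = 0" and x: "x \<in> carr"
  shows "s x \<le> h x"
proof (rule ccontr)
  assume "\<not> s x \<le> h x"
  then obtain n :: nat where n: "1 < real n * (s x - h x)" using reals_Archimedean3[of "s x - h x"] by auto
  \<comment> \<open>The least integer that makes the truncation vanish at \<open>h\<close>; the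
    choice of \<open>n\<close> leaves room for it below \<open>real n * s x\<close>.\<close>
  define k where "k = \<lceil>real n * h x\<rceil>"
  have k: "real n * h x \<le> of_int k" "of_int k < real n * s x"
    using n by (auto simp: k_def algebra_simps) linarith
  obtain v where v: "v \<in> carr" "\<forall>t\<in>mv_state_morphisms N. t v = clamp (real n * t x - of_int k)"
    using spectrum.clan_clamp[OF x, of n k] by (auto simp: evaluation_def)
  have "s v = 0" using v h k by (intro ker) auto
  \<comment> \<open>The weight \<open>n\<close> on \<open>v\<close> makes up for the truncation:
    \<open>n x - k\<close> never exceeds \<open>n\<close>, so it stays below \<open>n v\<close> also
    where it is larger than 1 and \<open>v\<close> is only 1.\<close>
  moreover have "(\<Sum>(c, x)\<leftarrow>[(real n, x), (- real n, v)]. c * s x) \<le> of_int k"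
  proof (rule state_dominated[OF s])
    fix t assume t: "t \<in> mv_state_morphisms N"
    define r where "r = real n * t x - of_int k"
    have "0 \<le> h x" "t x \<le> 1" using h t x by (auto simp: mv_state_morphisms_def unit_maps_def)
    then have "0 \<le> real n * h x" "real n * t x \<le> real n"
      using mult_left_mono[of "t x" 1 "real n"] by auto
    then have "0 \<le> k" unfolding k_def by linarith
    then have "r \<le> real n" using \<open>real n * t x \<le> real n\<close> by (simp add: r_def)
    have "0 < n" using n by (cases n) auto
    then have "clamp r \<le> real n * clamp r" using mult_right_mono[of 1 "real n" "clamp r"] by simp
    then have "r \<le> real n * clamp r"
      using \<open>r \<le> real n\<close> by (cases "r \<le> 1") auto
    then show "(\<Sum>(c, x)\<leftarrow>[(real n, x), (- real n, v)]. c * t x) \<le> of_int k"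
      using v t by (simp add: r_def)
  qed
  ultimately show False using k by simp
qed

text \<open>Values are nonnegative, so the endpoints of a segment through \<open>h\<close> vanish
  wherever \<open>h\<close> does. Such a state lies below \<open>h\<close> at \<open>x\<close> and
  at \<open>\<sim>x\<close>, hence equals \<open>h\<close>.\<close>

lemma morphism_extreme:
  assumes h: "h \<in> mv_state_morphisms N"
  shows "h extreme_point_of mv_states N"
  unfolding extreme_point_of_def
proof (intro conjI ballI notI)
  show "h \<in> mv_states N" by (rule morphism_state[OF h])
  have eq: "s = h" if s: "s \<in> mv_states N" and ker: "\<And>v. v \<in> carr \<Longrightarrow> h v = 0 \<Longrightarrow> s v = 0" for s
  proof
    fix x show "s x = h x"
    proof (cases "x \<in> carr")
      case True
      have "s x \<le> h x" "s (\<sim>x) \<le> h (\<sim>x)"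
        using state_le_morphism[OF h s ker] True by auto
      moreover have "h (\<sim>x) = 1 - h x" "s (\<sim>x) = 1 - s x"
        using h s True functional_neg[of s x] by (auto simp: mv_state_morphisms_def states_eq)
      ultimately show ?thesis by simp
    next
      case False
      then show ?thesis using s h by (auto simp: mv_states_def mv_state_morphisms_def unit_maps_def)
    qed
  qed
  fix a b assume ab: "a \<in> mv_states N" "b \<in> mv_states N" and "h \<in> open_segment a b"
  then obtain u where u: "a \<noteq> b" "0 < u" "u < 1" "h = (1 - u) *\<^sub>R a + u *\<^sub>R b" by (auto simp: in_segment)
  have "a v = 0" "b v = 0" if "v \<in> carr" "h v = 0" for v
  proof -
    have "0 \<le> a v" "0 \<le> b v" using ab that by (auto simp: mv_states_def unit_maps_def)
    moreover have "(1 - u) * a v + u * b v = 0" using u(4) that by (simp add: scaleR_fun_def)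
    ultimately show "a v = 0" "b v = 0"
      using u add_nonneg_eq_0_iff[of "(1 - u) * a v" "u * b v"] by auto
  qed
  then show False using eq[OF ab(1)] eq[OF ab(2)] u(1) by simp
qed

lemma extreme_state_iff: "h extreme_point_of mv_states N \<longleftrightarrow> h \<in> mv_state_morphisms N"
  using extreme_state_morphism morphism_extreme by blast

section \<open>The positive functionals as a lattice cone\<close>

lemma functional_pointwise_mono:
  assumes "F \<in> mv_functionals N" "x \<in> carr" "y \<in> carr"
    and "\<And>h. h \<in> mv_state_morphisms N \<Longrightarrow> h x \<le> h y"
  shows "F x \<le> F y"
  using functional_dominated[OF assms(1), of "[(1, x), (-1, y)]"] assms by simp

text \<open>Here \<open>x \<odot> y\<close> may be a non-zero infinitesimal that every morphism
  kills, so the defining additivity of \<open>F\<close> does not apply directly; domination in both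
  directions does.\<close>

lemma functional_pointwise_add:
  assumes F: "F \<in> mv_functionals N" and A: "x \<in> carr" "y \<in> carr" "z \<in> carr"
    and h: "\<And>h. h \<in> mv_state_morphisms N \<Longrightarrow> h z = h x + h y"
  shows "F z = F x + F y"
proof -
  have "(\<Sum>(c, x)\<leftarrow>[(1, z), (-1, x), (-1, y)]. c * F x) \<le> 0"
    by (rule functional_dominated[OF F]) (simp add: h)
  moreover have "(\<Sum>(c, x)\<leftarrow>[(-1, z), (1, x), (1, y)]. c * F x) \<le> 0"
    by (rule functional_dominated[OF F]) (simp add: h)
  ultimately show ?thesis by simp
qed

lemma functional_sup_exists:
  assumes F: "F \<in> mv_functionals N" and G: "G \<in> mv_functionals N"
  shows "\<exists>H\<in>mv_functionals N. (\<forall>x\<in>carr. F x \<le> H x \<and> G x \<le> H x)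
    \<and> (\<forall>K\<in>mv_functionals N. (\<forall>x\<in>carr. F x \<le> K x \<and> G x \<le> K x) \<longrightarrow> (\<forall>x\<in>carr. H x \<le> K x))"
proof -
  \<comment> \<open>Comparison at the morphisms instead of by \<open>\<preceq>\<close> turns the
    Riesz decomposition into arithmetic of real numbers.\<close>
  define below where "below x = {y \<in> carr. \<forall>h\<in>mv_state_morphisms N. h y \<le> h x}" for x
  define V where "V x = (\<lambda>y. F y + (G x - G y)) ` below x" for x
  \<comment> \<open>the Riesz formula for the supremum\<close>
  define H where "H x = (if x \<in> carr then Sup (V x) else 0)" for x
  have mono: "F' y \<le> F' x" if "F' \<in> mv_functionals N" "x \<in> carr" "y \<in> below x" for F' x y
    using functional_pointwise_mono[OF that(1), of y x] that(2,3) by (simp add: below_def)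
  have self: "x \<in> below x" "\<zero> \<in> below x" if "x \<in> carr" for x
    using that by (auto simp: below_def mv_state_morphisms_def unit_maps_def)
  have bdd: "bdd_above (V x)" if "x \<in> carr" for x
    using mono[OF F that] mono[OF G that] functional_nonneg[OF G] that
    by (intro bdd_aboveI[of _ "F x + G x"]) (auto simp: V_def add_mono diff_le_eq add_increasing2)
  have H_ge: "F y + (G x - G y) \<le> H x" if "x \<in> carr" "y \<in> below x" for x y
    using that bdd[OF that(1)] by (auto simp: H_def V_def intro!: cSup_upper)
  have H_le: "H x \<le> c" if "x \<in> carr" "\<And>y. y \<in> below x \<Longrightarrow> F y + (G x - G y) \<le> c" for x c
    using that self(1)[OF that(1)] by (auto simp: H_def V_def intro!: cSup_least)
  have FG_le: "F x \<le> H x" "G x \<le> H x" if "x \<in> carr" for x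
    using H_ge[OF that self(1)[OF that]] H_ge[OF that self(2)[OF that]] functional_zero[OF F] functional_zero[OF G] by auto
  have add: "H (x1 \<oplus> x2) = H x1 + H x2" if x: "x1 \<in> carr" "x2 \<in> carr" "x1 \<odot> x2 = \<zero>" for x1 x2
  proof (rule antisym)
    have hx: "h (x1 \<oplus> x2) = h x1 + h x2" if "h \<in> mv_state_morphisms N" for h
      using morphism_state[OF that] x by (auto simp: mv_states_def)
    have Gx: "G (x1 \<oplus> x2) = G x1 + G x2" using functional_add[OF G x] .
    show "H (x1 \<oplus> x2) \<le> H x1 + H x2"
    proof (rule H_le)
      fix y assume y: "y \<in> below (x1 \<oplus> x2)"
      \<comment> \<open>Riesz decomposition of \<open>y\<close>: the part under \<open>x1\<close>,
        and a remainder that must lie under \<open>x2\<close>.\<close>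
      obtain y1 where y1: "y1 \<in> carr" "\<forall>h\<in>mv_state_morphisms N. h y1 = min (h y) (h x1)"
        using spectrum.clan_min[of y x1] x y by (auto simp: below_def evaluation_def)
      obtain y2 where y2: "y2 \<in> carr" "\<forall>h\<in>mv_state_morphisms N. h y2 = max 0 (h y - h x1)"
        using spectrum.clan_diff[of y x1] x y by (auto simp: below_def evaluation_def)
      have b: "y1 \<in> below x1" "y2 \<in> below x2"
      proof -
        show "y1 \<in> below x1" using y1 by (auto simp: below_def)
        have "h y2 \<le> h x2" if h: "h \<in> mv_state_morphisms N" for h
        proof -
          have "0 \<le> h x2" using h x by (auto simp: mv_state_morphisms_def unit_maps_def)
          moreover have "h y \<le> h (x1 \<oplus> x2)" using y h by (simp add: below_def)
          moreover have "h y2 = max 0 (h y - h x1)" using y2(2) h by blast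
          ultimately show ?thesis using hx[OF h] by simp
        qed
        then show "y2 \<in> below x2" using y2(1) by (simp add: below_def)
      qed
      have "h y = h y1 + h y2" if "h \<in> mv_state_morphisms N" for h
        using y1(2)[rule_format, OF that] y2(2)[rule_format, OF that] by simp
      then have "F y = F y1 + F y2" "G y = G y1 + G y2"
        using functional_pointwise_add[OF F y1(1) y2(1), of y]
          functional_pointwise_add[OF G y1(1) y2(1), of y] y by (auto simp: below_def)
      then show "F y + (G (x1 \<oplus> x2) - G y) \<le> H x1 + H x2"
        using H_ge[OF x(1) b(1)] H_ge[OF x(2) b(2)] Gx by simp
    qed (use x in auto)
    have *: "F y1 + (G x1 - G y1) + (F y2 + (G x2 - G y2)) \<le> H (x1 \<oplus> x2)"
      if y: "y1 \<in> below x1" "y2 \<in> below x2" for y1 y2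
    proof -
      have yc: "y1 \<in> carr" "y2 \<in> carr" using y by (auto simp: below_def)
      \<comment> \<open>No truncation occurs, because the values at \<open>x1\<close> and
        \<open>x2\<close> already add up to at most 1.\<close>
      have hy: "h (y1 \<oplus> y2) = h y1 + h y2" if h: "h \<in> mv_state_morphisms N" for h
      proof -
        have "h (x1 \<oplus> x2) \<le> 1" using h x by (auto simp: mv_state_morphisms_def unit_maps_def)
        moreover have "h y1 \<le> h x1" "h y2 \<le> h x2" using y h by (auto simp: below_def)
        ultimately have "h y1 + h y2 \<le> 1" using hx[OF h] by simp
        then show ?thesis using h yc by (auto simp: mv_state_morphisms_def)
      qed
      have "h (y1 \<oplus> y2) \<le> h (x1 \<oplus> x2)" if h: "h \<in> mv_state_morphisms N" for h
      proof -
        have "h y1 \<le> h x1" "h y2 \<le> h x2" using y h by (auto simp: below_def)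
        then show ?thesis using hy[OF h] hx[OF h] by simp
      qed
      then have "y1 \<oplus> y2 \<in> below (x1 \<oplus> x2)" using yc by (simp add: below_def)
      moreover have "F (y1 \<oplus> y2) = F y1 + F y2" "G (y1 \<oplus> y2) = G y1 + G y2"
        using functional_pointwise_add[OF F] functional_pointwise_add[OF G] yc hy by auto
      ultimately show ?thesis using H_ge[of "x1 \<oplus> x2" "y1 \<oplus> y2"] x Gx by simp
    qed
    have "H x1 \<le> H (x1 \<oplus> x2) - H x2"
    proof (rule H_le[OF x(1)])
      fix y1 assume y1: "y1 \<in> below x1"
      have "H x2 \<le> H (x1 \<oplus> x2) - (F y1 + (G x1 - G y1))"
        by (rule H_le[OF x(2)]) (use *[OF y1] in \<open>simp add: algebra_simps\<close>)
      then show "F y1 + (G x1 - G y1) \<le> H (x1 \<oplus> x2) - H x2" by simp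
    qed
    then show "H x1 + H x2 \<le> H (x1 \<oplus> x2)" by simp
  qed
  have "H \<in> mv_functionals N"
  proof -
    have "0 \<le> H x" if "x \<in> carr" for x
      using FG_le(1)[OF that] functional_nonneg[OF F, of x] by simp
    moreover have "H x = 0" if "x \<notin> carr" for x using that by (simp add: H_def)
    ultimately show ?thesis using add by (simp add: mv_functionals_def)
  qed
  moreover have "H x \<le> K x" if K: "K \<in> mv_functionals N" "\<forall>x\<in>carr. F x \<le> K x \<and> G x \<le> K x"
    and x: "x \<in> carr" for K x
  proof (rule H_le[OF x])
    fix y assume y: "y \<in> below x"
    \<comment> \<open>The difference of \<open>x\<close> and \<open>y\<close>: \<open>K\<close>
      dominates \<open>F\<close> at \<open>y\<close> and \<open>G\<close> at the difference, and its
      two values add up to \<open>K x\<close>.\<close>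
    obtain z where z: "z \<in> carr" "\<forall>h\<in>mv_state_morphisms N. h z = max 0 (h x - h y)"
      using spectrum.clan_diff[of x y] x y by (auto simp: below_def evaluation_def)
    have "y \<in> carr" using y by (simp add: below_def)
    have "h x = h y + h z" if "h \<in> mv_state_morphisms N" for h
      using z(2)[rule_format, OF that] y that by (simp add: below_def)
    then have *: "F' x = F' y + F' z" if "F' \<in> mv_functionals N" for F'
      using functional_pointwise_add[OF that \<open>y \<in> carr\<close> z(1) x] by simp
    have "F y \<le> K y" "G z \<le> K z" using K(2) z(1) \<open>y \<in> carr\<close> by auto
    then show "F y + (G x - G y) \<le> K x" using *[OF G] *[OF K(1)] by simp
  qed
  ultimately show ?thesis using FG_le by blast
qed

lemma convex_cone_functionals: "convex_cone (mv_functionals N)"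
  unfolding convex_cone_iff by (auto simp: mv_functionals_def scaleR_fun_def distrib_left)

lemma cone_le_functionals_iff:
  assumes "F \<in> mv_functionals N" "G \<in> mv_functionals N"
  shows "G - F \<in> mv_functionals N \<longleftrightarrow> (\<forall>x\<in>carr. F x \<le> G x)"
  using dominated_diff_functional[OF assms(2,1)] functional_nonneg[of "G - F"] by auto

text \<open>\<open>simplex_set\<close> asks for a cone in the ambient type with a real coordinate
  added. The functionals already form a cone with the states as a base, so the extra coordinate is
  kept at 0.\<close>

lemma lattice_cone_functionals: "lattice_cone (mv_functionals N \<times> {0 :: real})"
proof -
  let ?C = "mv_functionals N"
  let ?D = "mv_functionals N \<times> {0 :: real}"
  have cc: "convex_cone ?D"
    using convex_cone_functionals unfolding convex_cone_iff by (auto simp: zero_prod_def)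
  have zero: "0 \<in> ?C" and plus: "\<And>F G. F \<in> ?C \<Longrightarrow> G \<in> ?C \<Longrightarrow> F + G \<in> ?C"
    using convex_cone_functionals unfolding convex_cone_iff by auto
  have "F = 0" if "F \<in> ?C" "- F \<in> ?C" for F
    using functional_nonneg[OF that(1)] functional_nonneg[OF that(2)] by (auto simp: fun_eq_iff intro: antisym)
  then have pointed: "?D \<inter> uminus ` ?D = {0}"
    using zero by (auto simp: zero_prod_def image_iff)
  have lat: "(\<exists>H\<in>?C. H - F \<in> ?C \<and> H - G \<in> ?C \<and> (\<forall>K\<in>?C. K - F \<in> ?C \<and> K - G \<in> ?C \<longrightarrow> K - H \<in> ?C))
    \<and> (\<exists>L\<in>?C. F - L \<in> ?C \<and> G - L \<in> ?C \<and> (\<forall>K\<in>?C. F - K \<in> ?C \<and> G - K \<in> ?C \<longrightarrow> L - K \<in> ?C))"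
    if F: "F \<in> ?C" and G: "G \<in> ?C" for F G
  proof -
    obtain H where H: "H \<in> ?C" "\<forall>x\<in>carr. F x \<le> H x \<and> G x \<le> H x"
      "\<And>K. K \<in> ?C \<Longrightarrow> \<forall>x\<in>carr. F x \<le> K x \<and> G x \<le> K x \<Longrightarrow> \<forall>x\<in>carr. H x \<le> K x"
      using functional_sup_exists[OF F G] by blast
    have HF: "H - F \<in> ?C" "H - G \<in> ?C" using H F G by (auto simp: cone_le_functionals_iff)
    have least: "K - H \<in> ?C" if "K \<in> ?C" "K - F \<in> ?C" "K - G \<in> ?C" for K
      using that H F G by (auto simp: cone_le_functionals_iff)
    \<comment> \<open>Subtraction from \<open>F + G\<close> reverses the order and exchanges
      \<open>F\<close> with \<open>G\<close>, so it carries the supremum to the infimum. It stays in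
      the cone because \<open>F + G\<close> is an upper bound.\<close>
    define L where "L = F + G - H"
    have L: "L \<in> ?C" unfolding L_def using F G by (intro least) (auto intro: plus)
    have "F - L = H - G" "G - L = H - F" by (auto simp: L_def)
    moreover have "L - K \<in> ?C" if K: "K \<in> ?C" "F - K \<in> ?C" "G - K \<in> ?C" for K
    proof -
      have eq: "F + G - K - F = G - K" "F + G - K - G = F - K" "F + (G - K) = F + G - K" by auto
      have "F + G - K \<in> ?C" using plus[OF F K(3)] by (simp add: eq(3))
      then have "F + G - K - H \<in> ?C" using K by (intro least) (simp_all add: eq)
      moreover have "F + G - K - H = L - K" by (simp add: L_def)
      ultimately show ?thesis by simp
    qed
    ultimately show ?thesis using H(1) HF least L by metis
  qed
  show ?thesis
    unfolding lattice_cone_def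
  proof (intro conjI ballI)
    fix p q assume "p \<in> ?D" "q \<in> ?D"
    then obtain F G where FG: "F \<in> ?C" "G \<in> ?C" "p = (F, 0)" "q = (G, 0)" by auto
    from lat[OF FG(1,2)] obtain H L where
      H: "H \<in> ?C" "H - F \<in> ?C" "H - G \<in> ?C" "\<forall>K\<in>?C. K - F \<in> ?C \<and> K - G \<in> ?C \<longrightarrow> K - H \<in> ?C"
      and L: "L \<in> ?C" "F - L \<in> ?C" "G - L \<in> ?C" "\<forall>K\<in>?C. F - K \<in> ?C \<and> G - K \<in> ?C \<longrightarrow> L - K \<in> ?C"
      by (elim conjE bexE) (rule that)
    show "\<exists>u\<in>?D. cone_le ?D p u \<and> cone_le ?D q u
        \<and> (\<forall>w\<in>?D. cone_le ?D p w \<and> cone_le ?D q w \<longrightarrow> cone_le ?D u w)"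
      using H FG by (intro bexI[of _ "(H, 0)"]) (auto simp: cone_le_def)
    show "\<exists>l\<in>?D. cone_le ?D l p \<and> cone_le ?D l q
        \<and> (\<forall>w\<in>?D. cone_le ?D w p \<and> cone_le ?D w q \<longrightarrow> cone_le ?D w l)"
      using L FG by (intro bexI[of _ "(L, 0)"]) (auto simp: cone_le_def)
  qed (rule cc pointed)+
qed

text \<open>The value at the unit recovers the scalar, hence uniqueness; it is positive because a
  functional that vanishes at the unit is zero.\<close>

lemma cone_base_states: "cone_base (mv_functionals N \<times> {0 :: real}) (mv_states N \<times> {0})"
  unfolding cone_base_def
proof (intro conjI ballI impI)
  show "mv_states N \<times> {0 :: real} \<subseteq> mv_functionals N \<times> {0}" by (auto simp: states_eq)
  show "convex (mv_states N \<times> {0 :: real})" by (intro convex_Times convex_states) auto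
  fix y :: "('a \<Rightarrow> real) \<times> real" assume y: "y \<in> mv_functionals N \<times> {0}" "y \<noteq> 0"
  then obtain F where F: "F \<in> mv_functionals N" "y = (F, 0)" "F \<noteq> 0" by (auto simp: zero_prod_def)
  then have pos: "0 < F \<one>" using functional_eq_zero functional_nonneg[of F \<one>] by fastforce
  show "\<exists>!p. fst p > (0::real) \<and> snd p \<in> mv_states N \<times> {0 :: real} \<and> y = fst p *\<^sub>R snd p"
  proof (rule ex1I[of _ "(F \<one>, (1 / F \<one>) *\<^sub>R F, 0)"])
    show "fst (F \<one>, (1 / F \<one>) *\<^sub>R F, 0) > (0::real) \<and> snd (F \<one>, (1 / F \<one>) *\<^sub>R F, 0) \<in> mv_states N \<times> {0 :: real}
      \<and> y = fst (F \<one>, (1 / F \<one>) *\<^sub>R F, 0) *\<^sub>R snd (F \<one>, (1 / F \<one>) *\<^sub>R F, 0)"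
      using pos scaled_functional_state[OF F(1) pos] F(2) by simp
    fix p assume p: "fst p > (0::real) \<and> snd p \<in> mv_states N \<times> {0 :: real} \<and> y = fst p *\<^sub>R snd p"
    obtain c s r where p': "p = (c, s, r)" by (cases p) auto
    then have "c > 0" "s \<in> mv_states N" "r = 0" "F = c *\<^sub>R s" using p F(2) by auto
    moreover from this have "F \<one> = c" by (simp add: scaleR_fun_def mv_states_def)
    ultimately show "p = (F \<one>, (1 / F \<one>) *\<^sub>R F, 0)" using p' by simp
  qed
qed

end

section \<open>Pre-states on EMV-algebras\<close>

lemma affine_iso_extreme_point:
  assumes f: "affine_iso K B f" and K: "convex K" and x: "x \<in> K"
  shows "x extreme_point_of K \<longleftrightarrow> f x extreme_point_of B"
proof -
  have bij: "f ` K = B" "inj_on f K"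
    and aff: "\<And>a b u. a \<in> K \<Longrightarrow> b \<in> K \<Longrightarrow> 0 \<le> u \<Longrightarrow> u \<le> 1
      \<Longrightarrow> f ((1 - u) *\<^sub>R a + u *\<^sub>R b) = (1 - u) *\<^sub>R f a + u *\<^sub>R f b"
    using f by (auto simp: affine_iso_def bij_betw_def)
  have "x \<in> open_segment a b \<longleftrightarrow> f x \<in> open_segment (f a) (f b)" if ab: "a \<in> K" "b \<in> K" for a b
  proof -
    have ne: "a \<noteq> b \<longleftrightarrow> f a \<noteq> f b" using bij(2) ab by (auto simp: inj_on_def)
    have eq: "x = (1 - u) *\<^sub>R a + u *\<^sub>R b \<longleftrightarrow> f x = (1 - u) *\<^sub>R f a + u *\<^sub>R f b"
      if u: "0 < u" "u < 1" for u
    proof -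
      have "(1 - u) *\<^sub>R a + u *\<^sub>R b \<in> K" using K ab u by (intro convexD) auto
      then have "x = (1 - u) *\<^sub>R a + u *\<^sub>R b \<longleftrightarrow> f x = f ((1 - u) *\<^sub>R a + u *\<^sub>R b)"
        using inj_on_eq_iff[OF bij(2) x] by blast
      then show ?thesis using aff[OF ab, of u] u by simp
    qed
    show ?thesis unfolding in_segment using ne eq by auto
  qed
  then show ?thesis using x bij(1) unfolding extreme_point_of_def by auto
qed

text \<open>Idempotence makes \<open>a\<close> and \<open>\<sim>a\<close> orthogonal, which by
  residuation makes \<open>\<sim>a\<close> idempotent too; De Morgan does the rest.\<close>

lemma (in mv_algebra) idem_odot:
  assumes a: "a \<in> carr" "a \<oplus> a = a" shows "a \<odot> a = a"
proof -
  have "\<sim>a \<sqinter>\<^sub>N a = \<sim>a \<odot> (a \<oplus> a)" using a(1) by (simp add: mv_meet_def)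
  then have "a \<sqinter>\<^sub>N \<sim>a = \<zero>" using a odot_comm[of "\<sim>a" a] meet_comm[of a "\<sim>a"] by simp
  then have "a \<odot> (\<sim>a \<oplus> \<sim>a) = \<zero>" by (simp add: mv_meet_def)
  then have "\<sim>a \<oplus> \<sim>a \<preceq> \<sim>a" using residuation[of a "\<sim>a \<oplus> \<sim>a" \<zero>] a by simp
  then have "\<sim>a \<oplus> \<sim>a = \<sim>a" using a by (intro le_antisym) auto
  then show ?thesis using a by (simp add: mv_odot_def)
qed

text \<open>An element \<open>x\<close> below \<open>a\<close> has the form
  \<open>a \<odot> (\<sim>a \<oplus> x)\<close>, and \<open>a \<odot> a = a\<close> merges the two
  factors \<open>a\<close>. The left side is the product formed in the interval below
  \<open>a\<close>, which is thus independent of \<open>a\<close>.\<close>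

lemma (in mv_algebra) odot_below_idem:
  assumes a: "a \<in> carr" "a \<oplus> a = a" and x: "x \<in> carr" "x \<preceq> a" and y: "y \<in> carr" "y \<preceq> a"
  shows "a \<odot> \<sim>(a \<odot> \<sim>x \<oplus> a \<odot> \<sim>y) = x \<odot> y"
proof -
  have "x \<odot> y = (a \<odot> (\<sim>a \<oplus> x)) \<odot> (a \<odot> (\<sim>a \<oplus> y))"
    using a x y meet_comm[of a x] meet_comm[of a y] by (simp add: mv_le_def mv_meet_def)
  also have "\<dots> = a \<odot> a \<odot> ((\<sim>a \<oplus> x) \<odot> (\<sim>a \<oplus> y))"
    using a x y odot_lcomm[of "\<sim>a \<oplus> x" a "\<sim>a \<oplus> y"] by (simp add: odot_assoc)
  finally show ?thesis using a x y idem_odot[OF a] by (simp add: neg_plus_distrib neg_odot)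
qed

section \<open>An EMV-algebra inside its representing MV-algebra\<close>

locale represented_emv = mv_algebra N + emv: emv_algebra M for N :: "'a mv" and M :: "'a emv" +
  assumes rep: "mv_represents N M"
begin

abbreviation E where "E \<equiv> emv_carrier M"

lemma ideal: "mv_ideal N E" and proper: "E \<noteq> carr"
  using rep by (auto simp: mv_represents_def mv_maximal_ideal_def)

lemma E_carr [simp, intro]: "x \<in> E \<Longrightarrow> x \<in> carr"
  using ideal by (auto simp: mv_ideal_def)

lemma E_plus [simp, intro]: "x \<in> E \<Longrightarrow> y \<in> E \<Longrightarrow> x \<oplus> y \<in> E"
  using ideal unfolding mv_ideal_def by blast

lemma E_down: "x \<in> E \<Longrightarrow> y \<in> carr \<Longrightarrow> y \<preceq> x \<Longrightarrow> y \<in> E"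
  using ideal unfolding mv_ideal_def by blast

lemma E_odot [simp, intro]: "x \<in> E \<Longrightarrow> y \<in> carr \<Longrightarrow> x \<odot> y \<in> E"
  by (rule E_down[of x]) auto

lemma E_zero [simp, intro]: "\<zero> \<in> E"
  using emv.zero_closed E_down[of "emv_zero M" \<zero>] by auto

lemma restricted_ops:
  assumes "x \<in> E" "y \<in> E"
  shows "emv_join M x y = mv_join N x y" "emv_meet M x y = x \<sqinter>\<^sub>N y" "emv_plus M x y = x \<oplus> y"
  using rep assms by (auto simp: mv_represents_def)

lemma emv_zero_eq: "emv_zero M = \<zero>"
proof -
  have "emv_plus M \<zero> (emv_zero M) = \<zero>" by (rule emv.plus_zero) simp
  then show ?thesis using restricted_ops(3)[of \<zero> "emv_zero M"] emv.zero_closed by simp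
qed

lemma emv_le_eq: "x \<in> E \<Longrightarrow> y \<in> E \<Longrightarrow> emv_le M x y \<longleftrightarrow> x \<preceq> y"
  by (simp add: emv_le_def mv_le_def restricted_ops)

lemma emv_idem_iff: "a \<in> emv_idem M \<longleftrightarrow> a \<in> E \<and> a \<oplus> a = a"
  by (auto simp: emv_idem_def restricted_ops)

lemma one_notin_E: "\<one> \<notin> E"
proof
  assume "\<one> \<in> E"
  then have "carr \<subseteq> E" using E_down[OF \<open>\<one> \<in> E\<close>] by auto
  then show False using proper by auto
qed

lemma neg_notin_E: assumes "x \<in> E" shows "\<sim>x \<notin> E"
proof
  assume "\<sim>x \<in> E"
  then have "x \<oplus> \<sim>x \<in> E" using assms by blast
  then show False using assms one_notin_E by simp
qed

lemma neg_in_E: assumes "x \<in> carr" "x \<notin> E" shows "\<sim>x \<in> E"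
proof -
  obtain x0 where "x0 \<in> E" "x = \<sim>x0" using rep assms by (auto simp: mv_represents_def)
  then show ?thesis by simp
qed

lemma emv_lam_eq: "a \<in> emv_idem M \<Longrightarrow> x \<in> E \<Longrightarrow> x \<preceq> a \<Longrightarrow> emv_lam M a x = a \<odot> \<sim>x"
  using rep emv_le_eq[of x a] by (auto simp: mv_represents_def emv_idem_iff)

lemma below_idem2:
  assumes "x \<in> E" "y \<in> E"
  obtains a where "a \<in> emv_idem M" "x \<preceq> a" "y \<preceq> a"
proof -
  obtain a where a: "a \<in> emv_idem M" "x \<oplus> y \<preceq> a"
  proof -
    have xy: "x \<oplus> y \<in> E" using assms by (rule E_plus)
    then obtain a where a: "a \<in> emv_idem M" "emv_le M (x \<oplus> y) a" using emv.below_idem by blast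
    then have "a \<in> E" by (simp add: emv_idem_iff)
    then show ?thesis using that a emv_le_eq[OF xy] by simp
  qed
  then have aE: "a \<in> E" by (simp add: emv_idem_iff)
  show ?thesis
    using assms a aE le_trans[of x "x \<oplus> y" a] le_trans[of y "x \<oplus> y" a] by (intro that[OF a(1)]) simp_all
qed

lemma emv_odot_eq:
  assumes a: "a \<in> emv_idem M" and x: "x \<in> E" "x \<preceq> a" and y: "y \<in> E" "y \<preceq> a"
  shows "emv_odot M a x y = x \<odot> y"
proof -
  have aE: "a \<in> E" "a \<oplus> a = a" using a by (auto simp: emv_idem_iff)
  have lam: "emv_lam M a x = a \<odot> \<sim>x" "emv_lam M a y = a \<odot> \<sim>y" using a x y by (simp_all add: emv_lam_eq)
  have "a \<odot> \<sim>x \<oplus> a \<odot> \<sim>y \<preceq> a \<oplus> a" using aE(1) x y by (intro plus_mono) auto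
  then have "emv_odot M a x y = a \<odot> \<sim>(a \<odot> \<sim>x \<oplus> a \<odot> \<sim>y)"
    using a aE x y by (simp add: emv_odot_def lam restricted_ops emv_lam_eq)
  then show ?thesis using odot_below_idem[of a x y] aE x y by auto
qed

text \<open>Some idempotent lies above both elements, and the product is the same for all of them,
  so the quantifier over idempotents collapses.\<close>

lemma emv_sum_defined_iff:
  assumes "x \<in> E" "y \<in> E" shows "emv_sum_defined M x y \<longleftrightarrow> x \<odot> y = \<zero>"
proof -
  obtain a where a: "a \<in> emv_idem M" "x \<preceq> a" "y \<preceq> a" using below_idem2 assms .
  then have "emv_le M x a" "emv_le M y a" using assms by (auto simp: emv_le_eq emv_idem_iff)
  then show ?thesis
    using a assms emv_odot_eq unfolding emv_sum_defined_def
    by (auto simp: emv_zero_eq emv_le_eq emv_idem_iff)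
qed

lemma pre_states_eq: "pre_states M = {s \<in> unit_maps E.
    \<forall>x\<in>E. \<forall>y\<in>E. x \<odot> y = \<zero> \<longrightarrow> s (x \<oplus> y) = s x + s y}"
  by (auto simp: pre_states_def emv_sum_defined_iff restricted_ops)

section \<open>Pre-states as restrictions of states\<close>

definition ext :: "('a \<Rightarrow> real) \<Rightarrow> 'a \<Rightarrow> real" where
  "ext s = (\<lambda>x. if x \<in> E then s x else if x \<in> carr then 1 - s (\<sim>x) else 0)"

definition res :: "('a \<Rightarrow> real) \<Rightarrow> 'a \<Rightarrow> real" where
  "res t = (\<lambda>x. if x \<in> E then t x else 0)"

lemma ext_E [simp]: "x \<in> E \<Longrightarrow> ext s x = s x"
  by (simp add: ext_def)

lemma ext_neg [simp]: "x \<in> E \<Longrightarrow> ext s (\<sim>x) = 1 - s x"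
  by (simp add: ext_def neg_notin_E)

lemma res_ext: "s \<in> unit_maps E \<Longrightarrow> res (ext s) = s"
  by (auto simp: res_def unit_maps_def fun_eq_iff)

lemma ext_res: assumes t: "t \<in> mv_states N" shows "ext (res t) = t"
proof
  fix x
  have "t (\<sim>x) = 1 - t x" if "x \<in> carr"
    using functional_neg[of t x] that t by (auto simp: states_eq)
  then show "ext (res t) x = t x"
    using t neg_in_E[of x] by (auto simp: ext_def res_def mv_states_def unit_maps_def)
qed

lemma res_state: assumes t: "t \<in> mv_states N" shows "res t \<in> pre_states M"
  using t by (auto simp: pre_states_eq res_def mv_states_def unit_maps_def)

lemma ext_state: assumes s: "s \<in> pre_states M" shows "ext s \<in> mv_states N"
proof -
  have s01: "0 \<le> s x" "s x \<le> 1" if "x \<in> E" for x using s that by (auto simp: pre_states_def unit_maps_def)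
  have add: "s (x \<oplus> y) = s x + s y" if "x \<in> E" "y \<in> E" "x \<odot> y = \<zero>" for x y
    using s that by (simp add: pre_states_eq)
  have "s \<zero> = 0" using add[of \<zero> \<zero>] by simp
  have mixed: "ext s (x \<oplus> y) = ext s x + ext s y" if x: "x \<in> E" and y: "y \<in> carr" "y \<notin> E" and xy: "x \<odot> y = \<zero>" for x y
  proof -
    define y0 where "y0 = \<sim>y"
    have y0: "y0 \<in> E" "y = \<sim>y0" using neg_in_E y by (auto simp: y0_def)
    \<comment> \<open>Disjointness from \<open>\<sim>y0\<close> means lying below \<open>y0\<close>.
      The sum is then the complement of the remainder \<open>y0 \<odot> \<sim>x\<close>, which
      belongs to \<open>M\<close>.\<close>
    have le: "x \<preceq> y0" using residuation[of y x \<zero>] xy x y odot_comm[of x y] by (simp add: y0_def)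
    have "y0 = x \<oplus> (y0 \<odot> \<sim>x)" using le_sum[of x y0] le x y0 by simp
    moreover have "x \<odot> (y0 \<odot> \<sim>x) = \<zero>" using odot_lcomm[of x y0 "\<sim>x"] x y0 by simp
    ultimately have "s y0 = s x + s (y0 \<odot> \<sim>x)" using add[of x "y0 \<odot> \<sim>x"] x y0 by simp
    moreover have "x \<oplus> y = \<sim>(y0 \<odot> \<sim>x)" using x y0 plus_comm[of x y] by (simp add: neg_odot)
    ultimately show ?thesis using x y0 by simp
  qed
  have "ext s (x \<oplus> y) = ext s x + ext s y" if x: "x \<in> carr" and y: "y \<in> carr" and xy: "x \<odot> y = \<zero>" for x y
  proof -
    consider "x \<in> E" "y \<in> E" | "x \<in> E" "y \<notin> E" | "x \<notin> E" "y \<in> E" | "x \<notin> E" "y \<notin> E" by blast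
    then show ?thesis
    proof cases
      case 1
      then show ?thesis using add xy by simp
    next
      case 2
      then show ?thesis using mixed y xy by simp
    next
      case 3
      then show ?thesis using mixed[of y x] x y xy plus_comm[of x y] odot_comm[of x y] by simp
    next
      case 4
      \<comment> \<open>Two elements outside the ideal are never disjoint: the unit would be a sum
        of two elements of the ideal.\<close>
      have "\<sim>x \<oplus> \<sim>y = \<one>" using neg_odot[of x y] x y xy by simp
      moreover have "\<sim>x \<oplus> \<sim>y \<in> E" using 4 x y neg_in_E by blast
      ultimately show ?thesis using one_notin_E by simp
    qed
  qed
  moreover have "ext s \<one> = 1" using \<open>s \<zero> = 0\<close> ext_neg[of \<zero> s] by simp
  moreover have "0 \<le> ext s x \<and> ext s x \<le> 1" if "x \<in> carr" for x
    using s01[of x] s01[of "\<sim>x"] neg_in_E[OF that] that by (auto simp: ext_def)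
  ultimately show ?thesis by (auto simp: mv_states_def unit_maps_def ext_def)
qed

lemma pre_states_unit: "s \<in> pre_states M \<Longrightarrow> s \<in> unit_maps E"
  by (simp add: pre_states_def)

lemma bij_ext: "bij_betw ext (pre_states M) (mv_states N)"
  by (rule bij_betw_byWitness[where f' = res])
     (auto simp: res_ext pre_states_unit ext_res ext_state res_state)

lemma affine_ext: "ext ((1 - u) *\<^sub>R s + u *\<^sub>R t) = (1 - u) *\<^sub>R ext s + u *\<^sub>R ext t"
  by (auto simp: ext_def scaleR_fun_def fun_eq_iff algebra_simps)

lemma affine_iso_ext: "affine_iso (pre_states M) (mv_states N) ext"
  unfolding affine_iso_def using bij_ext affine_ext by auto

lemma convex_pre_states: "convex (pre_states M)"
proof (rule convexI)
  fix s t :: "'a \<Rightarrow> real" and u v :: real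
  assume st: "s \<in> pre_states M" "t \<in> pre_states M" and uv: "0 \<le> u" "0 \<le> v" "u + v = 1"
  have "u * s x + v * t x \<le> u * 1 + v * 1" if "x \<in> E" for x
    using st uv that by (intro add_mono mult_left_mono) (auto simp: pre_states_eq unit_maps_def)
  then show "u *\<^sub>R s + v *\<^sub>R t \<in> pre_states M"
    using st uv by (auto simp: pre_states_eq unit_maps_def scaleR_fun_def algebra_simps)
qed

lemma compact_pre_states: "compact (pre_states M)"
proof -
  have "pre_states M = unit_maps E \<inter> {s.
     \<forall>x. x \<in> E \<longrightarrow> (\<forall>y. y \<in> E \<longrightarrow> x \<odot> y = \<zero> \<longrightarrow> s (x \<oplus> y) = s x + s y)}"
    by (auto simp: pre_states_eq)
  moreover have "closed {s :: 'a \<Rightarrow> real.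
     \<forall>x. x \<in> E \<longrightarrow> (\<forall>y. y \<in> E \<longrightarrow> x \<odot> y = \<zero> \<longrightarrow> s (x \<oplus> y) = s x + s y)}"
    by (intro closed_coordinate_intros)
  ultimately show ?thesis using compact_Int_closed[OF compact_unit_maps] by simp
qed

text \<open>The zero map is a pre-state, and over a convex set that joins a point to 0 the scalars
  are not unique. The base is therefore the set of states of \<open>N\<close>, reached by
  \<open>ext\<close>.\<close>

lemma simplex_pre_states: "simplex_set (pre_states M)"
  unfolding simplex_set_def
proof (intro conjI exI)
  show "affine_iso (pre_states M) (mv_states N \<times> {0 :: real}) (\<lambda>s. (ext s, 0))"
    using affine_iso_ext by (auto simp: affine_iso_def bij_betw_def inj_on_def)
qed (rule convex_pre_states lattice_cone_functionals cone_base_states)+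

section \<open>State-morphisms of both algebras and the extreme pre-states\<close>

lemma morphism_idem: "h \<in> mv_state_morphisms N \<Longrightarrow> a \<in> emv_idem M \<Longrightarrow> h a = 0 \<or> h a = 1"
proof -
  assume h: "h \<in> mv_state_morphisms N" and a: "a \<in> emv_idem M"
  then have "a \<in> carr" "a \<oplus> a = a" by (auto simp: emv_idem_iff)
  then have "h a = min (h a + h a) 1" using h by (metis (mono_tags, lifting) mem_Collect_eq mv_state_morphisms_def)
  then show ?thesis by (auto simp: min_def split: if_splits)
qed

lemma res_morphism:
  assumes h: "h \<in> mv_state_morphisms N" shows "res h \<in> insert 0 (emv_state_morphisms M)"
proof (cases "\<forall>x\<in>E. h x = 0")
  case True
  then have "res h = 0" by (auto simp: res_def fun_eq_iff)
  then show ?thesis by simp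
next
  case False
  then obtain x where x: "x \<in> E" "h x \<noteq> 0" by blast
  \<comment> \<open>Morphisms take only the values 0 and 1 at idempotents, so an idempotent above an
    element of non-zero value supplies the value 1 that a state-morphism has to attain.\<close>
  obtain a where a: "a \<in> emv_idem M" "x \<preceq> a" using below_idem2[OF x(1) x(1)] .
  then have aE: "a \<in> E" by (simp add: emv_idem_iff)
  have hF: "h \<in> mv_functionals N" using morphism_state[OF h] by (simp add: states_eq)
  have "h x \<le> h a" using functional_mono[OF hF] x aE a by auto
  then have "h a = 1" using morphism_idem[OF h a(1)] x(2) functional_nonneg[OF hF, of x] by auto
  have plus: "h (x \<oplus> y) = min (h x + h y) 1" if "x \<in> E" "y \<in> E" for x y
    using h that by (auto simp: mv_state_morphisms_def)
  have lam: "h (b \<odot> \<sim>x) = h b - h x" if "b \<in> E" "x \<in> E" "x \<preceq> b" for b x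
  proof -
    have "h x \<le> h b" using functional_mono[OF hF] that by auto
    then show ?thesis using morphism_odot[OF h, of b "\<sim>x"] that h by (auto simp: mv_state_morphisms_def)
  qed
  have join: "mv_join N x y \<in> E" if "x \<in> E" "y \<in> E" for x y
    using emv.join_closed[OF that] restricted_ops(1)[OF that] by simp
  have meet: "x \<sqinter>\<^sub>N y \<in> E" if "x \<in> E" "y \<in> E" for x y
    using emv.meet_closed[OF that] restricted_ops(2)[OF that] by simp
  have "res h \<in> emv_state_morphisms M"
    unfolding emv_state_morphisms_def
  proof (intro CollectI conjI ballI impI)
    show "res h \<in> unit_maps E" using h by (auto simp: res_def unit_maps_def mv_state_morphisms_def)
    show "res h (emv_zero M) = 0" using functional_zero[OF hF] by (simp add: res_def emv_zero_eq)
    show "\<exists>x\<in>E. res h x = 1" using aE \<open>h a = 1\<close> by (auto simp: res_def)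
    show "res h (emv_join M x y) = max (res h x) (res h y)" if "x \<in> E" "y \<in> E" for x y
      using that join[OF that] by (simp add: res_def restricted_ops morphism_join[OF h])
    show "res h (emv_meet M x y) = min (res h x) (res h y)" if "x \<in> E" "y \<in> E" for x y
      using that meet[OF that] by (simp add: res_def restricted_ops morphism_meet[OF h])
    show "res h (emv_plus M x y) = min (res h x + res h y) 1" if "x \<in> E" "y \<in> E" for x y
      using that by (simp add: res_def restricted_ops plus)
    show "res h (emv_lam M b x) = res h b - res h x" if "b \<in> emv_idem M" "x \<in> E" "emv_le M x b" for b x
    proof -
      have "b \<in> E" using that by (simp add: emv_idem_iff)
      then have "x \<preceq> b" using that by (simp add: emv_le_eq)
      then show ?thesis using that \<open>b \<in> E\<close> by (simp add: res_def emv_lam_eq lam)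
    qed
  qed
  then show ?thesis by simp
qed

text \<open>A sum lies in the ideal only if both summands do, and complementation exchanges the
  ideal with the rest of \<open>N\<close>. So the map that is 0 on \<open>M\<close> and 1 on the
  rest is a homomorphism onto the two-element algebra.\<close>

lemma ext_zero_morphism: "ext 0 \<in> mv_state_morphisms N"
proof -
  have eq: "ext 0 x = (if x \<in> E then 0 else if x \<in> carr then 1 else 0)" for x by (simp add: ext_def)
  have "x \<oplus> y \<in> E \<longleftrightarrow> x \<in> E \<and> y \<in> E" if "x \<in> carr" "y \<in> carr" for x y
    using that E_down[of "x \<oplus> y" x] E_down[of "x \<oplus> y" y] by auto
  moreover have "\<sim>x \<in> E \<longleftrightarrow> x \<notin> E" if "x \<in> carr" for x
    using that neg_in_E neg_notin_E by blast
  ultimately show ?thesis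
    using one_notin_E by (auto simp: mv_state_morphisms_def unit_maps_def eq)
qed

text \<open>Only the operations of \<open>M\<close> are known to be preserved, so products are
  computed below an idempotent \<open>a\<close> through \<open>emv_lam\<close>. As
  \<open>s a\<close> is 0 or 1, the interval formulas become those of the unit interval; De Morgan
  then settles the sums that involve complements.\<close>

lemma ext_morphism:
  assumes s: "s \<in> emv_state_morphisms M" shows "ext s \<in> mv_state_morphisms N"
proof -
  have s01: "0 \<le> s x" "s x \<le> 1" if "x \<in> E" for x
    using s that by (auto simp: emv_state_morphisms_def unit_maps_def)
  have plus: "s (x \<oplus> y) = min (s x + s y) 1" if "x \<in> E" "y \<in> E" for x y
    using s that by (auto simp: emv_state_morphisms_def restricted_ops)
  have lam: "s (b \<odot> \<sim>x) = s b - s x" if "b \<in> emv_idem M" "x \<in> E" "x \<preceq> b" for b x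
  proof -
    have "b \<in> E" using that by (simp add: emv_idem_iff)
    then have "emv_lam M b x = b \<odot> \<sim>x" "emv_le M x b" using that by (simp_all add: emv_lam_eq emv_le_eq)
    then show ?thesis using s that unfolding emv_state_morphisms_def by fastforce
  qed
  have zero: "s \<zero> = 0" using s by (simp add: emv_state_morphisms_def emv_zero_eq)
  have odot: "s (x \<odot> y) = max 0 (s x + s y - 1)" if x: "x \<in> E" and y: "y \<in> E" for x y
  proof -
    obtain a where a: "a \<in> emv_idem M" "x \<preceq> a" "y \<preceq> a" using below_idem2[OF x y] .
    then have aE: "a \<in> E" "a \<oplus> a = a" by (auto simp: emv_idem_iff)
    have "a \<odot> \<sim>x \<oplus> a \<odot> \<sim>y \<preceq> a \<oplus> a" using aE(1) x y by (intro plus_mono) auto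
    then have "a \<odot> \<sim>x \<oplus> a \<odot> \<sim>y \<preceq> a" using aE by simp
    then have "s (x \<odot> y) = s a - min (2 * s a - s x - s y) 1"
      using odot_below_idem[of a x y] lam[OF a(1), of "a \<odot> \<sim>x \<oplus> a \<odot> \<sim>y"]
        plus[of "a \<odot> \<sim>x" "a \<odot> \<sim>y"] lam[OF a(1) x a(2)] lam[OF a(1) y a(3)] aE x y a by auto
    moreover have "s a = 0 \<or> s a = 1"
      using plus[OF aE(1) aE(1)] aE(2) by (auto simp: min_def split: if_splits)
    moreover have "s x \<le> s a" "s y \<le> s a"
      using lam[OF a(1) x a(2)] lam[OF a(1) y a(3)] s01[of "a \<odot> \<sim>x"] s01[of "a \<odot> \<sim>y"] aE x y by auto
    ultimately show ?thesis using s01[OF x] s01[OF y] by (auto simp: min_def max_def)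
  qed
  have odot_neg: "s (x \<odot> \<sim>y) = max 0 (s x - s y)" if x: "x \<in> E" and y: "y \<in> E" for x y
  proof -
    obtain a where a: "a \<in> emv_idem M" "x \<preceq> a" "y \<preceq> a" using below_idem2[OF x y] .
    then have aE: "a \<in> E" "a \<oplus> a = a" by (auto simp: emv_idem_iff)
    \<comment> \<open>The factor \<open>\<sim>y\<close> lies outside \<open>M\<close>, but
      \<open>x \<odot> a = x\<close> lets \<open>a \<odot> \<sim>y\<close> take its place.\<close>
    have "x \<odot> (a \<odot> \<sim>y) = x \<odot> a \<odot> \<sim>y" using aE x y by (simp add: odot_assoc)
    also have "x \<odot> a = x"
    proof -
      have "x = a \<odot> (\<sim>a \<oplus> x)"
        using a aE x meet_comm[of a x] by (simp add: mv_le_def mv_meet_def)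
      then show ?thesis using idem_odot[of a] aE x odot_assoc[of a a "\<sim>a \<oplus> x"] odot_comm[of x a]
        by (metis E_carr neg_closed plus_closed)
    qed
    finally have "s (x \<odot> \<sim>y) = max 0 (s x + (s a - s y) - 1)"
      using odot[of x "a \<odot> \<sim>y"] lam[OF a(1) y a(3)] aE x y by simp
    moreover have "s a = 0 \<or> s a = 1"
      using plus[OF aE(1) aE(1)] aE(2) by (auto simp: min_def split: if_splits)
    moreover have "s x \<le> s a" "s y \<le> s a"
      using lam[OF a(1) x a(2)] lam[OF a(1) y a(3)] s01[of "a \<odot> \<sim>x"] s01[of "a \<odot> \<sim>y"] aE x y by auto
    ultimately show ?thesis using s01[OF x] s01[OF y] by (auto simp: min_def max_def)
  qed
  have mixed: "ext s (x \<oplus> \<sim>y) = min (ext s x + ext s (\<sim>y)) 1" if x: "x \<in> E" and y: "y \<in> E" for x y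
  proof -
    have "x \<oplus> \<sim>y = \<sim>(y \<odot> \<sim>x)" using x y plus_comm[of x "\<sim>y"] by (simp add: neg_odot)
    then show ?thesis using x y odot_neg[OF y x] by (simp add: min_def max_def)
  qed
  have "ext s (x \<oplus> y) = min (ext s x + ext s y) 1" if x: "x \<in> carr" and y: "y \<in> carr" for x y
  proof -
    consider "x \<in> E" "y \<in> E" | "x \<in> E" "y \<notin> E" | "x \<notin> E" "y \<in> E" | "x \<notin> E" "y \<notin> E" by blast
    then show ?thesis
    proof cases
      case 1
      then show ?thesis using plus by simp
    next
      case 2
      then show ?thesis using mixed[of x "\<sim>y"] y neg_in_E by simp
    next
      case 3
      then show ?thesis using mixed[of y "\<sim>x"] x y neg_in_E plus_comm[of x y] by simp
    next
      case 4
      then have n: "\<sim>x \<in> E" "\<sim>y \<in> E" using x y neg_in_E by auto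
      have "x \<oplus> y = \<sim>(\<sim>x \<odot> \<sim>y)" using x y by (simp add: neg_odot)
      then have "ext s (x \<oplus> y) = 1 - s (\<sim>x \<odot> \<sim>y)" using n ext_neg[of "\<sim>x \<odot> \<sim>y" s] by auto
      moreover have "ext s x = 1 - s (\<sim>x)" "ext s y = 1 - s (\<sim>y)" using 4 x y by (simp_all add: ext_def)
      ultimately show ?thesis using odot[OF n] by (simp add: min_def max_def)
    qed
  qed
  moreover have "ext s (\<sim>x) = 1 - ext s x" if "x \<in> carr" for x
    using neg_in_E[OF that] that by (cases "x \<in> E") (auto simp: ext_def neg_notin_E)
  moreover have "0 \<le> ext s x \<and> ext s x \<le> 1" if "x \<in> carr" for x
    using s01[of x] s01[of "\<sim>x"] neg_in_E[OF that] that by (auto simp: ext_def)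
  moreover have "ext s \<one> = 1" using zero ext_neg[of \<zero> s] by simp
  ultimately show ?thesis using zero by (auto simp: mv_state_morphisms_def unit_maps_def ext_def[of s])
qed

text \<open>The zero map is the restriction to \<open>M\<close> of the morphism with kernel \<open>M\<close>; adding it compactifies
  the space of state-morphisms.\<close>

abbreviation Z where "Z \<equiv> insert 0 (emv_state_morphisms M)"

lemma zero_notin_morphisms: "0 \<notin> emv_state_morphisms M"
  by (auto simp: emv_state_morphisms_def)

lemma Z_ext: "s \<in> Z \<Longrightarrow> ext s \<in> mv_state_morphisms N"
  using ext_morphism ext_zero_morphism by blast

lemma Z_unit: "s \<in> Z \<Longrightarrow> s \<in> unit_maps E"
  by (auto simp: emv_state_morphisms_def unit_maps_def)

lemma Z_eq: "Z = res ` mv_state_morphisms N"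
proof (intro equalityI subsetI)
  fix s assume s: "s \<in> Z"
  then have "s = res (ext s)" using res_ext Z_unit by simp
  then show "s \<in> res ` mv_state_morphisms N" using Z_ext[OF s] by blast
qed (use res_morphism in blast)

lemma compact_Z: "compact Z"
proof -
  have "continuous_on UNIV (\<lambda>t :: 'a \<Rightarrow> real. if x \<in> E then t x else 0)" for x
    by (cases "x \<in> E") (simp_all add: continuous_on_coordinate)
  then have "continuous_on UNIV res" unfolding res_def
    by (intro continuous_on_coordinatewise_then_product)
  then show ?thesis
    unfolding Z_eq using compact_state_morphisms compact_continuous_image continuous_on_subset by blast
qed

text \<open>Affine isomorphisms preserve extreme points, and restriction sends the morphisms of
  \<open>N\<close>, its extreme states, onto the state-morphisms of \<open>M\<close> together with
  the zero map.\<close>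

lemma extreme_pre_states: "{s. s extreme_point_of pre_states M} = Z"
proof (intro equalityI subsetI)
  fix s assume "s \<in> {s. s extreme_point_of pre_states M}"
  then have s: "s \<in> pre_states M" "s extreme_point_of pre_states M" by (auto simp: extreme_point_of_def)
  then have "ext s \<in> mv_state_morphisms N"
    using affine_iso_extreme_point[OF affine_iso_ext convex_pre_states] extreme_state_iff by blast
  moreover have "s = res (ext s)" using res_ext pre_states_unit s by simp
  ultimately show "s \<in> Z" unfolding Z_eq by blast
next
  fix s assume s: "s \<in> Z"
  then have "ext s extreme_point_of mv_states N" using Z_ext extreme_state_iff by blast
  moreover have "s = res (ext s)" using res_ext Z_unit[OF s] by simp
  then have "s \<in> pre_states M" using res_state morphism_state Z_ext[OF s] by metis
  ultimately show "s \<in> {s. s extreme_point_of pre_states M}"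
    using affine_iso_extreme_point[OF affine_iso_ext convex_pre_states] by blast
qed

lemma bauer_pre_states: "bauer_simplex (pre_states M)"
  unfolding bauer_simplex_def extreme_pre_states
  using simplex_pre_states compact_pre_states compact_Z by simp

text \<open>All of \<open>N\<close> remains the index set although the points are maps on
  \<open>M\<close>: the elements of \<open>M\<close> alone are not closed under complements, and
  \<open>ext\<close> supplies the missing values.\<close>

sublocale Z: separating_clan Z carr "\<lambda>x s. ext s x"
proof
  fix x t assume "x \<in> carr" "t \<in> Z"
  then show "0 \<le> ext t x \<and> ext t x \<le> 1"
    using spectrum.clan_range[of x "ext t"] Z_ext by (simp add: evaluation_def)
next
  show "carr \<noteq> {}" using one_closed by blast
next
  fix x assume "x \<in> carr"
  then show "\<exists>u\<in>carr. \<forall>t\<in>Z. ext t u = 1 - ext t x"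
    using spectrum.clan_neg[of x] Z_ext unfolding evaluation_def by blast
next
  fix x y assume "x \<in> carr" "y \<in> carr"
  then show "\<exists>u\<in>carr. \<forall>t\<in>Z. ext t u = min 1 (ext t x + ext t y)"
    using spectrum.clan_plus[of x y] Z_ext unfolding evaluation_def by blast
next
  show "compact Z" by (rule compact_Z)
next
  fix x show "continuous_on Z (\<lambda>s. ext s x)"
    by (cases "x \<in> E"; cases "x \<in> carr")
       (auto simp: ext_def intro!: continuous_intros continuous_on_coordinate)
next
  fix s t assume st: "s \<in> Z" "t \<in> Z" "s \<noteq> t"
  then obtain x where x: "s x \<noteq> t x" by (auto simp: fun_eq_iff)
  have "r x = 0" if "r \<in> Z" "x \<notin> E" for r using Z_unit[OF that(1)] that(2) by (simp add: unit_maps_def)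
  then have "x \<in> E" using st x by metis
  then show "\<exists>x\<in>carr. ext s x \<noteq> ext t x" using x by (intro bexI[of _ x]) auto
qed

lemma ext_functional_Z:
  assumes s: "s \<in> pre_states M"
  shows "clan_functional Z carr (\<lambda>x s. ext s x) (ext s)"
proof unfold_locales
  fix xs :: "(real \<times> 'a) list" and b
  assume b: "\<And>t. t \<in> Z \<Longrightarrow> (\<Sum>(c, x)\<leftarrow>xs. c * ext t x) \<le> b"
  show "(\<Sum>(c, x)\<leftarrow>xs. c * ext s x) \<le> b"
  proof (rule state_dominated[OF ext_state[OF s]])
    fix h assume h: "h \<in> mv_state_morphisms N"
    then have "h = ext (res h)" using ext_res morphism_state by simp
    then show "(\<Sum>(c, x)\<leftarrow>xs. c * h x) \<le> b" using b[of "res h"] res_morphism[OF h] by simp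
  qed
qed

section \<open>Existence and uniqueness of the representing measures\<close>

lemma spectral_measure_exists_unique:
  assumes s: "s \<in> pre_states M"
  shows "\<exists>!\<mu>. regular_borel_measure (mv_state_morphisms N) \<mu> \<and> prob_space \<mu>
            \<and> (\<forall>x\<in>E. has_bochner_integral \<mu> (evaluation x) (s x))"
proof -
  interpret T: clan_functional "mv_state_morphisms N" carr evaluation "ext s"
    using state_clan_functional ext_state[OF s] by blast
  \<comment> \<open>Uniqueness on the clan refers to all elements of \<open>N\<close>. At the
    complement of an element of \<open>M\<close> the integral is forced by the total mass 1.\<close>
  have full: "\<forall>x\<in>carr. has_bochner_integral \<mu> (evaluation x) (ext s x)"
    if \<mu>: "regular_borel_measure (mv_state_morphisms N) \<mu>" "prob_space \<mu>"
      "\<forall>x\<in>E. has_bochner_integral \<mu> (evaluation x) (s x)" for \<mu>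
  proof
    fix x assume x: "x \<in> carr"
    interpret prob_space \<mu> by fact
    have sp: "space \<mu> = mv_state_morphisms N"
      using \<mu>(1) by (auto simp: regular_borel_measure_def space_restrict_space dest!: sets_eq_imp_space_eq)
    show "has_bochner_integral \<mu> (evaluation x) (ext s x)"
    proof (cases "x \<in> E")
      case True
      then show ?thesis using \<mu>(3) by simp
    next
      case False
      then have n: "\<sim>x \<in> E" using neg_in_E x by blast
      have "has_bochner_integral \<mu> (\<lambda>t. 1 - evaluation (\<sim>x) t) (1 - s (\<sim>x))"
        using \<mu>(3) n by (intro has_bochner_integral_diff) (auto simp: has_bochner_integral_iff prob_space)
      moreover have "evaluation x t = 1 - evaluation (\<sim>x) t" if "t \<in> space \<mu>" for t
        using that x by (auto simp: sp evaluation_def mv_state_morphisms_def)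
      ultimately show ?thesis
        using has_bochner_integral_cong[of \<mu> \<mu> "evaluation x" "\<lambda>t. 1 - evaluation (\<sim>x) t"] x False
        by (simp add: ext_def)
    qed
  qed
  show ?thesis
  proof (rule ex1I)
    show "regular_borel_measure (mv_state_morphisms N) T.content_measure \<and> prob_space T.content_measure
        \<and> (\<forall>x\<in>E. has_bochner_integral T.content_measure (evaluation x) (s x))"
      using T.regular_content_measure T.prob_content_measure T.content_measure_represents by fastforce
    then have *: "\<forall>x\<in>carr. has_bochner_integral T.content_measure (evaluation x) (ext s x)"
      using full by blast
    fix \<mu> assume "regular_borel_measure (mv_state_morphisms N) \<mu> \<and> prob_space \<mu>
        \<and> (\<forall>x\<in>E. has_bochner_integral \<mu> (evaluation x) (s x))"
    then show "\<mu> = T.content_measure"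
      using full spectrum.represented_measure_unique[OF _ _ T.regular_content_measure *] by blast
  qed
qed

lemma openin_morphisms: "openin (top_of_set Z) (emv_state_morphisms M)"
  using zero_notin_morphisms by (auto simp: openin_open intro!: exI[of _ "- {0}"])

text \<open>The integrals are known for elements of \<open>M\<close> only. An element separating
  \<open>K\<close> from \<open>Z - U\<close> is 0 at the zero map, which \<open>U\<close> avoids,
  whereas \<open>ext 0\<close> is 1 off \<open>M\<close>; so the separating element belongs to
  \<open>M\<close>.\<close>

lemma morphism_measure_unique:
  assumes \<mu>: "regular_borel_measure (emv_state_morphisms M) \<mu>" "\<forall>x\<in>E. has_bochner_integral \<mu> (evaluation x) (s x)"
    and \<nu>: "regular_borel_measure (emv_state_morphisms M) \<nu>" "\<forall>x\<in>E. has_bochner_integral \<nu> (evaluation x) (s x)"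
  shows "\<mu> = \<nu>"
proof (rule regular_borel_measure_unique[OF \<mu>(1) \<nu>(1)])
  fix K U assume K: "compact K" "K \<subseteq> U" and U: "openin (top_of_set (emv_state_morphisms M)) U"
  have UY: "U \<subseteq> emv_state_morphisms M" using openin_imp_subset[OF U] .
  have "openin (top_of_set Z) U" using openin_trans[OF U openin_morphisms] .
  then obtain O' where "open O'" "U = Z \<inter> O'" by (auto simp: openin_open)
  then have "Z - U = Z - O'" "open O'" by auto
  then have "compact (Z - U)" using compact_Z compact_diff by metis
  then obtain u where u: "u \<in> carr" "\<forall>t\<in>K. ext t u = 1" "\<forall>t\<in>Z - U. ext t u = 0"
    using Z.separate_compacts[of K "Z - U"] K UY by blast
  have "0 \<in> Z - U" using UY zero_notin_morphisms by auto
  then have "ext 0 u = 0" using u(3) by blast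
  then have uE: "u \<in> E" using u(1) by (simp add: ext_def split: if_splits)
  show "\<exists>(f :: ('a \<Rightarrow> real) \<Rightarrow> real) r. has_bochner_integral \<mu> f r \<and> has_bochner_integral \<nu> f r
      \<and> (\<forall>t\<in>emv_state_morphisms M. 0 \<le> f t \<and> f t \<le> 1) \<and> (\<forall>t\<in>K. f t = 1)
      \<and> (\<forall>t\<in>emv_state_morphisms M - U. f t = 0)"
  proof (intro exI[of _ "evaluation u"] exI[of _ "s u"] conjI)
    show "\<forall>t\<in>emv_state_morphisms M. 0 \<le> evaluation u t \<and> evaluation u t \<le> 1"
      using uE by (auto simp: evaluation_def emv_state_morphisms_def unit_maps_def)
  qed (use \<mu> \<nu> uE u in \<open>auto simp: evaluation_def\<close>)
qed

text \<open>The representing measure on the compact \<open>Z\<close> is restricted to the complement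
  of the zero map. Dropping the mass at that point changes no integral, as every element of
  \<open>M\<close> vanishes there.\<close>

lemma morphism_measure_exists:
  assumes s: "s \<in> pre_states M"
  shows "\<exists>\<mu>. regular_borel_measure (emv_state_morphisms M) \<mu>
    \<and> (\<forall>x\<in>E. has_bochner_integral \<mu> (evaluation x) (s x))"
proof -
  interpret T: clan_functional Z carr "\<lambda>x s. ext s x" "ext s" by (rule ext_functional_Z[OF s])
  let ?Y = "emv_state_morphisms M"
  let ?\<nu> = "T.content_measure"
  have Y: "?Y \<in> sets ?\<nu>" using T.opens_sets openin_morphisms by simp
  have sets: "sets (restrict_space ?\<nu> ?Y) = sets (restrict_space borel ?Y)"
    unfolding sets_restrict_space[of _ ?Y] T.sets_content_measure
    by (auto simp: sets_restrict_space image_image Int_absorb1 Int_assoc[symmetric])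
  have em: "emeasure (restrict_space ?\<nu> ?Y) B = emeasure ?\<nu> B" if "B \<subseteq> ?Y" for B
    using that Y by (intro emeasure_restrict_space) (simp_all add: sets.Int_space_eq2)
  have "regular_borel_measure ?Y (restrict_space ?\<nu> ?Y)"
    unfolding regular_borel_measure_def
  proof (intro conjI ballI)
    fix B assume "B \<in> sets (restrict_space ?\<nu> ?Y)"
    then have B: "B \<in> sets ?\<nu>" "B \<subseteq> ?Y" using Y by (auto simp: sets_restrict_space)
    have eq: "(INF U\<in>{U. openin (top_of_set Z) U \<and> B \<subseteq> U}. emeasure ?\<nu> U) = emeasure ?\<nu> B"
      "emeasure ?\<nu> B = (SUP C\<in>{C. compact C \<and> C \<subseteq> B}. emeasure ?\<nu> C)"
      using T.regular_content_measure B(1) by (auto simp: regular_borel_measure_def)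
    \<comment> \<open>Sets open in the subspace are open in \<open>Z\<close>, and open supersets in
      \<open>Z\<close> can be cut down to the subspace, so the two infima agree.\<close>
    have "(INF U\<in>{U. openin (top_of_set ?Y) U \<and> B \<subseteq> U}. emeasure ?\<nu> U)
        = (INF U\<in>{U. openin (top_of_set Z) U \<and> B \<subseteq> U}. emeasure ?\<nu> U)"
    proof (rule antisym)
      show "(INF U\<in>{U. openin (top_of_set ?Y) U \<and> B \<subseteq> U}. emeasure ?\<nu> U)
        \<le> (INF U\<in>{U. openin (top_of_set Z) U \<and> B \<subseteq> U}. emeasure ?\<nu> U)"
      proof (rule INF_mono)
        fix V assume V: "V \<in> {U. openin (top_of_set Z) U \<and> B \<subseteq> U}"
        then have "openin (top_of_set ?Y) (V \<inter> ?Y)" by (auto simp: openin_open)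
        moreover have "emeasure ?\<nu> (V \<inter> ?Y) \<le> emeasure ?\<nu> V"
          using V T.opens_sets by (intro emeasure_mono) auto
        ultimately show "\<exists>U\<in>{U. openin (top_of_set ?Y) U \<and> B \<subseteq> U}. emeasure ?\<nu> U \<le> emeasure ?\<nu> V"
          using V B(2) by (intro bexI[of _ "V \<inter> ?Y"]) auto
      qed
      show "(INF U\<in>{U. openin (top_of_set Z) U \<and> B \<subseteq> U}. emeasure ?\<nu> U)
        \<le> (INF U\<in>{U. openin (top_of_set ?Y) U \<and> B \<subseteq> U}. emeasure ?\<nu> U)"
        using openin_trans[OF _ openin_morphisms] by (intro INF_superset_mono) auto
    qed
    moreover have "(INF U\<in>{U. openin (top_of_set ?Y) U \<and> B \<subseteq> U}. emeasure (restrict_space ?\<nu> ?Y) U)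
        = (INF U\<in>{U. openin (top_of_set ?Y) U \<and> B \<subseteq> U}. emeasure ?\<nu> U)"
      using openin_imp_subset by (intro INF_cong em) auto
    ultimately show "(INF U\<in>{U. openin (top_of_set ?Y) U \<and> B \<subseteq> U}. emeasure (restrict_space ?\<nu> ?Y) U)
        = emeasure (restrict_space ?\<nu> ?Y) B"
      using eq(1) em[OF B(2)] by simp
    have "(SUP C\<in>{C. compact C \<and> C \<subseteq> B}. emeasure (restrict_space ?\<nu> ?Y) C)
        = (SUP C\<in>{C. compact C \<and> C \<subseteq> B}. emeasure ?\<nu> C)"
      using B(2) by (intro SUP_cong em) auto
    then show "emeasure (restrict_space ?\<nu> ?Y) B
        = (SUP C\<in>{C. compact C \<and> C \<subseteq> B}. emeasure (restrict_space ?\<nu> ?Y) C)"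
      using eq(2) em[OF B(2)] by simp
  qed (rule sets)
  moreover have "has_bochner_integral (restrict_space ?\<nu> ?Y) (evaluation x) (s x)" if x: "x \<in> E" for x
  proof -
    have "has_bochner_integral ?\<nu> (\<lambda>t. ext t x) (s x)"
      using T.content_measure_represents[of x] x by simp
    moreover have "indicator ?Y t *\<^sub>R evaluation x t = ext t x" if "t \<in> space ?\<nu>" for t
      using that x zero_notin_morphisms by (auto simp: T.space_content_measure evaluation_def indicator_def)
    ultimately have "has_bochner_integral ?\<nu> (\<lambda>t. indicator ?Y t *\<^sub>R evaluation x t) (s x)"
      using has_bochner_integral_cong[of ?\<nu> ?\<nu> "\<lambda>t. indicator ?Y t *\<^sub>R evaluation x t" "\<lambda>t. ext t x"] by simp
    then show ?thesis
      using Y by (subst has_bochner_integral_restrict_space) auto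
  qed
  ultimately show ?thesis by blast
qed

end

theorem theorem7p7:
  fixes M :: "'a emv" and N :: "'a mv"
  assumes "emv_algebra M"
    and "\<not> emv_has_top M"
    and "mv_algebra N"
    and "mv_represents N M"
  shows "bauer_simplex (pre_states M)
    \<and> (\<forall>x\<in>emv_carrier M. continuous_on (mv_states N) (evaluation x)
          \<and> evaluation x ` mv_states N \<subseteq> {0..1})
    \<and> (\<forall>x\<in>emv_carrier M. continuous_on (pre_states M) (evaluation x)
          \<and> evaluation x ` pre_states M \<subseteq> {0..1}
          \<and> (\<forall>t\<in>pre_states M. \<forall>t'\<in>pre_states M. \<forall>u\<in>{0..1}.
               evaluation x ((1 - u) *\<^sub>R t + u *\<^sub>R t')
                 = (1 - u) * evaluation x t + u * evaluation x t'))
    \<and> (\<forall>s\<in>pre_states M.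
         (\<exists>!\<mu>. regular_borel_measure (mv_state_morphisms N) \<mu> \<and> prob_space \<mu>
            \<and> (\<forall>x\<in>emv_carrier M. has_bochner_integral \<mu> (evaluation x) (s x)))
       \<and> (\<exists>!\<mu>. regular_borel_measure (emv_state_morphisms M) \<mu>
            \<and> (\<forall>x\<in>emv_carrier M. has_bochner_integral \<mu> (evaluation x) (s x))))"
proof -
  interpret represented_emv N M
    using assms by (intro represented_emv.intro represented_emv_axioms.intro)
  have cont: "continuous_on S (evaluation x)" for S and x :: 'a
    unfolding evaluation_def by (rule continuous_on_coordinate)
  show ?thesis
  proof (intro conjI ballI)
    show "bauer_simplex (pre_states M)" by (rule bauer_pre_states)
    fix x assume x: "x \<in> emv_carrier M"
    show "evaluation x ` mv_states N \<subseteq> {0..1}"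
      using x by (auto simp: evaluation_def mv_states_def unit_maps_def)
    show "evaluation x ` pre_states M \<subseteq> {0..1}"
      using x by (auto simp: evaluation_def pre_states_def unit_maps_def)
    show "evaluation x ((1 - u) *\<^sub>R t + u *\<^sub>R t') = (1 - u) * evaluation x t + u * evaluation x t'" for t t' u
      by (simp add: evaluation_def scaleR_fun_def)
  next
    fix s assume s: "s \<in> pre_states M"
    show "\<exists>!\<mu>. regular_borel_measure (mv_state_morphisms N) \<mu> \<and> prob_space \<mu>
            \<and> (\<forall>x\<in>emv_carrier M. has_bochner_integral \<mu> (evaluation x) (s x))"
      by (rule spectral_measure_exists_unique[OF s])
    show "\<exists>!\<mu>. regular_borel_measure (emv_state_morphisms M) \<mu>
            \<and> (\<forall>x\<in>emv_carrier M. has_bochner_integral \<mu> (evaluation x) (s x))"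
      using morphism_measure_exists[OF s] morphism_measure_unique by (auto intro!: ex_ex1I)
  qed (rule cont)+
qed

end
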